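(* Let $(\bar M,g)$ be a compact connected smooth Riemannian manifold of dimension $n\geq 3$ with nonempty smooth boundary $\partial M$. Let $\Gamma\subset\mathbb{R}^n$ be an open, symmetric, convex cone with vertex at the origin, with $\partial\Gamma\neq\emptyset$ and $\Gamma_n\subseteq\Gamma$, where $\Gamma_n=\{\lambda\in\mathbb{R}^n: \lambda_i>0 \text{ for all } i\}$. Let $\varrho_\Gamma$ be the constant determined by $(1,\dots,1,1-\varrho_\Gamma)\in\partial\Gamma$. (1) If $\varrho_\Gamma>2$, then there exists $u\in C^\infty(\bar M)$ such that the conformal metric $g_u=e^{2u}g$ satisfies $$\lambda(-g^{-1}A_{g_u})\in\Gamma\quad\text{in }\bar M.$$ (2) If $\Gamma$ is of type 2, then the same conclusion (existence of $u\in C^\infty(\bar M)$ with $\lambda(-g^{-1}A_{g_u})\in\Gamma$ in $\bar M$) holds whenever $\varrho_\Gamma\geq 2$.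
   Context: $\bar M=M\cup\partial M$ denotes the compact manifold including its boundary, and $g$ is smooth up to the boundary; $C^\infty(\bar M)$ denotes real-valued functions smooth up to the boundary. A cone $\Gamma\subset\mathbb{R}^n$ is symmetric if it is invariant under permutations of coordinates. Such a cone $\Gamma$ is of type 1 if $(0,\dots,0,1)\in\partial\Gamma$, and of type 2 otherwise. For a Riemannian metric $g$ with Ricci tensor $Ric_g$ and scalar curvature $R_g$, the Schouten tensor is $$A_g=\frac{1}{n-2}\left(Ric_g-\frac{1}{2(n-1)}R_g\, g\right).$$ For a symmetric $2$-tensor $B$, $\lambda(g^{-1}B)=(\lambda_1,\dots,\lambda_n)$ denotes the vector of eigenvalues of $B$ with respect to $g$ at a given point (the order is irrelevant since $\Gamma$ is symmetric), and $\lambda(-g^{-1}A_{g_u})=\lambda(g^{-1}(-A_{g_u}))$. "In $\bar M$" means at every point of $\bar M$. *)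

theory Defs
  imports "HOL-Analysis.Analysis"
begin

section \<open>Smooth functions on relatively open subsets of a half-space\<close>

text \<open>
  All derivatives are taken within the set S. In the uses below S is open, or relatively open in a
  closed coordinate half-space, so the derivative within S is unique; at a boundary point it is
  the one-sided derivative. Smoothness is thus the existence and continuity of the partial
  derivatives of every order up to the boundary.
\<close>

definition partial :: "'n::finite \<Rightarrow> (real^'n) set \<Rightarrow> (real^'n \<Rightarrow> 'b::real_normed_vector) \<Rightarrow> real^'n \<Rightarrow> 'b"
  where "partial i S f x = frechet_derivative f (at x within S) (axis i 1)"

primrec Ck_on :: "nat \<Rightarrow> (real^'n::finite) set \<Rightarrow> (real^'n \<Rightarrow> 'b::real_normed_vector) \<Rightarrow> bool"
  where
    "Ck_on 0 S f \<longleftrightarrow> continuous_on S f"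
  | "Ck_on (Suc k) S f \<longleftrightarrow> f differentiable_on S \<and> (\<forall>i. Ck_on k S (partial i S f))"

definition smooth_on :: "(real^'n::finite) set \<Rightarrow> (real^'n \<Rightarrow> 'b::real_normed_vector) \<Rightarrow> bool"
  where "smooth_on S f \<longleftrightarrow> (\<forall>k. Ck_on k S f)"


section \<open>Smooth manifolds with boundary\<close>

text \<open>
  A chart is a pair of its domain and the coordinate map. The half-space of a chart may be
  bounded by any coordinate hyperplane; permuting coordinates reduces this to a fixed one.
\<close>

type_synonym ('a, 'n) chart = "'a set \<times> ('a \<Rightarrow> real^'n)"

definition is_chart :: "'a topology \<Rightarrow> ('a, 'n::finite) chart \<Rightarrow> bool"
  where "is_chart X = (\<lambda>(U, \<phi>).
    openin X U \<and>
    (open (\<phi> ` U) \<or> (\<exists>k. openin (top_of_set {x. 0 \<le> x $ k}) (\<phi> ` U))) \<and>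
    homeomorphic_map (subtopology X U) (top_of_set (\<phi> ` U)) \<phi>)"

definition transition :: "('a, 'n) chart \<Rightarrow> ('a, 'n) chart \<Rightarrow> real^'n::finite \<Rightarrow> real^'n"
  where "transition = (\<lambda>(U, \<phi>) (V, \<psi>). \<psi> \<circ> inv_into U \<phi>)"

definition smooth_manifold_with_boundary :: "'a topology \<Rightarrow> ('a, 'n::finite) chart set \<Rightarrow> bool"
  where "smooth_manifold_with_boundary X \<A> \<longleftrightarrow>
    Hausdorff_space X \<and> second_countable X \<and>
    (\<forall>c\<in>\<A>. is_chart X c) \<and>
    (\<Union>c\<in>\<A>. fst c) = topspace X \<and>
    (\<forall>c\<in>\<A>. \<forall>d\<in>\<A>. smooth_on (snd c ` (fst c \<inter> fst d)) (transition c d))"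

text \<open>
  A relatively open subset of a half-space meets the bounding hyperplane exactly in the points
  that are not interior to it in Euclidean space.
\<close>

definition manifold_boundary :: "('a, 'n::finite) chart set \<Rightarrow> 'a set"
  where "manifold_boundary \<A> = {p. \<exists>(U, \<phi>)\<in>\<A>. p \<in> U \<and> \<phi> p \<notin> interior (\<phi> ` U)}"

definition smooth_function :: "('a, 'n::finite) chart set \<Rightarrow> ('a \<Rightarrow> real) \<Rightarrow> bool"
  where "smooth_function \<A> u \<longleftrightarrow> (\<forall>(U, \<phi>)\<in>\<A>. smooth_on (\<phi> ` U) (u \<circ> inv_into U \<phi>))"


section \<open>Riemannian metrics and curvature\<close>

text \<open>
  A covariant 2-tensor field is given by its component matrix in each chart, as a function of the
  point. Being a tensor is the transformation law under change of charts.
\<close>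

type_synonym ('a, 'n) tensor2 = "('a, 'n) chart \<Rightarrow> 'a \<Rightarrow> real^'n^'n"

definition smooth_tensor2 :: "('a, 'n::finite) chart set \<Rightarrow> ('a, 'n) tensor2 \<Rightarrow> bool"
  where "smooth_tensor2 \<A> g \<longleftrightarrow>
    (\<forall>c\<in>\<A>. smooth_on (snd c ` fst c) (g c \<circ> inv_into (fst c) (snd c))) \<and>
    (\<forall>c\<in>\<A>. \<forall>d\<in>\<A>. \<forall>p\<in>fst c \<inter> fst d.
      let J = jacobian (transition c d) (at (snd c p) within snd c ` (fst c \<inter> fst d))
      in g c p = transpose J ** g d p ** J)"

definition riemannian_metric :: "('a, 'n::finite) chart set \<Rightarrow> ('a, 'n) tensor2 \<Rightarrow> bool"
  where "riemannian_metric \<A> g \<longleftrightarrow> smooth_tensor2 \<A> g \<and>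
    (\<forall>c\<in>\<A>. \<forall>p\<in>fst c. transpose (g c p) = g c p \<and> (\<forall>v. v \<noteq> 0 \<longrightarrow> v \<bullet> (g c p *v v) > 0))"

definition conformal :: "('a \<Rightarrow> real) \<Rightarrow> ('a, 'n::finite) tensor2 \<Rightarrow> ('a, 'n) tensor2"
  where "conformal u g c p = exp (2 * u p) *\<^sub>R g c p"

text \<open>
  In the following coordinate expressions, h is the component matrix of the metric as a function
  of the coordinates in S. The sign and index conventions are

    nabla_i d_j = sum over k of (christoffel S h k i j) d_k,
    R(d_i, d_j) d_k = sum over l of (riemann S h l k i j) d_l,
    Ric(Y, Z) = trace of the map sending X to R(X, Y) Z,

  so that round spheres have positive Ricci curvature.
\<close>

definition christoffel ::
  "(real^'n::finite) set \<Rightarrow> (real^'n \<Rightarrow> real^'n^'n) \<Rightarrow> 'n \<Rightarrow> 'n \<Rightarrow> 'n \<Rightarrow> real^'n \<Rightarrow> real"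
  where "christoffel S h k i j x =
    (1/2) * (\<Sum>l\<in>UNIV. matrix_inv (h x) $ k $ l *
      (partial i S (\<lambda>y. h y $ j $ l) x + partial j S (\<lambda>y. h y $ i $ l) x
        - partial l S (\<lambda>y. h y $ i $ j) x))"

definition riemann ::
  "(real^'n::finite) set \<Rightarrow> (real^'n \<Rightarrow> real^'n^'n) \<Rightarrow> 'n \<Rightarrow> 'n \<Rightarrow> 'n \<Rightarrow> 'n \<Rightarrow> real^'n \<Rightarrow> real"
  where "riemann S h l k i j x =
    partial i S (christoffel S h l j k) x - partial j S (christoffel S h l i k) x
    + (\<Sum>m\<in>UNIV. christoffel S h l i m x * christoffel S h m j k x
                 - christoffel S h l j m x * christoffel S h m i k x)"

definition ricci :: "(real^'n::finite) set \<Rightarrow> (real^'n \<Rightarrow> real^'n^'n) \<Rightarrow> real^'n \<Rightarrow> real^'n^'n"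
  where "ricci S h x = (\<chi> j k. \<Sum>i\<in>UNIV. riemann S h i k i j x)"

definition scalar_curvature :: "(real^'n::finite) set \<Rightarrow> (real^'n \<Rightarrow> real^'n^'n) \<Rightarrow> real^'n \<Rightarrow> real"
  where "scalar_curvature S h x =
    (\<Sum>i\<in>UNIV. \<Sum>j\<in>UNIV. matrix_inv (h x) $ i $ j * ricci S h x $ i $ j)"

definition schouten :: "(real^'n::finite) set \<Rightarrow> (real^'n \<Rightarrow> real^'n^'n) \<Rightarrow> real^'n \<Rightarrow> real^'n^'n"
  where "schouten S h x =
    (1 / (real CARD('n) - 2)) *\<^sub>R
      (ricci S h x - (1 / (2 * (real CARD('n) - 1)) * scalar_curvature S h x) *\<^sub>R h x)"

definition schouten_tensor :: "('a, 'n::finite) tensor2 \<Rightarrow> ('a, 'n) tensor2"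
  where "schouten_tensor g = (\<lambda>(U, \<phi>) p. schouten (\<phi> ` U) (g (U, \<phi>) \<circ> inv_into U \<phi>) (\<phi> p))"


section \<open>Eigenvalues and cones\<close>

text \<open>The eigenvalues are listed with multiplicity, in any order.\<close>

definition eigenvalue_vector :: "real^'n^'n \<Rightarrow> real^'n::finite \<Rightarrow> bool"
  where "eigenvalue_vector A v \<longleftrightarrow> (\<forall>t. det (mat t - A) = (\<Prod>i\<in>UNIV. t - v $ i))"

definition eigenvalues_in ::
  "('a, 'n::finite) chart set \<Rightarrow> ('a, 'n) tensor2 \<Rightarrow> ('a, 'n) tensor2 \<Rightarrow> (real^'n) set \<Rightarrow> 'a \<Rightarrow> bool"
  where "eigenvalues_in \<A> g B \<Gamma> p \<longleftrightarrow>
    (\<forall>c\<in>\<A>. p \<in> fst c \<longrightarrow> (\<exists>v\<in>\<Gamma>. eigenvalue_vector (matrix_inv (g c p) ** B c p) v))"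

definition symmetric_set :: "(real^'n::finite) set \<Rightarrow> bool"
  where "symmetric_set \<Gamma> \<longleftrightarrow> (\<forall>\<pi>. \<pi> permutes UNIV \<longrightarrow> (\<forall>x\<in>\<Gamma>. (\<chi> i. x $ \<pi> i) \<in> \<Gamma>))"

text \<open>
  The library's cone and conic require a nonempty cone to contain its vertex, which excludes the
  proper open cones meant here.
\<close>

definition open_cone :: "(real^'n::finite) set \<Rightarrow> bool"
  where "open_cone \<Gamma> \<longleftrightarrow> open \<Gamma> \<and> (\<forall>x\<in>\<Gamma>. \<forall>t>0. t *\<^sub>R x \<in> \<Gamma>)"

definition positive_cone :: "(real^'n::finite) set"
  where "positive_cone = {x. \<forall>i. x $ i > 0}"

text \<open>
  The index type carries no order, hence has no last coordinate. The next two notions are applied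
  to symmetric sets only, for which the choice of the distinguished coordinate k is immaterial.
\<close>

definition type1_cone :: "(real^'n::finite) set \<Rightarrow> bool"
  where "type1_cone \<Gamma> \<longleftrightarrow> (\<exists>k. axis k 1 \<in> frontier \<Gamma>)"

definition type2_cone :: "(real^'n::finite) set \<Rightarrow> bool"
  where "type2_cone \<Gamma> \<longleftrightarrow> \<not> type1_cone \<Gamma>"

definition is_varrho :: "(real^'n::finite) set \<Rightarrow> real \<Rightarrow> bool"
  where "is_varrho \<Gamma> \<rho> \<longleftrightarrow> (\<exists>k. (\<chi> i. if i = k then 1 - \<rho> else 1) \<in> frontier \<Gamma>)"

end

theory Submission
  imports Defs
begin

text \<open>
  Let v be a nonnegative smooth function without critical points and u = exp (N v). The
  eigenvalues of minus the Schouten tensor of exp (2 u) g with respect to g are, in a g-orthonormal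
  frame that diagonalises it,

    a (m / 2 - p_i) + b p_i + lower order terms,

  where p_i is the square of the i-th component of dv, m = sum of the p_i = |dv|^2,
  a = N^2 exp (2 N v) and b = N^2 exp (N v), and the lower order terms are O(N exp (N v)). The vector
  (m / 2 - p_i) is a nonnegative combination of the permutations of (1, ..., 1, -1) / 2, and (p_i) one
  of the coordinate vectors. If varrho > 2 the former lie in the cone, and if the cone is of type
  2 the latter do; all of them always lie in its closure. Hence the sum lies in the cone for large N.

  To find v, take a function with nondegenerate, hence finitely many, critical points. The points p
  that are missed by some injective local diffeomorphism of the manifold into itself form a set that
  is open and closed: points of one coordinate ball are moved into each other, and points near the
  boundary are missed after pushing the manifold inwards. By connectedness it is the whole manifold.
  Composing with a map that misses a critical point lowers the number of critical points.
\<close>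

section \<open>Calculus on half-space domains\<close>

text \<open>At a critical point of \<open>v\<close> the leading terms vanish and nothing outweighs
  the Schouten tensor of \<open>g\<close>. Hence \<open>v\<close> must have none, which requires the
  boundary: on a nonempty compact manifold without boundary every function has critical points. The
  choice u = N v would give only the term m / 2 - p_i, which for \<rho> = 2 may lie on the boundary
  of the cone and leaves no room for errors. The exponential adds, through the Hessian, the square
  of dv with coefficient b; for type 2 this points into the interior, and it exceeds the errors by a
  factor of order N. The value 2 is built into m / 2 - p_i: a covector along one frame direction
  gives a multiple of (1, ..., 1, -1), which is (1, ..., 1, 1 - \<rho>) for \<rho> = 2.
  Nonnegativity of \<open>v\<close> gives a \<ge> b. The eigenvalue condition is demanded in every
  chart, but the estimate is made in one chart per coordinate ball; this is why the curvature has to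
  be transformed under changes of charts, up to the boundary.\<close>

definition smooth_domain :: "(real^'n::finite) set \<Rightarrow> bool"
  where "smooth_domain S \<longleftrightarrow> open S \<or> (\<exists>k. openin (top_of_set {x. 0 \<le> x $ k}) S)"

lemma smooth_domainE:
  assumes "smooth_domain S"
  obtains T where "open T" "S = T" | T k where "open T" "S = T \<inter> {x. 0 \<le> x $ k}"
  using assms unfolding smooth_domain_def openin_open by blast

lemma smooth_domain_Int:
  assumes "smooth_domain S" "open N"
  shows "smooth_domain (S \<inter> N)"
  using assms(1)
proof (cases rule: smooth_domainE)
  case (1 T)
  then show ?thesis using assms(2) by (simp add: smooth_domain_def open_Int)
next
  case (2 T k)
  then have "S \<inter> N = {x. 0 \<le> x $ k} \<inter> (T \<inter> N)" by auto
  moreover have "open (T \<inter> N)" using 2 assms by (simp add: open_Int)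
  ultimately show ?thesis unfolding smooth_domain_def openin_open by blast
qed

lemma smooth_domain_openin:
  assumes "smooth_domain S" "openin (top_of_set S) T"
  shows "smooth_domain T"
  using assms smooth_domain_Int unfolding openin_open by blast

text \<open>This is the condition under which a derivative within a set is unique: from every point
  one can move a little along each axis. A small positive step works, because it does not lower the
  coordinate that bounds the half-space.\<close>

lemma smooth_domain_direction:
  fixes x :: "real^'n::finite"
  assumes "smooth_domain S" "x \<in> S" "0 < e"
  shows "\<exists>d. 0 < \<bar>d\<bar> \<and> \<bar>d\<bar> < e \<and> x + d *\<^sub>R axis i 1 \<in> S"
proof -
  have *: "\<exists>d>0. d < e \<and> x + d *\<^sub>R axis i 1 \<in> T" if T: "open T" "x \<in> T" for T
  proof -
    obtain r where r: "r > 0" "ball x r \<subseteq> T" using T by (rule openE)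
    define d where "d = min (e/2) (r/2)"
    have d: "0 < d" "d < e" "d < r" using assms(3) r by (auto simp: d_def)
    then have "x + d *\<^sub>R axis i 1 \<in> ball x r"
      by (simp add: dist_norm)
    then show ?thesis using d r by blast
  qed
  show ?thesis using assms(1)
  proof (cases rule: smooth_domainE)
    case (1 T)
    then obtain d where "d>0" "d < e" "x + d *\<^sub>R axis i 1 \<in> T" using * assms by blast
    then show ?thesis using 1 by (intro exI[of _ d]) auto
  next
    case (2 T k)
    then obtain d where d: "d>0" "d < e" "x + d *\<^sub>R axis i 1 \<in> T" using * assms by blast
    moreover have "0 \<le> (x + d *\<^sub>R axis i 1) $ k"
      using 2 assms d by (auto simp: axis_def)
    ultimately show ?thesis using 2 by (intro exI[of _ d]) auto
  qed
qed

lemma has_derivative_unique_smooth_domain: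
  fixes f :: "real^'n::finite \<Rightarrow> 'b::real_normed_vector"
  assumes "smooth_domain S" "x \<in> S"
    "(f has_derivative f') (at x within S)" "(f has_derivative f'') (at x within S)"
  shows "f' = f''"
proof (rule frechet_derivative_unique_within[OF assms(3,4)])
  fix i :: "real^'n" and e :: real
  assume "i \<in> Basis" "0 < e"
  then obtain j where "i = axis j 1" by (auto simp: Basis_vec_def)
  then show "\<exists>d. 0 < \<bar>d\<bar> \<and> \<bar>d\<bar> < e \<and> x + d *\<^sub>R i \<in> S"
    using smooth_domain_direction[OF assms(1,2) \<open>0 < e\<close>] by blast
qed

lemma partial_eqI:
  assumes "smooth_domain S" "x \<in> S" "(f has_derivative f') (at x within S)"
  shows "partial i S f x = f' (axis i 1)"
proof -
  have "(f has_derivative frechet_derivative f (at x within S)) (at x within S)"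
    using assms(3) differentiable_def frechet_derivative_works by blast
  then have "frechet_derivative f (at x within S) = f'"
    using has_derivative_unique_smooth_domain assms by blast
  then show ?thesis by (simp add: partial_def)
qed

lemma has_derivative_partial:
  assumes "f differentiable (at x within S)"
  shows "(f has_derivative (\<lambda>v. \<Sum>i\<in>UNIV. (v $ i) *\<^sub>R partial i S f x)) (at x within S)"
proof -
  let ?D = "frechet_derivative f (at x within S)"
  have D: "(f has_derivative ?D) (at x within S)"
    using assms frechet_derivative_works by blast
  then interpret bounded_linear ?D by (rule has_derivative_bounded_linear)
  have "?D v = (\<Sum>i\<in>UNIV. (v $ i) *\<^sub>R partial i S f x)" for v
  proof -
    have "v = (\<Sum>i\<in>UNIV. (v $ i) *\<^sub>R axis i 1)"
      by (simp add: vec_eq_iff axis_def if_distrib cong: if_cong)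
    then have "?D v = ?D (\<Sum>i\<in>UNIV. (v $ i) *\<^sub>R axis i 1)" by simp
    also have "\<dots> = (\<Sum>i\<in>UNIV. (v $ i) *\<^sub>R ?D (axis i 1))" by (simp add: sum scaleR)
    finally show ?thesis by (simp add: partial_def)
  qed
  then have "?D = (\<lambda>v. \<Sum>i\<in>UNIV. (v $ i) *\<^sub>R partial i S f x)" by blast
  then show ?thesis using D by metis
qed

text \<open>The derivative is picked by a choice operator. Both functions have the same derivatives
  within \<open>S\<close>, so the choice agrees, even where no derivative exists.\<close>

lemma partial_cong:
  assumes "\<And>y. y \<in> S \<Longrightarrow> f y = g y" "x \<in> S"
  shows "partial i S f x = partial i S g x"
proof -
  have "(f has_derivative f') (at x within S) \<longleftrightarrow> (g has_derivative f') (at x within S)" for f'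
    using assms by (metis has_derivative_transform)
  then show ?thesis by (simp add: partial_def frechet_derivative_def)
qed

lemma partial_subset:
  assumes "smooth_domain S" "smooth_domain T" "T \<subseteq> S" "x \<in> T" "f differentiable (at x within S)"
  shows "partial i T f x = partial i S f x"
proof -
  have "(f has_derivative frechet_derivative f (at x within S)) (at x within T)"
    using assms(3,5) frechet_derivative_works has_derivative_subset by blast
  from partial_eqI[OF assms(2,4) this] show ?thesis by (simp add: partial_def[of _ S])
qed

lemma at_within_Int_nhd:
  assumes "open N" "x \<in> N"
  shows "at x within (S \<inter> N) = at x within S"
  by (rule at_within_nhd[OF assms(2,1)]) auto

lemma partial_Int_open:
  assumes "open N" "x \<in> N"
  shows "partial i (S \<inter> N) f x = partial i S f x"
  by (simp add: partial_def at_within_Int_nhd[OF assms])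

section \<open>Functions of class C^k: dependence on the values and on the domain\<close>

lemma Ck_on_cong:
  assumes "\<And>x. x \<in> S \<Longrightarrow> f x = g x"
  shows "Ck_on k S f \<longleftrightarrow> Ck_on k S g"
  using assms
proof (induction k arbitrary: f g)
  case 0
  then show ?case by (simp cong: continuous_on_cong)
next
  case (Suc k)
  have "f differentiable_on S \<longleftrightarrow> g differentiable_on S"
    unfolding differentiable_on_def differentiable_def
    by (metis Suc.prems has_derivative_transform)
  moreover have "Ck_on k S (partial i S f) \<longleftrightarrow> Ck_on k S (partial i S g)" for i
    by (rule Suc.IH, rule partial_cong) (use Suc.prems in auto)
  ultimately show ?case by simp
qed

lemma Ck_on_congI:
  assumes "Ck_on k S g" "\<And>x. x \<in> S \<Longrightarrow> f x = g x"
  shows "Ck_on k S f"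
  using assms Ck_on_cong by blast

lemma Ck_on_SucD: "Ck_on (Suc k) S f \<Longrightarrow> Ck_on k S f"
proof (induction k arbitrary: f)
  case 0
  then show ?case by (simp add: differentiable_imp_continuous_on)
next
  case (Suc k)
  then show ?case by (metis Ck_on.simps(2))
qed

lemma Ck_on_subset:
  assumes "smooth_domain S" "smooth_domain T" "T \<subseteq> S" "Ck_on k S f"
  shows "Ck_on k T f"
  using assms(4)
proof (induction k arbitrary: f)
  case 0
  then show ?case using assms(3) continuous_on_subset by auto
next
  case (Suc k)
  have "Ck_on k T (partial i T f)" for i
    by (rule Ck_on_congI[of k T "partial i S f"])
      (use Suc assms(3) in \<open>auto simp: differentiable_on_def intro!: partial_subset[OF assms(1-3)]\<close>)
  moreover have "f differentiable_on T"
    using Suc.prems assms(3) differentiable_on_subset by auto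
  ultimately show ?case by simp
qed

text \<open>Intersecting \<open>S\<close> with an open neighbourhood of \<open>x\<close> does not
  change the filter \<open>at x within S\<close>, so differentiability and the partial derivatives
  at \<open>x\<close> are unaffected.\<close>

lemma Ck_on_local:
  assumes "\<And>x. x \<in> S \<Longrightarrow> \<exists>N. open N \<and> x \<in> N \<and> Ck_on k (S \<inter> N) f"
  shows "Ck_on k S f"
  using assms
proof (induction k arbitrary: f)
  case 0
  have "continuous (at x within S) f" if x: "x \<in> S" for x
  proof -
    obtain N where N: "open N" "x \<in> N" "continuous_on (S \<inter> N) f" using 0[OF x] by auto
    then show ?thesis
      using x at_within_Int_nhd[OF N(1,2), of S] by (metis IntI continuous_on_eq_continuous_within)
  qed
  then show ?case by (simp add: continuous_on_eq_continuous_within)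
next
  case (Suc k)
  have "f differentiable (at x within S)" if x: "x \<in> S" for x
  proof -
    obtain N where N: "open N" "x \<in> N" "f differentiable_on (S \<inter> N)" using Suc.prems[OF x] by auto
    then show ?thesis using x at_within_Int_nhd[OF N(1,2), of S]
      by (metis IntI differentiable_on_def)
  qed
  moreover have "Ck_on k S (partial i S f)" for i
  proof (rule Suc.IH)
    fix x assume "x \<in> S"
    then obtain N where N: "open N" "x \<in> N" "Ck_on k (S \<inter> N) (partial i (S \<inter> N) f)"
      using Suc.prems by auto
    then have "Ck_on k (S \<inter> N) (partial i S f)"
      using Ck_on_congI[OF N(3)] partial_Int_open[OF N(1)] by (metis IntE)
    then show "\<exists>N. open N \<and> x \<in> N \<and> Ck_on k (S \<inter> N) (partial i S f)" using N by blast
  qed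
  ultimately show ?case by (simp add: differentiable_on_def)
qed

section \<open>Rules of differentiation, and closure of C^k under products and composition\<close>

lemma partial_const [simp]:
  assumes "smooth_domain S" "x \<in> S"
  shows "partial i S (\<lambda>x. c) x = 0"
  by (rule trans[OF partial_eqI[OF assms has_derivative_const]]) simp

lemmas has_derivative_frechet = frechet_derivative_works[THEN iffD1]

lemma partial_bounded_linear:
  assumes "smooth_domain S" "x \<in> S" "bounded_linear L" "f differentiable (at x within S)"
  shows "partial i S (\<lambda>x. L (f x)) x = L (partial i S f x)"
using partial_eqI[OF assms(1,2) bounded_linear.has_derivative[OF assms(3) has_derivative_frechet[OF assms(4)]]]
  by (simp add: partial_def[of _ _ f])

lemma partial_add:
  assumes "smooth_domain S" "x \<in> S" "f differentiable (at x within S)" "g differentiable (at x within S)"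
  shows "partial i S (\<lambda>x. f x + g x) x = partial i S f x + partial i S g x"
  using partial_eqI[OF assms(1,2) has_derivative_add[OF assms(3,4)[THEN has_derivative_frechet]]]
  by (simp add: partial_def[of _ _ f] partial_def[of _ _ g])

lemma partial_bilinear:
  assumes "smooth_domain S" "x \<in> S" "bounded_bilinear B"
    "f differentiable (at x within S)" "g differentiable (at x within S)"
  shows "partial i S (\<lambda>x. B (f x) (g x)) x = B (f x) (partial i S g x) + B (partial i S f x) (g x)"
  using partial_eqI[OF assms(1,2) bounded_bilinear.FDERIV[OF assms(3) assms(4,5)[THEN has_derivative_frechet]]]
  by (simp add: partial_def[of _ _ f] partial_def[of _ _ g])

lemma Ck_on_const: "smooth_domain S \<Longrightarrow> Ck_on k S (\<lambda>x. c)"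
proof (induction k arbitrary: c)
  case (Suc k)
  have "Ck_on k S (partial i S (\<lambda>x. c))" for i
    by (rule Ck_on_congI[of k S "\<lambda>x. 0"]) (use Suc in \<open>auto simp: partial_const\<close>)
  then show ?case by simp
qed simp

lemma Ck_on_bounded_linear:
  assumes "smooth_domain S" "bounded_linear L" "Ck_on k S f"
  shows "Ck_on k S (\<lambda>x. L (f x))"
  using assms(3)
proof (induction k arbitrary: f)
  case 0
  then show ?case using assms(2) by (simp add: bounded_linear.continuous_on)
next
  case (Suc k)
  have "Ck_on k S (partial i S (\<lambda>x. L (f x)))" for i
    using Suc Ck_on_cong[of S "partial i S (\<lambda>x. L (f x))" "\<lambda>x. L (partial i S f x)" k]
      partial_bounded_linear[OF assms(1) _ assms(2)] by (auto simp: differentiable_on_def)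
  moreover have "(\<lambda>x. L (f x)) differentiable_on S"
    using Suc.prems bounded_linear.has_derivative[OF assms(2)]
    unfolding differentiable_on_def differentiable_def Ck_on.simps by blast
  ultimately show ?case by simp
qed

lemma Ck_on_add:
  assumes "smooth_domain S" "Ck_on k S f" "Ck_on k S g"
  shows "Ck_on k S (\<lambda>x. f x + g x)"
  using assms(2,3)
proof (induction k arbitrary: f g)
  case 0
  then show ?case by (simp add: continuous_on_add)
next
  case (Suc k)
  have "Ck_on k S (partial i S (\<lambda>x. f x + g x))" for i
    by (rule Ck_on_congI[of k S "\<lambda>x. partial i S f x + partial i S g x"])
      (use Suc in \<open>auto simp: differentiable_on_def intro!: partial_add[OF assms(1)]\<close>)
  then show ?case using Suc.prems by (auto simp: differentiable_on_def)
qed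

text \<open>One product rule serves all products in use: of reals, scalar multiples, inner products
  and matrix products.\<close>

lemma Ck_on_bilinear:
  assumes "smooth_domain S" "bounded_bilinear B" "Ck_on k S f" "Ck_on k S g"
  shows "Ck_on k S (\<lambda>x. B (f x) (g x))"
  using assms(3,4)
proof (induction k arbitrary: f g)
  case 0
  then show ?case using assms(2) by (simp add: bounded_bilinear.continuous_on)
next
  case (Suc k)
  have "Ck_on k S (\<lambda>x. B (f x) (partial i S g x) + B (partial i S f x) (g x))" for i
    by (intro Ck_on_add[OF assms(1)] Suc.IH) (use Suc.prems Ck_on_SucD in auto)
  then have "Ck_on k S (partial i S (\<lambda>x. B (f x) (g x)))" for i
    using Suc.prems Ck_on_cong[of S "partial i S (\<lambda>x. B (f x) (g x))" "\<lambda>x. B (f x) (partial i S g x) + B (partial i S f x) (g x)" k]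
      partial_bilinear[OF assms(1) _ assms(2)] by (auto simp: differentiable_on_def)
  moreover have "(\<lambda>x. B (f x) (g x)) differentiable_on S"
    using Suc.prems bounded_bilinear.FDERIV[OF assms(2)]
    unfolding differentiable_on_def differentiable_def Ck_on.simps by blast
  ultimately show ?case by simp
qed

lemma Ck_on_sum:
  assumes "smooth_domain S" "\<And>i. i \<in> I \<Longrightarrow> Ck_on k S (f i)"
  shows "Ck_on k S (\<lambda>x. \<Sum>i\<in>I. f i x)"
  using assms(2) by (induction I rule: infinite_finite_induct)
    (auto intro!: Ck_on_add Ck_on_const assms(1))

lemma partial_compose:
  fixes f :: "real^'m::finite \<Rightarrow> 'b::real_normed_vector" and g :: "real^'n::finite \<Rightarrow> real^'m"
  assumes "smooth_domain S" "x \<in> S" "g ` S \<subseteq> T"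
    "g differentiable (at x within S)" "f differentiable (at (g x) within T)"
  shows "partial i S (\<lambda>x. f (g x)) x = (\<Sum>j\<in>UNIV. (partial i S g x $ j) *\<^sub>R partial j T f (g x))"
proof -
  have "(f has_derivative (\<lambda>v. \<Sum>i\<in>UNIV. (v $ i) *\<^sub>R partial i T f (g x))) (at (g x) within g ` S)"
    using has_derivative_partial[OF assms(5)] assms(3) has_derivative_subset by blast
  from has_derivative_in_compose[OF has_derivative_frechet[OF assms(4)] this]
  have "((\<lambda>x. f (g x)) has_derivative (\<lambda>v. \<Sum>i\<in>UNIV. (frechet_derivative g (at x within S) v $ i) *\<^sub>R partial i T f (g x))) (at x within S)" .
  from partial_eqI[OF assms(1,2) this] show ?thesis by (simp add: partial_def)
qed

lemma differentiable_on_compose_within: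
  assumes "g differentiable_on S" "f differentiable_on T" "g ` S \<subseteq> T"
  shows "(\<lambda>x. f (g x)) differentiable_on S"
  using assms by (metis differentiable_on_compose differentiable_on_subset)

text \<open>The induction generalises \<open>f\<close> and keeps \<open>g\<close>: a derivative of
  the composition is a sum of products of partial derivatives of \<open>g\<close> with partial
  derivatives of \<open>f\<close> composed with the same \<open>g\<close>.\<close>

lemma Ck_on_compose:
  fixes f :: "real^'m::finite \<Rightarrow> 'b::real_normed_vector" and g :: "real^'n::finite \<Rightarrow> real^'m"
  assumes "smooth_domain S" "g ` S \<subseteq> T" "Ck_on k S g" "Ck_on k T f"
  shows "Ck_on k S (\<lambda>x. f (g x))"
  using assms(3,4)
proof (induction k arbitrary: f)
  case 0
  then show ?case using assms(2) continuous_on_compose2 by auto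
next
  case (Suc k)
  have "Ck_on k S (\<lambda>x. \<Sum>j\<in>UNIV. (partial i S g x $ j) *\<^sub>R partial j T f (g x))" for i
    by (intro Ck_on_sum[OF assms(1)] Ck_on_bilinear[OF assms(1) bounded_bilinear_scaleR]
        Ck_on_bounded_linear[OF assms(1) bounded_linear_vec_nth] Suc.IH)
      (use Suc.prems Ck_on_SucD in auto)
  moreover have "partial i S (\<lambda>x. f (g x)) x = (\<Sum>j\<in>UNIV. (partial i S g x $ j) *\<^sub>R partial j T f (g x))"
    if "x \<in> S" for i x
    using Suc.prems that assms(2)
    by (intro partial_compose[OF assms(1) that assms(2)]) (auto simp: differentiable_on_def)
  ultimately have "Ck_on k S (partial i S (\<lambda>x. f (g x)))" for i
    by (rule Ck_on_congI)
  then show ?case using Suc.prems assms(2) differentiable_on_compose_within by auto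
qed

section \<open>Closure properties of smooth functions\<close>

lemma smooth_on_cong:
  "(\<And>x. x \<in> S \<Longrightarrow> f x = g x) \<Longrightarrow> smooth_on S f \<longleftrightarrow> smooth_on S g"
  unfolding smooth_on_def using Ck_on_cong by blast

lemma smooth_on_subset:
  "smooth_domain S \<Longrightarrow> smooth_domain T \<Longrightarrow> T \<subseteq> S \<Longrightarrow> smooth_on S f \<Longrightarrow> smooth_on T f"
  unfolding smooth_on_def using Ck_on_subset by blast

lemma smooth_on_local:
  assumes "\<And>x. x \<in> S \<Longrightarrow> \<exists>N. open N \<and> x \<in> N \<and> smooth_on (S \<inter> N) f"
  shows "smooth_on S f"
  unfolding smooth_on_def by (intro allI Ck_on_local) (meson assms smooth_on_def)

lemma smooth_on_partial: "smooth_on S f \<Longrightarrow> smooth_on S (partial i S f)"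
  unfolding smooth_on_def by (metis Ck_on.simps(2))

lemma smooth_on_imp_differentiable:
  "smooth_on S f \<Longrightarrow> x \<in> S \<Longrightarrow> f differentiable (at x within S)"
  unfolding smooth_on_def differentiable_on_def[symmetric] by (metis Ck_on.simps(2) differentiable_on_def)

lemma smooth_on_imp_continuous_on: "smooth_on S f \<Longrightarrow> continuous_on S f"
  unfolding smooth_on_def by (metis Ck_on.simps(1))

lemma smooth_on_const: "smooth_domain S \<Longrightarrow> smooth_on S (\<lambda>x. c)"
  by (simp add: smooth_on_def Ck_on_const)

lemma smooth_on_bounded_linear:
  "smooth_domain S \<Longrightarrow> bounded_linear L \<Longrightarrow> smooth_on S f \<Longrightarrow> smooth_on S (\<lambda>x. L (f x))"
  by (simp add: smooth_on_def Ck_on_bounded_linear)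

lemma smooth_on_add:
  "smooth_domain S \<Longrightarrow> smooth_on S f \<Longrightarrow> smooth_on S g \<Longrightarrow> smooth_on S (\<lambda>x. f x + g x)"
  by (simp add: smooth_on_def Ck_on_add)

lemma smooth_on_bilinear:
  "smooth_domain S \<Longrightarrow> bounded_bilinear B \<Longrightarrow> smooth_on S f \<Longrightarrow> smooth_on S g
    \<Longrightarrow> smooth_on S (\<lambda>x. B (f x) (g x))"
  by (simp add: smooth_on_def Ck_on_bilinear)

lemmas smooth_on_mult = smooth_on_bilinear[OF _ bounded_bilinear_mult]
lemmas smooth_on_scaleR = smooth_on_bilinear[OF _ bounded_bilinear_scaleR]

lemma smooth_on_minus: "smooth_domain S \<Longrightarrow> smooth_on S f \<Longrightarrow> smooth_on S (\<lambda>x. - f x)"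
  using smooth_on_bounded_linear[OF _ bounded_linear_minus[OF bounded_linear_ident]] .

lemma smooth_on_diff:
  "smooth_domain S \<Longrightarrow> smooth_on S f \<Longrightarrow> smooth_on S g \<Longrightarrow> smooth_on S (\<lambda>x. f x - g x)"
  using smooth_on_add[of S f "\<lambda>x. - g x"] smooth_on_minus[of S g] by simp

lemma smooth_on_sum:
  "smooth_domain S \<Longrightarrow> (\<And>i. i \<in> I \<Longrightarrow> smooth_on S (f i)) \<Longrightarrow> smooth_on S (\<lambda>x. \<Sum>i\<in>I. f i x)"
  by (simp add: smooth_on_def Ck_on_sum)

lemma smooth_on_prod:
  fixes f :: "'i \<Rightarrow> real^'n::finite \<Rightarrow> real"
  assumes "smooth_domain S" "\<And>i. i \<in> I \<Longrightarrow> smooth_on S (f i)"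
  shows "smooth_on S (\<lambda>x. \<Prod>i\<in>I. f i x)"
  using assms(2) by (induction I rule: infinite_finite_induct)
    (auto intro!: smooth_on_mult smooth_on_const assms(1))

lemma smooth_on_compose:
  fixes f :: "real^'m::finite \<Rightarrow> 'b::real_normed_vector" and g :: "real^'n::finite \<Rightarrow> real^'m"
  shows "smooth_domain S \<Longrightarrow> g ` S \<subseteq> T \<Longrightarrow> smooth_on S g \<Longrightarrow> smooth_on T f \<Longrightarrow> smooth_on S (\<lambda>x. f (g x))"
  by (simp add: smooth_on_def Ck_on_compose)

lemma smooth_on_nth:
  "smooth_domain S \<Longrightarrow> smooth_on S f \<Longrightarrow> smooth_on S (\<lambda>x. f x $ i)"
  by (rule smooth_on_bounded_linear[OF _ bounded_linear_vec_nth])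

lemma smooth_on_vecI:
  fixes f :: "real^'n::finite \<Rightarrow> 'b::real_normed_vector^'m::finite"
  assumes "smooth_domain S" "\<And>i. smooth_on S (\<lambda>x. f x $ i)"
  shows "smooth_on S f"
proof -
  have lin: "bounded_linear (\<lambda>r::'b. axis i r :: 'b^'m)" for i
    by (rule bounded_linear_intro[of _ 1]) (auto simp: vec_eq_iff axis_def norm_vec_def L2_set_def if_distrib[of "\<lambda>y. (norm y)\<^sup>2"] cong: if_cong)
  have "f x = (\<Sum>i\<in>UNIV. axis i (f x $ i))" for x
    by (simp add: vec_eq_iff axis_def if_distrib cong: if_cong)
  moreover have "smooth_on S (\<lambda>x. \<Sum>i\<in>UNIV. axis i (f x $ i))"
    by (intro smooth_on_sum smooth_on_bounded_linear[OF assms(1) lin] assms)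
  ultimately show ?thesis by presburger
qed

lemma Ck_on_ident: "smooth_domain S \<Longrightarrow> Ck_on k S (\<lambda>x. x)"
proof (induction k)
  case (Suc k)
  have "partial i S (\<lambda>x. x) x = axis i 1" if "x \<in> S" for i x
    using partial_eqI[OF Suc.prems that has_derivative_ident] by simp
  then have "Ck_on k S (partial i S (\<lambda>x. x))" for i
    using Ck_on_cong[of S "partial i S (\<lambda>x. x)" "\<lambda>x. axis i 1"] Ck_on_const[OF Suc.prems] by auto
  then show ?case by (simp add: differentiable_on_def)
qed simp

lemma smooth_on_ident: "smooth_domain S \<Longrightarrow> smooth_on S (\<lambda>x. x)"
  by (simp add: smooth_on_def Ck_on_ident)

section \<open>Composition with functions of one real variable, quotients and inverse
  matrices\<close>

lemma partial_real_compose: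
  fixes f :: "real^'n::finite \<Rightarrow> real" and \<phi> :: "real \<Rightarrow> real"
  assumes "smooth_domain S" "x \<in> S" "f differentiable (at x within S)"
    "(\<phi> has_real_derivative d) (at (f x))"
  shows "partial i S (\<lambda>x. \<phi> (f x)) x = d * partial i S f x"
proof -
  have "(f has_derivative frechet_derivative f (at x within S)) (at x within S)"
    using assms(3) frechet_derivative_works by blast
  from has_derivative_compose[OF this, of \<phi> "(*) d"] assms(4)
  have "((\<lambda>x. \<phi> (f x)) has_derivative (\<lambda>v. d * frechet_derivative f (at x within S) v)) (at x within S)"
    unfolding has_field_derivative_def by blast
  from partial_eqI[OF assms(1,2) this] show ?thesis by (simp add: partial_def)
qed

text \<open>The function of one variable is presented by the sequence \<open>D\<close> of its
  successive derivatives, required only at the values of \<open>f\<close>. This covers functions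
  with a singularity that \<open>f\<close> avoids, such as the reciprocal.\<close>

lemma smooth_on_real_compose:
  fixes f :: "real^'n::finite \<Rightarrow> real" and D :: "nat \<Rightarrow> real \<Rightarrow> real"
  assumes S: "smooth_domain S" and f: "smooth_on S f"
    and D: "\<And>j x. x \<in> S \<Longrightarrow> (D j has_real_derivative D (Suc j) (f x)) (at (f x))"
  shows "smooth_on S (\<lambda>x. D j (f x))"
proof -
  have diff: "(\<lambda>x. D j (f x)) differentiable (at x within S)" if "x \<in> S" for x j
  proof -
    have "(D j has_derivative (*) (D (Suc j) (f x))) (at (f x))"
      using D[OF that] by (simp add: has_field_derivative_def)
    from has_derivative_compose[OF has_derivative_frechet[OF smooth_on_imp_differentiable[OF f that]] this]
    show ?thesis unfolding differentiable_def by blast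
  qed
  have "\<forall>j. Ck_on k S (\<lambda>x. D j (f x))" for k
  proof (induction k)
    case 0
    show ?case using diff
      by (simp add: differentiable_imp_continuous_on differentiable_on_def)
  next
    case (Suc k)
    have "Ck_on k S (partial i S (\<lambda>x. D j (f x)))" for i j
    proof -
      have "Ck_on k S (\<lambda>x. D (Suc j) (f x) * partial i S f x)"
        using Suc f smooth_on_partial Ck_on_bilinear[OF S bounded_bilinear_mult] unfolding smooth_on_def by blast
      moreover have "partial i S (\<lambda>x. D j (f x)) x = D (Suc j) (f x) * partial i S f x" if "x \<in> S" for x
        by (rule partial_real_compose[OF S that smooth_on_imp_differentiable[OF f that] D[OF that]])
      ultimately show ?thesis by (rule Ck_on_congI)
    qed
    then show ?case using diff by (simp add: differentiable_on_def)
  qed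
  then show ?thesis by (simp add: smooth_on_def)
qed

lemma smooth_on_exp:
  fixes f :: "real^'n::finite \<Rightarrow> real"
  assumes "smooth_domain S" "smooth_on S f"
  shows "smooth_on S (\<lambda>x. exp (f x))"
  by (rule smooth_on_real_compose[OF assms, of "\<lambda>_. exp"]) (rule DERIV_exp)

lemma smooth_on_inverse:
  fixes f :: "real^'n::finite \<Rightarrow> real"
  assumes "smooth_domain S" "smooth_on S f" "\<And>x. x \<in> S \<Longrightarrow> f x \<noteq> 0"
  shows "smooth_on S (\<lambda>x. inverse (f x))"
proof -
  \<comment> \<open>The \<open>j\<close>-th derivative of the reciprocal, so that \<open>D 0\<close>
    is the reciprocal itself.\<close>
  define D where "D j y = (-1)^j * fact j * inverse y ^ Suc j" for j and y :: real
  have "(D j has_real_derivative D (Suc j) (f x)) (at (f x))" if "x \<in> S" for j x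
    unfolding D_def
    by (rule derivative_eq_intros refl assms(3) that)+
      (use assms(3)[OF that] in \<open>auto simp: field_simps power_add\<close>)
  from smooth_on_real_compose[OF assms(1,2), of D 0] this have "smooth_on S (\<lambda>x. D 0 (f x))" by blast
  then show ?thesis by (simp add: D_def)
qed

lemma smooth_on_divide:
  fixes f :: "real^'n::finite \<Rightarrow> real"
  assumes "smooth_domain S" "smooth_on S f" "smooth_on S g" "\<And>x. x \<in> S \<Longrightarrow> g x \<noteq> 0"
  shows "smooth_on S (\<lambda>x. f x / g x)"
  using smooth_on_mult[OF assms(1,2) smooth_on_inverse[OF assms(1,3,4)]] by (simp add: divide_inverse)

lemma smooth_on_det:
  fixes A :: "real^'n::finite \<Rightarrow> real^'m::finite^'m"
  assumes "smooth_domain S" "smooth_on S A"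
  shows "smooth_on S (\<lambda>x. det (A x))"
  unfolding det_def
  by (intro smooth_on_sum smooth_on_mult smooth_on_const smooth_on_prod smooth_on_nth assms)

lemma
  fixes A :: "real^'m::finite^'m"
  assumes "invertible A"
  shows matrix_inv_right: "A ** matrix_inv A = mat 1" and matrix_inv_left: "matrix_inv A ** A = mat 1"
proof -
  have "\<exists>B. A ** B = mat 1 \<and> B ** A = mat 1" using assms by (simp add: invertible_def)
  from someI_ex[OF this] show "A ** matrix_inv A = mat 1" "matrix_inv A ** A = mat 1"
    unfolding matrix_inv_def by blast+
qed

text \<open>Cramer's rule. It presents the entries of the inverse as quotients of polynomials in the
  entries of \<open>A\<close>, from which smooth dependence is immediate.\<close>

lemma matrix_inv_cramer:
  fixes A :: "real^'m::finite^'m"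
  assumes "invertible A"
  shows "matrix_inv A $ i $ j = det (\<chi> a b. if b = i then axis j 1 $ a else A $ a $ b) / det A"
proof -
  have "A *v (matrix_inv A *v axis j 1) = axis j 1"
    using matrix_inv_right[OF assms] by (simp add: matrix_vector_mul_assoc)
  moreover have "det A \<noteq> 0" using assms invertible_det_nz by blast
  ultimately have "matrix_inv A *v axis j 1 =
      (\<chi> k. det (\<chi> a b. if b = k then axis j 1 $ a else A $ a $ b) / det A)"
    using cramer by blast
  moreover have "(matrix_inv A *v axis j 1) $ i = matrix_inv A $ i $ j"
    by (simp add: matrix_vector_mult_basis column_def)
  ultimately show ?thesis by simp
qed

lemma smooth_on_matrix_inv:
  fixes A :: "real^'n::finite \<Rightarrow> real^'m::finite^'m"
  assumes "smooth_domain S" "smooth_on S A" "\<And>x. x \<in> S \<Longrightarrow> invertible (A x)"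
  shows "smooth_on S (\<lambda>x. matrix_inv (A x))"
proof (intro smooth_on_vecI assms(1))
  fix i j
  have "smooth_on S (\<lambda>x. (if b = i then axis j 1 $ a else A x $ a $ b) :: real)" for a b
    by (cases "b = i") (auto intro!: smooth_on_const smooth_on_nth assms(1,2))
  then have "smooth_on S (\<lambda>x. det (\<chi> a b. if b = i then axis j 1 $ a else A x $ a $ b) / det (A x))"
    using assms(3) invertible_det_nz
    by (intro smooth_on_divide smooth_on_det assms(1,2) smooth_on_vecI) auto
  then show "smooth_on S (\<lambda>x. matrix_inv (A x) $ i $ j)"
    by (rule smooth_on_cong[THEN iffD2, rotated]) (rule matrix_inv_cramer[OF assms(3)])
qed

section \<open>Symmetry of second derivatives up to the boundary\<close>

lemma has_derivative_along_axis:
  fixes f :: "real^'n::finite \<Rightarrow> real"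
  assumes "s \<in> I" "\<And>s. s \<in> I \<Longrightarrow> y + s *\<^sub>R axis i 1 \<in> S"
    "f differentiable (at (y + s *\<^sub>R axis i 1) within S)"
  shows "((\<lambda>s. f (y + s *\<^sub>R axis i 1)) has_derivative (\<lambda>t. t * partial i S f (y + s *\<^sub>R axis i 1))) (at s within I)"
proof -
  let ?g = "\<lambda>s. y + s *\<^sub>R axis i (1::real)"
  have "(?g has_derivative (\<lambda>t. t *\<^sub>R axis i 1)) (at s within I)"
    by (auto intro!: derivative_eq_intros)
  moreover have "(f has_derivative (\<lambda>v. \<Sum>k\<in>UNIV. (v $ k) *\<^sub>R partial k S f (?g s))) (at (?g s) within ?g ` I)"
    by (rule has_derivative_subset[OF has_derivative_partial[OF assms(3)]]) (use assms(2) in auto)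
  ultimately have "((\<lambda>s. f (?g s)) has_derivative
      (\<lambda>t. \<Sum>k\<in>UNIV. ((t *\<^sub>R axis i (1::real)) $ k) *\<^sub>R partial k S f (?g s))) (at s within I)"
    by (rule has_derivative_in_compose)
  moreover have "(\<Sum>k\<in>UNIV. ((t *\<^sub>R axis i (1::real)) $ k) *\<^sub>R partial k S f (?g s)) = t * partial i S f (?g s)" for t
  proof -
    have "((t *\<^sub>R axis i (1::real)) $ k) *\<^sub>R partial k S f (?g s) = (if k = i then t * partial i S f (?g s) else 0)" for k
      by (simp add: axis_def)
    then show ?thesis by simp
  qed
  ultimately show ?thesis by (simp only:)
qed

text \<open>The mean value theorem is applied along axis \<open>i\<close> and then to the derivative
  along axis \<open>j\<close>. The left side is symmetric in \<open>i\<close> and \<open>j\<close>,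
  so the two orders of differentiation can be compared through it.\<close>

lemma second_difference_mvt:
  fixes f :: "real^'n::finite \<Rightarrow> real"
  assumes h: "0 \<le> h" and f: "Ck_on 2 S f"
    and S: "\<And>s t. s \<in> {0..h} \<Longrightarrow> t \<in> {0..h} \<Longrightarrow> x + s *\<^sub>R axis i 1 + t *\<^sub>R axis j 1 \<in> S"
  shows "\<exists>s\<in>{0..h}. \<exists>t\<in>{0..h}.
    f (x + h *\<^sub>R axis i 1 + h *\<^sub>R axis j 1) - f (x + h *\<^sub>R axis i 1) - f (x + h *\<^sub>R axis j 1) + f x
      = h * h * partial j S (partial i S f) (x + s *\<^sub>R axis i 1 + t *\<^sub>R axis j 1)"
proof -
  have d1: "f differentiable (at y within S)" if "y \<in> S" for y
    using f that by (simp add: numeral_2_eq_2 differentiable_on_def)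
  have d2: "partial i S f differentiable (at y within S)" if "y \<in> S" for y
    using f that by (simp add: numeral_2_eq_2 differentiable_on_def)
  let ?a = "\<lambda>s. x + h *\<^sub>R axis j 1 + s *\<^sub>R axis i 1" and ?b = "\<lambda>s. x + s *\<^sub>R axis i 1"
  have Sa: "?a s \<in> S" if "s \<in> {0..h}" for s using S[OF that, of h] h by (simp add: ac_simps)
  have Sb: "?b s \<in> S" if "s \<in> {0..h}" for s using S[OF that, of 0] h by simp
  have "((\<lambda>s. f (?a s) - f (?b s)) has_derivative (\<lambda>t. t * partial i S f (?a s) - t * partial i S f (?b s)))
      (at s within {0..h})" if "s \<in> {0..h}" for s
    by (intro has_derivative_diff has_derivative_along_axis d1) (use that Sa Sb in auto)
  from mvt_very_simple[OF h this]
  obtain s where s: "s \<in> {0..h}"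
    and 1: "(f (?a h) - f (?b h)) - (f (?a 0) - f (?b 0)) = h * partial i S f (?a s) - h * partial i S f (?b s)"
    by force
  have "((\<lambda>t. partial i S f (?b s + t *\<^sub>R axis j 1)) has_derivative
      (\<lambda>r. r * partial j S (partial i S f) (?b s + t *\<^sub>R axis j 1))) (at t within {0..h})" if "t \<in> {0..h}" for t
    by (intro has_derivative_along_axis d2) (use that S s in auto)
  from mvt_very_simple[OF h this]
  obtain t where t: "t \<in> {0..h}"
    and 2: "partial i S f (?b s + h *\<^sub>R axis j 1) - partial i S f (?b s + 0 *\<^sub>R axis j 1)
      = h * partial j S (partial i S f) (?b s + t *\<^sub>R axis j 1)"
    by force
  have "f (x + h *\<^sub>R axis i 1 + h *\<^sub>R axis j 1) - f (x + h *\<^sub>R axis i 1) - f (x + h *\<^sub>R axis j 1) + f x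
      = (f (?a h) - f (?b h)) - (f (?a 0) - f (?b 0))" by (simp add: ac_simps)
  also have "\<dots> = h * (partial i S f (?b s + h *\<^sub>R axis j 1) - partial i S f (?b s + 0 *\<^sub>R axis j 1))"
    unfolding 1 by (simp add: algebra_simps)
  also have "\<dots> = h * h * partial j S (partial i S f) (?b s + t *\<^sub>R axis j 1)" unfolding 2 by simp
  finally show ?thesis using s t by blast
qed

text \<open>Nonnegative multiples of the axes do not leave a half-space, so the squares used for the symmetry
  of second derivatives fit into the domain even at a boundary point.\<close>

lemma smooth_domain_rectangle:
  fixes x :: "real^'n::finite"
  assumes "smooth_domain S" "x \<in> S"
  obtains r where "r > 0" "\<And>s t. s \<in> {0..r} \<Longrightarrow> t \<in> {0..r} \<Longrightarrow> x + s *\<^sub>R axis i 1 + t *\<^sub>R axis j 1 \<in> S"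
proof -
  have *: "\<exists>r>0. \<forall>s\<in>{0..r}. \<forall>t\<in>{0..r}. x + s *\<^sub>R axis i 1 + t *\<^sub>R axis j 1 \<in> T"
    if T: "open T" "x \<in> T" for T
  proof -
    obtain r where r: "r > 0" "ball x r \<subseteq> T" using T by (rule openE)
    have "x + s *\<^sub>R axis i 1 + t *\<^sub>R axis j 1 \<in> T" if "s \<in> {0..r/3}" "t \<in> {0..r/3}" for s t
    proof -
      have "norm (s *\<^sub>R axis i (1::real) + t *\<^sub>R axis j 1 :: real^'n) \<le> \<bar>s\<bar> + \<bar>t\<bar>"
        by (rule order_trans[OF norm_triangle_ineq]) simp
      also have "\<dots> < r" using that r by auto
      finally have "x + s *\<^sub>R axis i 1 + t *\<^sub>R axis j 1 \<in> ball x r"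
        by (simp add: dist_norm norm_minus_commute add.assoc)
          (metis add.commute add_diff_cancel_left' diff_add_eq_diff_diff_swap norm_minus_commute)
      then show ?thesis using r by blast
    qed
    then show ?thesis using r by (intro exI[of _ "r/3"]) auto
  qed
  show ?thesis using assms(1)
  proof (cases rule: smooth_domainE)
    case (1 T)
    then show ?thesis using * assms that by metis
  next
    case (2 T k)
    then obtain r where r: "r > 0" "\<forall>s\<in>{0..r}. \<forall>t\<in>{0..r}. x + s *\<^sub>R axis i 1 + t *\<^sub>R axis j 1 \<in> T"
      using * assms by blast
    moreover have "0 \<le> (x + s *\<^sub>R axis i 1 + t *\<^sub>R axis j 1) $ k" if "s \<in> {0..r}" "t \<in> {0..r}" for s t
      using 2 assms that by (auto simp: axis_def)
    ultimately show ?thesis using that[of r] 2 by auto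
  qed
qed

lemma partial_commute:
  fixes f :: "real^'n::finite \<Rightarrow> real"
  assumes S: "smooth_domain S" "x \<in> S" and f: "smooth_on S f"
  shows "partial i S (partial j S f) x = partial j S (partial i S f) x"
proof (rule ccontr)
  let ?A = "partial j S (partial i S f)" and ?B = "partial i S (partial j S f)"
  assume "?B x \<noteq> ?A x"
  \<comment> \<open>Half of the supposed gap: if each mixed derivative varies by less than
    \<open>e\<close> on the square, the two cannot agree at any two of its points.\<close>
  define e where "e = \<bar>?A x - ?B x\<bar> / 2"
  have e: "e > 0" using \<open>?B x \<noteq> ?A x\<close> by (simp add: e_def)
  have cont: "continuous_on S ?A" "continuous_on S ?B"
    using f smooth_on_partial smooth_on_imp_continuous_on by blast+
  obtain d1 where d1: "d1 > 0" "\<And>y. y \<in> S \<Longrightarrow> dist y x < d1 \<Longrightarrow> \<bar>?A y - ?A x\<bar> < e"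
    using cont(1) e S(2) unfolding continuous_on_iff dist_real_def by metis
  obtain d2 where d2: "d2 > 0" "\<And>y. y \<in> S \<Longrightarrow> dist y x < d2 \<Longrightarrow> \<bar>?B y - ?B x\<bar> < e"
    using cont(2) e S(2) unfolding continuous_on_iff dist_real_def by metis
  obtain r where r: "r > 0" "\<And>s t. s \<in> {0..r} \<Longrightarrow> t \<in> {0..r} \<Longrightarrow> x + s *\<^sub>R axis i 1 + t *\<^sub>R axis j 1 \<in> S"
    using smooth_domain_rectangle[OF S] by metis
  \<comment> \<open>A point of the square is within \<open>2 * h\<close> of \<open>x\<close>; the
    thirds keep this below \<open>d1\<close> and \<open>d2\<close>.\<close>
  define h where "h = min r (min (d1/3) (d2/3))"
  have h: "h > 0" "h \<le> r" "2 * h < d1" "2 * h < d2" using r d1 d2 by (auto simp: h_def)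
  have near: "dist (x + s *\<^sub>R axis i 1 + t *\<^sub>R axis j 1) x \<le> 2 * h" if "s \<in> {0..h}" "t \<in> {0..h}" for s t
  proof -
    have "norm (s *\<^sub>R axis i (1::real) + t *\<^sub>R axis j 1 :: real^'n) \<le> \<bar>s\<bar> + \<bar>t\<bar>"
      by (rule order_trans[OF norm_triangle_ineq]) simp
    also have "\<dots> \<le> 2 * h" using that by auto
    finally show ?thesis by (simp add: dist_norm add.assoc)
  qed
  have C2: "Ck_on 2 S f" using f by (simp add: smooth_on_def)
  have Sij: "x + s *\<^sub>R axis i 1 + t *\<^sub>R axis j 1 \<in> S" "x + t *\<^sub>R axis j 1 + s *\<^sub>R axis i 1 \<in> S"
    if "s \<in> {0..h}" "t \<in> {0..h}" for s t
    using r(2)[of s t] that h by (auto simp: ac_simps)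
  obtain s t where st: "s \<in> {0..h}" "t \<in> {0..h}" and
    1: "f (x + h *\<^sub>R axis i 1 + h *\<^sub>R axis j 1) - f (x + h *\<^sub>R axis i 1) - f (x + h *\<^sub>R axis j 1) + f x
      = h * h * ?A (x + s *\<^sub>R axis i 1 + t *\<^sub>R axis j 1)"
    using second_difference_mvt[OF _ C2, of h x i j] Sij h by force
  obtain s' t' where st': "s' \<in> {0..h}" "t' \<in> {0..h}" and
    2: "f (x + h *\<^sub>R axis j 1 + h *\<^sub>R axis i 1) - f (x + h *\<^sub>R axis j 1) - f (x + h *\<^sub>R axis i 1) + f x
      = h * h * ?B (x + t' *\<^sub>R axis j 1 + s' *\<^sub>R axis i 1)"
    using second_difference_mvt[OF _ C2, of h x j i] Sij h by force
  have "h * h * ?A (x + s *\<^sub>R axis i 1 + t *\<^sub>R axis j 1) = h * h * ?B (x + t' *\<^sub>R axis j 1 + s' *\<^sub>R axis i 1)"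
    unfolding 1[symmetric] 2[symmetric] by (simp add: ac_simps)
  then have "?A (x + s *\<^sub>R axis i 1 + t *\<^sub>R axis j 1) = ?B (x + s' *\<^sub>R axis i 1 + t' *\<^sub>R axis j 1)"
    using h by (simp add: ac_simps)
  moreover have "\<bar>?A (x + s *\<^sub>R axis i 1 + t *\<^sub>R axis j 1) - ?A x\<bar> < e"
    using d1(2) near[OF st] h Sij st by force
  moreover have "\<bar>?B (x + s' *\<^sub>R axis i 1 + t' *\<^sub>R axis j 1) - ?B x\<bar> < e"
    using d2(2) near[OF st'] h Sij st' by force
  ultimately have "\<bar>?A x - ?B x\<bar> < 2 * e" by linarith
  then show False by (simp add: e_def)
qed

section \<open>Bump functions\<close>

text \<open>The derivatives of exp (-1/x) stay in the linear span of this family.\<close>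

definition flat :: "nat \<Rightarrow> real \<Rightarrow> real"
  where "flat k x = (if x > 0 then exp (- inverse x) * inverse x ^ k else 0)"

text \<open>With t = 1 / x the limit from the right is that of t^k / exp t at infinity.\<close>

lemma flat_tendsto_0: "(flat k \<longlongrightarrow> 0) (at 0)"
proof -
  have "((\<lambda>x::real. inverse x ^ k / exp (inverse x)) \<longlongrightarrow> 0) (at_right 0)"
    by (rule filterlim_compose[OF tendsto_power_div_exp_0 filterlim_inverse_at_top_right])
  moreover have "eventually (\<lambda>x. inverse x ^ k / exp (inverse x) = flat k x) (at_right (0::real))"
    using eventually_at_right_less[of "0::real"]
    by eventually_elim (simp add: flat_def exp_minus divide_inverse)
  ultimately have "(flat k \<longlongrightarrow> 0) (at_right 0)" using Lim_transform_eventually by blast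
  moreover have "(flat k \<longlongrightarrow> 0) (at_left 0)"
  proof (rule Lim_transform_eventually[OF tendsto_const])
    show "eventually (\<lambda>x. 0 = flat k x) (at_left 0)"
      unfolding eventually_at_filter by (simp add: flat_def)
  qed
  ultimately show ?thesis using filterlim_split_at by blast
qed

text \<open>For positive \<open>x\<close> this is the product rule. At 0 the difference quotient of
  \<open>flat k\<close> is \<open>flat (k + 1)\<close>, which tends to 0.\<close>

lemma flat_deriv: "(flat k has_real_derivative (flat (k + 2) x - real k * flat (k + 1) x)) (at x)"
proof (cases "x = 0")
  case True
  have "(flat k has_real_derivative 0) (at 0)"
    unfolding has_field_derivative_iff
  proof (rule Lim_transform_eventually[OF flat_tendsto_0[of "k + 1"]])
    show "eventually (\<lambda>h. flat (k + 1) h = (flat k h - flat k 0) / (h - 0)) (at 0)"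
      by (auto simp: flat_def eventually_at_filter divide_inverse)
  qed
  then show ?thesis using True by (simp add: flat_def)
next
  case False
  show ?thesis
  proof (cases "x > 0")
    case True
    have "((\<lambda>x. exp (- inverse x) * inverse x ^ k) has_real_derivative
        (flat (k + 2) x - real k * flat (k + 1) x)) (at x)"
    proof -
      have "((\<lambda>x. inverse x ^ k) has_real_derivative - (real k * inverse x ^ (k + 1))) (at x)"
      proof -
        have "(inverse has_real_derivative - (inverse x ^ 2)) (at x)"
          using DERIV_inverse[of x UNIV] True by (simp add: numeral_2_eq_2)
        from DERIV_power[OF this, of k] show ?thesis
          by (rule DERIV_cong) (cases k; simp add: power2_eq_square algebra_simps)
      qed
      moreover have "((\<lambda>x. exp (- inverse x)) has_real_derivative exp (- inverse x) * inverse x ^ 2) (at x)"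
        using True by (auto intro!: derivative_eq_intros simp: power2_eq_square)
      ultimately have "((\<lambda>x. exp (- inverse x) * inverse x ^ k) has_real_derivative
          exp (- inverse x) * inverse x ^ 2 * inverse x ^ k + - (real k * inverse x ^ (k + 1)) * exp (- inverse x)) (at x)"
        using DERIV_mult by blast
      then show ?thesis
        by (rule DERIV_cong)
          (use True in \<open>simp add: flat_def power_add algebra_simps power2_eq_square\<close>)
    qed
    then show ?thesis
      by (rule has_field_derivative_transform_within_open[of _ _ _ "{0<..}"]) (use True in \<open>auto simp: flat_def\<close>)
  next
    case neg: False
    have "((\<lambda>x. 0) has_real_derivative 0) (at x)" by simp
    then have "(flat k has_real_derivative 0) (at x)"
      by (rule has_field_derivative_transform_within_open[of _ _ _ "{..<0}"]) (use neg False in \<open>auto simp: flat_def\<close>)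
    then show ?thesis using neg by (simp add: flat_def)
  qed
qed

text \<open>Differentiation leads from one member to a combination of two later ones, so the
  induction on the order treats the whole family at once.\<close>

lemma smooth_on_flat:
  fixes f :: "real^'n::finite \<Rightarrow> real"
  assumes S: "smooth_domain S" and f: "smooth_on S f"
  shows "smooth_on S (\<lambda>x. flat k (f x))"
proof -
  have diff: "(\<lambda>x. flat k (f x)) differentiable (at x within S)" if "x \<in> S" for x k
  proof -
    have "(flat k has_derivative (*) (flat (k + 2) (f x) - real k * flat (k + 1) (f x))) (at (f x))"
      using flat_deriv by (simp add: has_field_derivative_def)
    from has_derivative_compose[OF has_derivative_frechet[OF smooth_on_imp_differentiable[OF f that]] this]
    show ?thesis unfolding differentiable_def by blast
  qed
  have "\<forall>k. Ck_on n S (\<lambda>x. flat k (f x))" for n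
  proof (induction n)
    case 0
    show ?case using diff by (simp add: differentiable_imp_continuous_on differentiable_on_def)
  next
    case (Suc n)
    have "Ck_on n S (partial i S (\<lambda>x. flat k (f x)))" for i k
    proof (rule Ck_on_congI)
      have "Ck_on n S (\<lambda>x. flat (k + 2) (f x) + (- real k) * flat (k + 1) (f x))"
        using Suc by (intro Ck_on_add[OF S] Ck_on_bilinear[OF S bounded_bilinear_mult] Ck_on_const[OF S]) auto
      then show "Ck_on n S (\<lambda>x. (flat (k + 2) (f x) + (- real k) * flat (k + 1) (f x)) * partial i S f x)"
        using f smooth_on_partial Ck_on_bilinear[OF S bounded_bilinear_mult] unfolding smooth_on_def by blast
      show "partial i S (\<lambda>x. flat k (f x)) x = (flat (k + 2) (f x) + (- real k) * flat (k + 1) (f x)) * partial i S f x"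
        if "x \<in> S" for x
        using partial_real_compose[OF S that smooth_on_imp_differentiable[OF f that] flat_deriv] by simp
    qed
    then show ?case using diff by (simp add: differentiable_on_def)
  qed
  then show ?thesis by (simp add: smooth_on_def)
qed

text \<open>A smooth step that is 1 up to t = 1 and 0 from t = 2 on. The denominator is positive
  because 2 - t and t - 1 are never both nonpositive.\<close>

definition flat_step :: "real \<Rightarrow> real"
  where "flat_step t = flat 0 (2 - t) / (flat 0 (2 - t) + flat 0 (t - 1))"

text \<open>Using the squared distance keeps the function smooth at the centre. It vanishes already
  from distance \<open>sqrt 2 * r\<close> on; the simpler bound \<open>2 * r\<close> is used
  throughout.\<close>

definition bump :: "real^'n::finite \<Rightarrow> real \<Rightarrow> real^'n \<Rightarrow> real"
  where "bump a r x = flat_step ((x - a) \<bullet> (x - a) / r\<^sup>2)"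

lemma flat_nonneg: "0 \<le> flat k x"
  by (simp add: flat_def)

lemma flat_0_pos: "0 < x \<Longrightarrow> 0 < flat 0 x"
  by (simp add: flat_def)

lemma flat_0_sum_pos: "0 < flat 0 (2 - t) + flat 0 (t - 1)"
  using flat_nonneg[of 0] flat_0_pos
  by (cases "t < 2") (auto simp: add_pos_nonneg add_nonneg_pos)

lemma smooth_on_flat_step:
  assumes "smooth_domain S" "smooth_on S f"
  shows "smooth_on S (\<lambda>x. flat_step (f x))"
proof -
  have "flat 0 (2 - f x) + flat 0 (f x - 1) \<noteq> 0" for x
    using flat_0_sum_pos[of "f x"] by linarith
  then show ?thesis unfolding flat_step_def
    by (intro smooth_on_divide smooth_on_add smooth_on_flat smooth_on_diff smooth_on_const assms)
qed

lemma smooth_on_bump: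
  assumes "smooth_domain S"
  shows "smooth_on S (bump a r)"
proof -
  have "smooth_on S (\<lambda>x. (x - a) \<bullet> (x - a) / r\<^sup>2)"
    unfolding divide_inverse
    by (intro smooth_on_mult smooth_on_bilinear[OF _ bounded_bilinear_inner] smooth_on_diff
        smooth_on_ident smooth_on_const assms)
  from smooth_on_flat_step[OF assms this] show ?thesis unfolding bump_def[abs_def] .
qed

lemma bump_range: "0 \<le> bump a r x" "bump a r x \<le> 1"
  using flat_0_sum_pos flat_nonneg by (auto simp: bump_def flat_step_def divide_le_eq)

lemma bump_eq_1:
  assumes "0 < r" "dist x a \<le> r"
  shows "bump a r x = 1"
proof -
  have "(x - a) \<bullet> (x - a) \<le> r\<^sup>2"
    using assms by (simp add: dist_norm power2_norm_eq_inner[symmetric] power_mono)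
  then have "(x - a) \<bullet> (x - a) / r\<^sup>2 \<le> 1" using assms by (simp add: divide_le_eq)
  then show ?thesis by (simp add: bump_def flat_step_def flat_def)
qed

lemma bump_eq_0:
  assumes "0 < r" "2 * r \<le> dist x a"
  shows "bump a r x = 0"
proof -
  have "(2 * r)\<^sup>2 \<le> (x - a) \<bullet> (x - a)"
    using assms unfolding dist_norm power2_norm_eq_inner[symmetric] by (intro power_mono) auto
  moreover have "2 * r\<^sup>2 \<le> (2 * r)\<^sup>2" by (simp add: power_mult_distrib)
  ultimately have "2 * r\<^sup>2 \<le> (x - a) \<bullet> (x - a)" by linarith
  then have "2 \<le> (x - a) \<bullet> (x - a) / r\<^sup>2" using assms by (simp add: le_divide_eq)
  then show ?thesis by (simp add: bump_def flat_step_def flat_def)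
qed

section \<open>Lipschitz constants of bump functions\<close>

lemma smooth_lipschitz_cball:
  fixes f :: "real^'n::finite \<Rightarrow> real"
  assumes "smooth_on UNIV f"
  obtains B where "0 \<le> B" "\<And>x y. x \<in> cball a r \<Longrightarrow> y \<in> cball a r \<Longrightarrow> \<bar>f x - f y\<bar> \<le> B * norm (x - y)"
proof -
  have "\<exists>b. \<forall>x\<in>cball a r. \<bar>partial i UNIV f x\<bar> \<le> b" for i
  proof -
    have "continuous_on (cball a r) (partial i UNIV f)"
      using assms smooth_on_partial smooth_on_imp_continuous_on continuous_on_subset by blast
    then have "bounded (partial i UNIV f ` cball a r)"
      using compact_continuous_image compact_imp_bounded compact_cball by blast
    then show ?thesis unfolding bounded_iff by auto
  qed
  then obtain b where b: "\<And>i x. x \<in> cball a r \<Longrightarrow> \<bar>partial i UNIV f x\<bar> \<le> b i" by metis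
  define B where "B = (\<Sum>i\<in>UNIV. \<bar>b i\<bar>)"
  have B: "0 \<le> B" by (simp add: B_def sum_nonneg)
  have "norm (f x - f y) \<le> B * norm (x - y)" if "x \<in> cball a r" "y \<in> cball a r" for x y
  proof (rule differentiable_bound[OF convex_cball[of a r] _ _ that])
    fix z assume z: "z \<in> cball a r"
    show "(f has_derivative (\<lambda>v. \<Sum>i\<in>UNIV. (v $ i) *\<^sub>R partial i UNIV f z)) (at z within cball a r)"
      using has_derivative_partial[OF smooth_on_imp_differentiable[OF assms UNIV_I]] has_derivative_subset by blast
    show "onorm (\<lambda>v. \<Sum>i\<in>UNIV. (v $ i) *\<^sub>R partial i UNIV f z) \<le> B"
    proof (rule onorm_bound[OF B])
      fix v :: "real^'n"
      have "norm (\<Sum>i\<in>UNIV. (v $ i) *\<^sub>R partial i UNIV f z) \<le> (\<Sum>i\<in>UNIV. \<bar>b i\<bar> * norm v)"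
      proof (rule order_trans[OF norm_sum], rule sum_mono)
        fix i
        have "\<bar>v $ i\<bar> * \<bar>partial i UNIV f z\<bar> \<le> norm v * \<bar>b i\<bar>"
          using b[OF z, of i] by (intro mult_mono component_le_norm_cart) auto
        then show "norm ((v $ i) *\<^sub>R partial i UNIV f z) \<le> \<bar>b i\<bar> * norm v"
          by (simp add: abs_mult mult.commute)
      qed
      then show "norm (\<Sum>i\<in>UNIV. (v $ i) *\<^sub>R partial i UNIV f z) \<le> B * norm v"
        by (simp add: B_def sum_distrib_right)
    qed
  qed
  then show ?thesis using that B by auto
qed

text \<open>Inside the ball of radius \<open>3 * r\<close> the derivative is bounded by compactness.
  If one point lies outside, either both values are 0 or the points are more than \<open>r\<close>
  apart, and then the slope \<open>1 / r\<close> bounds a difference of at most 1.\<close>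

lemma bump_lipschitz:
  assumes "0 < r"
  obtains L where "0 < L" "\<And>x y. \<bar>bump a r x - bump a r y\<bar> \<le> L * norm (x - y)"
proof -
  have "smooth_domain UNIV" by (simp add: smooth_domain_def)
  from smooth_lipschitz_cball[OF smooth_on_bump[OF this]]
  obtain B where B: "0 \<le> B"
    "\<And>x y. x \<in> cball a (3*r) \<Longrightarrow> y \<in> cball a (3*r) \<Longrightarrow> \<bar>bump a r x - bump a r y\<bar> \<le> B * norm (x - y)"
    by metis
  define L where "L = max B (1/r)"
  have L: "0 < L" using assms by (simp add: L_def less_max_iff_disj)
  have far: "\<bar>bump a r x - bump a r y\<bar> \<le> L * norm (x - y)" if y: "y \<notin> cball a (3*r)" for x y
  proof (cases "2 * r \<le> dist x a")
    case True
    moreover have "2 * r \<le> dist y a" using y assms by (simp add: dist_commute)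
    ultimately show ?thesis using bump_eq_0[OF assms, of x a] bump_eq_0[OF assms, of y a] L by simp
  next
    case False
    have "dist a y \<le> dist a x + dist x y" by (rule dist_triangle)
    then have "r < norm (x - y)" using y False by (auto simp: dist_norm norm_minus_commute)
    then have "1 \<le> (1/r) * norm (x - y)" using assms by (simp add: field_simps)
    also have "\<dots> \<le> L * norm (x - y)" by (rule mult_right_mono) (auto simp: L_def)
    finally show ?thesis using bump_range[of a r x] bump_range[of a r y] by linarith
  qed
  have "\<bar>bump a r x - bump a r y\<bar> \<le> L * norm (x - y)" for x y
  proof (cases "x \<in> cball a (3*r) \<and> y \<in> cball a (3*r)")
    case True
    then have "\<bar>bump a r x - bump a r y\<bar> \<le> B * norm (x - y)" using B by blast
    also have "\<dots> \<le> L * norm (x - y)" by (rule mult_right_mono) (auto simp: L_def)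
    finally show ?thesis .
  next
    case False
    then show ?thesis using far[of y x] far[of x y] by (auto simp: norm_minus_commute abs_minus_commute)
  qed
  then show ?thesis using that L by blast
qed

section \<open>Simultaneous diagonalisation\<close>

lemma inner_matrix_symmetric:
  fixes A :: "real^'n::finite^'n"
  assumes "transpose A = A"
  shows "x \<bullet> (A *v y) = y \<bullet> (A *v x)"
  using dot_lmul_matrix[of x A y] transpose_matrix_vector[of A x] assms by (simp add: inner_commute)

text \<open>The first-order condition at a minimum: at \<open>t = - c / D\<close>, with
  \<open>D\<close> a positive upper bound of \<open>d\<close>, the expression is at most
  \<open>- c\<^sup>2 / D\<close>.\<close>

lemma linear_term_zero:
  fixes c d :: real
  assumes "\<And>t. 0 \<le> 2 * t * c + t\<^sup>2 * d"
  shows "c = 0"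
proof (rule ccontr)
  assume c: "c \<noteq> 0"
  define D where "D = \<bar>d\<bar> + 1"
  have D: "D > 0" "d \<le> D" by (auto simp: D_def)
  have "2 * (- c / D) * c + (- c / D)\<^sup>2 * d \<le> 2 * (- c / D) * c + (- c / D)\<^sup>2 * D"
    using D by (intro add_left_mono mult_left_mono) auto
  also have "\<dots> = - (c\<^sup>2 / D)" using D by (simp add: power2_eq_square field_simps)
  also have "\<dots> < 0" using c D by simp
  finally show False using assms[of "- c / D"] by linarith
qed

text \<open>The Rayleigh quotient of \<open>B\<close> relative to \<open>h\<close> attains its
  maximum on the \<open>h\<close>-orthogonal complement \<open>V\<close> of the eigenvectors found
  so far. The maximiser satisfies the eigenvalue equation tested against \<open>V\<close> by the
  first-order condition, and tested against the earlier eigenvectors because these are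
  eigenvectors.\<close>

lemma generalized_eigenvector_exists:
  fixes h B :: "real^'n::finite^'n"
  assumes h: "transpose h = h" "\<And>v. v \<noteq> 0 \<Longrightarrow> v \<bullet> (h *v v) > 0" and B: "transpose B = B"
    and I: "finite I" "card I < CARD('n)"
    and e: "\<And>i. i \<in> I \<Longrightarrow> B *v e i = l i *\<^sub>R (h *v e i)"
      "\<And>i j. i \<in> I \<Longrightarrow> j \<in> I \<Longrightarrow> e i \<bullet> (h *v e j) = (if i = j then 1 else 0)"
  obtains u \<mu> where "B *v u = \<mu> *\<^sub>R (h *v u)" "u \<bullet> (h *v u) = 1" "\<And>i. i \<in> I \<Longrightarrow> u \<bullet> (h *v e i) = 0"
proof -
  define V where "V = {x. \<forall>i\<in>I. x \<bullet> (h *v e i) = 0}"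
  have "dim ((\<lambda>i. h *v e i) ` I) \<le> card ((\<lambda>i. h *v e i) ` I)"
    using I(1) by (intro dim_le_card') auto
  also have "\<dots> \<le> card I" using I(1) by (rule card_image_le)
  finally have "dim ((\<lambda>i. h *v e i) ` I) < DIM(real^'n)" using I(2) by simp
  then obtain z where z: "z \<noteq> 0" "\<And>y. y \<in> span ((\<lambda>i. h *v e i) ` I) \<Longrightarrow> orthogonal z y"
    using orthogonal_to_subspace_exists by blast
  have zV: "z \<in> V" using z(2) unfolding V_def orthogonal_def by (auto intro: span_base)
  have V_scale: "t *\<^sub>R x \<in> V" if "x \<in> V" for x t using that by (simp add: V_def)
  have V_add: "x + y \<in> V" if "x \<in> V" "y \<in> V" for x y using that by (simp add: V_def inner_add_left)
  have "V = (\<Inter>i\<in>I. {x. x \<bullet> (h *v e i) = 0})" by (auto simp: V_def)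
  moreover have "closed {x. x \<bullet> (h *v e i) = 0}" for i
    by (intro closed_Collect_eq continuous_intros)
  ultimately have "closed V" by (simp add: closed_INT)
  then have comp: "compact (sphere 0 1 \<inter> V)" by (intro compact_Int_closed) auto
  have "z /\<^sub>R norm z \<in> sphere 0 1 \<inter> V" using z(1) V_scale[OF zV] by simp
  then have ne: "sphere 0 1 \<inter> V \<noteq> {}" by blast
  let ?q = "\<lambda>x. (x \<bullet> (B *v x)) / (x \<bullet> (h *v x))"
  have "x \<bullet> (h *v x) \<noteq> 0" if "x \<in> sphere 0 1 \<inter> V" for x
  proof -
    have "x \<noteq> 0" using that by auto
    then show ?thesis using h(2)[of x] by simp
  qed
  then have "continuous_on (sphere 0 1 \<inter> V) ?q"
    by (intro continuous_intros linear_continuous_on matrix_vector_mul_bounded_linear) auto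
  from continuous_attains_sup[OF comp ne this]
  obtain u where u: "u \<in> sphere 0 1" "u \<in> V" "\<And>x. x \<in> sphere 0 1 \<inter> V \<Longrightarrow> ?q x \<le> ?q u"
    by blast
  define \<mu> where "\<mu> = ?q u"
  \<comment> \<open>Maximality of the quotient at \<open>u\<close> says that \<open>Q\<close> is
    nonnegative on \<open>V\<close> and zero at \<open>u\<close>.\<close>
  define Q where "Q x y = \<mu> * (x \<bullet> (h *v y)) - x \<bullet> (B *v y)" for x y
  have u0: "u \<noteq> 0" using u(1) by auto
  have Qu: "Q u u = 0" using h(2)[OF u0] by (simp add: Q_def \<mu>_def)
  have Q_sym: "Q x y = Q y x" for x y
    using inner_matrix_symmetric[OF h(1)] inner_matrix_symmetric[OF B] by (simp add: Q_def)
  have Q_nonneg: "0 \<le> Q x x" if "x \<in> V" for x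
  proof (cases "x = 0")
    case False
    have "x /\<^sub>R norm x \<in> sphere 0 1 \<inter> V" using False V_scale[OF that] by simp
    from u(3)[OF this] have "?q x \<le> \<mu>"
      using False by (simp add: \<mu>_def matrix_vector_mult_scaleR)
    then show ?thesis using h(2)[OF False] by (simp add: Q_def divide_le_eq)
  qed (simp add: Q_def)
  have Q_add: "Q (x + y) z = Q x z + Q y z" "Q z (x + y) = Q z x + Q z y" for x y z
    by (simp_all add: Q_def inner_add_left inner_add_right matrix_vector_right_distrib algebra_simps)
  have Q_scale: "Q (t *\<^sub>R x) z = t * Q x z" "Q z (t *\<^sub>R x) = t * Q z x" for t x z
    by (simp_all add: Q_def matrix_vector_mult_scaleR algebra_simps)
  have QV: "Q w u = 0" if "w \<in> V" for w
  proof (rule linear_term_zero)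
    fix t :: real
    have "0 \<le> Q (u + t *\<^sub>R w) (u + t *\<^sub>R w)" using Q_nonneg V_add V_scale that u(2) by blast
    then show "0 \<le> 2 * t * Q w u + t\<^sup>2 * Q w w"
      using Qu Q_sym[of u w] by (simp add: Q_add Q_scale power2_eq_square algebra_simps)
  qed
  have Qe: "Q (e i) u = 0" if "i \<in> I" for i
    using u(2) e(1)[OF that] that inner_matrix_symmetric[OF h(1), of u "e i"]
    by (subst Q_sym) (simp add: Q_def V_def)
  have "Q x u = 0" for x
  proof -
    \<comment> \<open>The \<open>h\<close>-orthogonal projection of \<open>x\<close> to the span of
      the earlier eigenvectors, so that \<open>x - y\<close> lies in \<open>V\<close>.\<close>
    define y where "y = (\<Sum>i\<in>I. (x \<bullet> (h *v e i)) *\<^sub>R e i)"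
    have "y \<bullet> (h *v e j) = x \<bullet> (h *v e j)" if "j \<in> I" for j
    proof -
      have "y \<bullet> (h *v e j) = (\<Sum>i\<in>I. (x \<bullet> (h *v e i)) * (e i \<bullet> (h *v e j)))"
        by (simp add: y_def inner_sum_left)
      also have "\<dots> = (\<Sum>i\<in>I. if i = j then x \<bullet> (h *v e j) else 0)"
        by (intro sum.cong) (use e(2) that in auto)
      finally show ?thesis using I(1) that by simp
    qed
    then have "x - y \<in> V" by (simp add: V_def inner_diff_left)
    moreover have "Q y u = 0"
    proof -
      have "Q y u = (\<Sum>i\<in>I. (x \<bullet> (h *v e i)) * Q (e i) u)"
        by (simp add: y_def Q_def inner_sum_left sum_distrib_left sum_subtractf algebra_simps)
      then show ?thesis by (simp add: Qe)
    qed
    ultimately have "Q ((x - y) + y) u = 0" using QV unfolding Q_add by simp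
    then show ?thesis by simp
  qed
  then have "x \<bullet> (\<mu> *\<^sub>R (h *v u) - B *v u) = 0" for x
    by (simp add: Q_def inner_diff_right)
  then have eig: "B *v u = \<mu> *\<^sub>R (h *v u)"
    using inner_eq_zero_iff[of "\<mu> *\<^sub>R (h *v u) - B *v u"] by simp
  define c where "c = 1 / sqrt (u \<bullet> (h *v u))"
  have c: "c * c * (u \<bullet> (h *v u)) = 1" using h(2)[OF u0] by (simp add: c_def)
  show thesis
  proof (rule that[of "c *\<^sub>R u" \<mu>])
    show "B *v (c *\<^sub>R u) = \<mu> *\<^sub>R (h *v (c *\<^sub>R u))"
      by (simp add: matrix_vector_mult_scaleR eig)
    show "(c *\<^sub>R u) \<bullet> (h *v (c *\<^sub>R u)) = 1" using c by (simp add: matrix_vector_mult_scaleR)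
    show "(c *\<^sub>R u) \<bullet> (h *v e i) = 0" if "i \<in> I" for i using u(2) that by (simp add: V_def)
  qed
qed

lemma simultaneous_diagonalisation:
  fixes h B :: "real^'n::finite^'n"
  assumes h: "transpose h = h" "\<And>v. v \<noteq> 0 \<Longrightarrow> v \<bullet> (h *v v) > 0" and B: "transpose B = B"
  obtains e :: "'n \<Rightarrow> real^'n" and l where "\<And>i. B *v e i = l i *\<^sub>R (h *v e i)"
    "\<And>i j. e i \<bullet> (h *v e j) = (if i = j then 1 else 0)"
proof -
  have "\<exists>(e :: 'n \<Rightarrow> real^'n) l. (\<forall>i\<in>I. B *v e i = l i *\<^sub>R (h *v e i)) \<and>
      (\<forall>i\<in>I. \<forall>j\<in>I. e i \<bullet> (h *v e j) = (if i = j then 1 else 0))" if "finite I" for I :: "'n set"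
    using that
  proof (induction I)
    case empty
    then show ?case by simp
  next
    case (insert a I)
    then obtain e :: "'n \<Rightarrow> real^'n" and l where e: "\<And>i. i \<in> I \<Longrightarrow> B *v e i = l i *\<^sub>R (h *v e i)"
      "\<And>i j. i \<in> I \<Longrightarrow> j \<in> I \<Longrightarrow> e i \<bullet> (h *v e j) = (if i = j then 1 else 0)" by blast
    have "card (insert a I) \<le> CARD('n)" by (intro card_mono) auto
    then have "card I < CARD('n)" using insert.hyps by simp
    from generalized_eigenvector_exists[OF h B insert.hyps(1) this e]
    obtain u \<mu> where u: "B *v u = \<mu> *\<^sub>R (h *v u)" "u \<bullet> (h *v u) = 1"
      "\<And>i. i \<in> I \<Longrightarrow> u \<bullet> (h *v e i) = 0" by metis
    have u': "e i \<bullet> (h *v u) = 0" if "i \<in> I" for i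
      using u(3)[OF that] inner_matrix_symmetric[OF h(1)] by simp
    show ?case
      by (rule exI[of _ "e(a := u)"], rule exI[of _ "l(a := \<mu>)"])
        (use e u u' insert.hyps in auto)
  qed
  from this[of UNIV] show ?thesis using that by auto
qed

text \<open>Similarity is stated without an inverse; the factor \<open>det P\<close> cancels between
  the two characteristic polynomials.\<close>

lemma eigenvalue_vector_similar:
  fixes M M' P :: "real^'n::finite^'n"
  assumes "M ** P = P ** M'" "det P \<noteq> 0" "eigenvalue_vector M' v"
  shows "eigenvalue_vector M v"
  unfolding eigenvalue_vector_def
proof
  fix t
  have "(mat t - M) ** P = P ** (mat t - M')"
  proof -
    have "mat t ** P = P ** mat t"
      by (simp add: vec_eq_iff matrix_matrix_mult_def mat_def if_distrib[of "\<lambda>z. z * _"] if_distrib[of "\<lambda>z. _ * z"] mult.commute cong: if_cong)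
    moreover have "(mat t - M) ** P = mat t ** P - M ** P" "P ** (mat t - M') = P ** mat t - P ** M'"
      by (simp_all add: vec_eq_iff matrix_matrix_mult_def left_diff_distrib right_diff_distrib sum_subtractf)
    ultimately show ?thesis using assms(1) by simp
  qed
  then have "det (mat t - M) * det P = det P * det (mat t - M')" by (metis det_mul)
  then show "det (mat t - M) = (\<Prod>i\<in>UNIV. t - v $ i)"
    using assms(2,3) by (simp add: eigenvalue_vector_def)
qed

lemma positive_definite_invertible:
  fixes h :: "real^'n::finite^'n"
  assumes "\<And>v. v \<noteq> 0 \<Longrightarrow> v \<bullet> (h *v v) > 0"
  shows "invertible h"
proof -
  have "h *v v = 0 \<Longrightarrow> v = 0" for v using assms[of v] by force
  then show ?thesis by (simp add: matrix_left_invertible_ker invertible_left_inverse)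
qed

text \<open>In the frame the eigenvalues are values of the quadratic form of \<open>B\<close>, so
  that later only quadratic forms need to be estimated. The last property is Parseval's identity for
  covectors: the matrix \<open>P\<close> with columns \<open>e i\<close> satisfies
  \<open>P ** transpose P = matrix_inv h\<close>.\<close>

lemma orthonormal_frame_eigenvalues:
  fixes h B :: "real^'n::finite^'n"
  assumes h: "transpose h = h" "\<And>v. v \<noteq> 0 \<Longrightarrow> v \<bullet> (h *v v) > 0" and B: "transpose B = B"
  obtains e :: "'n \<Rightarrow> real^'n" where "\<And>i. e i \<bullet> (h *v e i) = 1"
    "eigenvalue_vector (matrix_inv h ** B) (\<chi> i. e i \<bullet> (B *v e i))"
    "\<And>d. (\<Sum>i\<in>UNIV. (d \<bullet> e i)\<^sup>2) = d \<bullet> (matrix_inv h *v d)"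
proof -
  obtain e :: "'n \<Rightarrow> real^'n" and l where e: "\<And>i. B *v e i = l i *\<^sub>R (h *v e i)"
    "\<And>i j. e i \<bullet> (h *v e j) = (if i = j then 1 else 0)"
    using simultaneous_diagonalisation[OF h B] by metis
  have inv: "invertible h" by (rule positive_definite_invertible[OF h(2)])
  note hinv = matrix_inv_right[OF inv] matrix_inv_left[OF inv]
  define P :: "real^'n^'n" where "P = (\<chi> a i. e i $ a)"
  define D :: "real^'n^'n" where "D = (\<chi> i j. if i = j then l i else 0)"
  have P_col: "A ** P = (\<chi> a i. (A *v e i) $ a)" for A :: "real^'n^'n"
    by (simp add: P_def matrix_matrix_mult_def matrix_vector_mult_def)
  have PhP: "transpose P ** (h ** P) = mat 1"
    using e(2) by (simp add: P_col vec_eq_iff mat_def)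
      (simp add: P_def matrix_matrix_mult_def transpose_def inner_vec_def)
  then have detP: "det P \<noteq> 0"
    by (metis det_I det_mul mult_zero_left det_transpose zero_neq_one)
  have "(matrix_inv h ** B) *v e i = l i *\<^sub>R e i" for i
    using hinv(2) by (simp add: matrix_vector_mul_assoc[symmetric] e(1) matrix_vector_mult_scaleR)
      (simp add: matrix_vector_mul_assoc)
  then have "(matrix_inv h ** B) ** P = P ** D"
    by (simp add: P_col vec_eq_iff)
      (simp add: P_def D_def matrix_matrix_mult_def if_distrib[of "\<lambda>z. _ * z"] mult.commute cong: if_cong)
  moreover have "eigenvalue_vector D (\<chi> i. l i)"
    unfolding eigenvalue_vector_def
  proof
    fix t
    show "det (mat t - D) = (\<Prod>i\<in>UNIV. t - (\<chi> i. l i) $ i)"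
      by (subst det_diagonal) (auto simp: D_def mat_def)
  qed
  ultimately have eig: "eigenvalue_vector (matrix_inv h ** B) (\<chi> i. l i)"
    using eigenvalue_vector_similar detP by blast
  have l: "l i = e i \<bullet> (B *v e i)" for i using e by simp
  have sum: "(\<Sum>i\<in>UNIV. (d \<bullet> e i)\<^sup>2) = d \<bullet> (matrix_inv h *v d)" for d
  proof -
    have "P ** (transpose P ** h) = mat 1"
      using PhP matrix_left_right_inverse[of "transpose P ** h" P] by (simp add: matrix_mul_assoc)
    then have "matrix_inv h *v d = P *v (transpose P *v (h *v (matrix_inv h *v d)))"
      by (metis matrix_vector_mul_assoc matrix_vector_mul_lid)
    also have "\<dots> = P *v (transpose P *v d)" using hinv by (simp add: matrix_vector_mul_assoc)
    finally have "d \<bullet> (matrix_inv h *v d) = d \<bullet> (P *v (transpose P *v d))" by simp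
    also have "\<dots> = (transpose P *v d) \<bullet> (transpose P *v d)"
      by (simp add: dot_lmul_matrix[symmetric] transpose_matrix_vector)
    also have "\<dots> = (\<Sum>i\<in>UNIV. (d \<bullet> e i)\<^sup>2)"
      by (simp add: inner_vec_def P_def transpose_def matrix_vector_mult_def power2_eq_square mult.commute)
    finally show ?thesis by simp
  qed
  show thesis by (rule that[of e]) (use e(2) eig l sum in auto)
qed

section \<open>Symmetric cones\<close>

lemma cone_add:
  assumes "open_cone \<Gamma>" "convex \<Gamma>" "x \<in> \<Gamma>" "y \<in> \<Gamma>"
  shows "x + y \<in> \<Gamma>"
proof -
  have "(1/2) *\<^sub>R x + (1/2) *\<^sub>R y \<in> \<Gamma>" using assms by (intro convexD) auto
  then have "2 *\<^sub>R ((1/2) *\<^sub>R x + (1/2) *\<^sub>R y) \<in> \<Gamma>"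
    using assms(1) unfolding open_cone_def by (metis zero_less_numeral)
  then show ?thesis by (simp add: scaleR_add_right)
qed

text \<open>A nearby \<open>z\<close> in the cone replaces \<open>y\<close>, and the difference
  \<open>y - z\<close> is given to \<open>x\<close>, which has room around it in the open
  cone.\<close>

lemma cone_add_closure:
  assumes "open_cone \<Gamma>" "convex \<Gamma>" "x \<in> \<Gamma>" "y \<in> closure \<Gamma>"
  shows "x + y \<in> \<Gamma>"
proof -
  have "open \<Gamma>" using assms(1) by (simp add: open_cone_def)
  then obtain r where r: "r > 0" "ball x r \<subseteq> \<Gamma>" using assms(3) by (rule openE)
  obtain z where z: "z \<in> \<Gamma>" "dist z y < r" using assms(4) r(1) closure_approachable by metis
  have "x + (y - z) \<in> ball x r" using z(2) by (simp add: dist_norm norm_minus_commute)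
  then have "(x + (y - z)) + z \<in> \<Gamma>" using cone_add[OF assms(1,2)] z(1) r(2) by blast
  then show ?thesis by simp
qed

lemma cone_closure_scale:
  fixes y :: "real^'n::finite"
  assumes "open_cone \<Gamma>" "y \<in> closure \<Gamma>" "0 < t"
  shows "t *\<^sub>R y \<in> closure \<Gamma>"
proof -
  have "(\<lambda>x. t *\<^sub>R x) ` closure \<Gamma> \<subseteq> closure \<Gamma>"
  proof (rule image_closure_subset)
    show "(\<lambda>x. t *\<^sub>R x) ` \<Gamma> \<subseteq> closure \<Gamma>"
      using assms(1,3) closure_subset unfolding open_cone_def by blast
  qed (auto intro!: continuous_intros)
  then show ?thesis using assms(2) by blast
qed

lemma symmetric_set_closure:
  fixes x :: "real^'n::finite"
  assumes "symmetric_set \<Gamma>" "\<pi> permutes UNIV" "x \<in> closure \<Gamma>"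
  shows "(\<chi> i. x $ \<pi> i) \<in> closure \<Gamma>"
proof -
  have "(\<lambda>x::real^'n. \<chi> i. x $ \<pi> i) ` closure \<Gamma> \<subseteq> closure \<Gamma>"
  proof (rule image_closure_subset)
    show "(\<lambda>x. \<chi> i. x $ \<pi> i) ` \<Gamma> \<subseteq> closure \<Gamma>"
      using assms(1,2) closure_subset unfolding symmetric_set_def by blast
  qed (auto intro!: continuous_intros)
  then show ?thesis using assms(3) by blast
qed

text \<open>The vector (1, ..., 1, -1) is the multiple 2 / \<rho> of (1, ..., 1, 1 - \<rho>) plus 1
  - 2 / \<rho> times (1, ..., 1). For \<rho> > 2 the second summand is interior.\<close>

lemma reflected_ones_in_cone:
  fixes \<Gamma> :: "(real^'n::finite) set"
  assumes "open_cone \<Gamma>" "symmetric_set \<Gamma>" "convex \<Gamma>" "positive_cone \<subseteq> \<Gamma>" "is_varrho \<Gamma> \<rho>"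
  shows "2 \<le> \<rho> \<Longrightarrow> (\<chi> i. if i = k then - 1 else 1) \<in> closure \<Gamma>"
    and "2 < \<rho> \<Longrightarrow> (\<chi> i. if i = k then - 1 else 1) \<in> \<Gamma>"
proof -
  define z where "z k = (\<chi> i. if i = k then 1 - \<rho> else 1 :: real^'n)" for k :: 'n
  obtain k0 where "z k0 \<in> closure \<Gamma>"
    using assms(5) unfolding is_varrho_def z_def frontier_def by blast
  \<comment> \<open>The definition of \<rho> provides some distinguished coordinate
    \<open>k0\<close>; swapping it with \<open>k\<close> reaches every coordinate. The qualified
    name is the swap of two indices, not the transposed matrix.\<close>
  then have "(\<chi> i. z k0 $ (Transposition.transpose k k0 i)) \<in> closure \<Gamma>"
    by (intro symmetric_set_closure assms(2) permutes_swap_id) auto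
  moreover have "(\<chi> i. z k0 $ (Transposition.transpose k k0 i)) = z k"
    by (auto simp: z_def vec_eq_iff Transposition.transpose_def)
  ultimately have zk: "z k \<in> closure \<Gamma>" by simp
  show strict: "(\<chi> i. if i = k then - 1 else 1) \<in> \<Gamma>" if "2 < \<rho>"
  proof -
    have "(\<chi> i. 1 - 2 / \<rho>) \<in> \<Gamma>" using assms(4) that by (auto simp: positive_cone_def)
    moreover have "(2 / \<rho>) *\<^sub>R z k \<in> closure \<Gamma>" using cone_closure_scale[OF assms(1) zk] that by simp
    ultimately have "(\<chi> i. 1 - 2 / \<rho>) + (2 / \<rho>) *\<^sub>R z k \<in> \<Gamma>" using cone_add_closure assms by blast
    moreover have "(\<chi> i. 1 - 2 / \<rho>) + (2 / \<rho>) *\<^sub>R z k = (\<chi> i. if i = k then - 1 else 1)"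
      using that by (auto simp: z_def vec_eq_iff field_simps)
    ultimately show ?thesis by simp
  qed
  show "(\<chi> i. if i = k then - 1 else 1) \<in> closure \<Gamma>" if "2 \<le> \<rho>"
  proof (cases "\<rho> = 2")
    case True
    then show ?thesis using zk by (simp add: z_def cong: if_cong)
  next
    case False
    then show ?thesis using strict that closure_subset by auto
  qed
qed

lemma axis_in_cone_closure:
  fixes \<Gamma> :: "(real^'n::finite) set"
  assumes "open_cone \<Gamma>" "positive_cone \<subseteq> \<Gamma>"
  shows "axis k 1 \<in> closure \<Gamma>"
  unfolding closure_approachable
proof (intro allI impI)
  fix e :: real assume e: "e > 0"
  let ?one = "(\<chi> i. 1) :: real^'n"
  have n: "norm ?one > 0" by (simp add: vec_eq_iff)
  define t where "t = e / (2 * norm ?one)"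
  have t: "t > 0" using e n by (simp add: t_def)
  have "axis k 1 + t *\<^sub>R ?one \<in> positive_cone" using t by (auto simp: positive_cone_def axis_def)
  moreover have "dist (axis k 1 + t *\<^sub>R ?one) (axis k 1) < e"
    using e n by (simp add: dist_norm t_def)
  ultimately show "\<exists>y\<in>\<Gamma>. dist y (axis k 1) < e" using assms(2) by blast
qed

lemma cone_positive_combination:
  fixes z :: "'n::finite \<Rightarrow> real^'n"
  assumes "open_cone \<Gamma>" "convex \<Gamma>" "\<And>k. z k \<in> \<Gamma>" "\<And>k. 0 \<le> p k" "0 < (\<Sum>k\<in>UNIV. p k)"
  shows "(\<Sum>k\<in>UNIV. p k *\<^sub>R z k) \<in> \<Gamma>"
proof -
  let ?m = "\<Sum>k\<in>UNIV. p k"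
  have "(\<Sum>k\<in>UNIV. (p k / ?m) *\<^sub>R z k) \<in> \<Gamma>"
    using assms by (intro convex_sum) (auto simp: sum_divide_distrib[symmetric])
  then have "?m *\<^sub>R (\<Sum>k\<in>UNIV. (p k / ?m) *\<^sub>R z k) \<in> \<Gamma>"
    using assms(1,5) unfolding open_cone_def by blast
  then show ?thesis using assms(5) by (simp add: scaleR_sum_right)
qed

lemma open_cone_uniform_ball:
  fixes w :: "'n::finite \<Rightarrow> real^'n"
  assumes "open_cone \<Gamma>" "\<And>k. w k \<in> \<Gamma>"
  obtains r where "r > 0" "\<And>k. ball (w k) r \<subseteq> \<Gamma>"
proof -
  have "\<exists>r>0. ball (w k) r \<subseteq> \<Gamma>" for k
    using assms unfolding open_cone_def by (meson openE)
  then obtain R where R: "\<And>k. R k > 0" "\<And>k. ball (w k) (R k) \<subseteq> \<Gamma>" by metis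
  show thesis
  proof (rule that[of "Min (range R)"])
    show "Min (range R) > 0" using R(1) by simp
    show "ball (w k) (Min (range R)) \<subseteq> \<Gamma>" for k
    proof -
      have "Min (range R) \<le> R k" by simp
      then show ?thesis using R(2)[of k] subset_ball by blast
    qed
  qed
qed

text \<open>
  In an orthonormal frame, \<^term>\<open>p\<close> collects the squares of the components of a covector of square
  norm \<^term>\<open>m\<close>, so that the main term is the spectrum of a combination of the metric and of the
  square of the covector.
\<close>

lemma cone_margin:
  fixes \<Gamma> :: "(real^'n::finite) set"
  assumes \<Gamma>: "open_cone \<Gamma>" "symmetric_set \<Gamma>" "convex \<Gamma>" "positive_cone \<subseteq> \<Gamma>" "is_varrho \<Gamma> \<rho>"
    and \<rho>: "2 < \<rho> \<or> (type2_cone \<Gamma> \<and> 2 \<le> \<rho>)"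
  obtains \<delta> where "\<delta> > 0"
    "\<And>p m \<alpha> \<beta> r. \<lbrakk>\<And>i. 0 \<le> p i; (\<Sum>i\<in>UNIV. p i) = m; 0 < m; 0 < \<beta>; \<beta> \<le> \<alpha>; \<And>i. \<bar>r i\<bar> \<le> \<delta> * \<beta> * m\<rbrakk>
      \<Longrightarrow> (\<chi> i. \<alpha> * (m / 2 - p i) + \<beta> * p i + r i) \<in> \<Gamma>"
proof -
  define w where "w k = (\<chi> i. if i = k then - 1 else 1 :: real^'n)" for k :: 'n
  have w_cl: "w k \<in> closure \<Gamma>" for k
    using reflected_ones_in_cone(1)[OF \<Gamma>] \<rho> by (auto simp: w_def)
  have ax_cl: "axis k 1 \<in> closure \<Gamma>" for k by (rule axis_in_cone_closure[OF \<Gamma>(1,4)])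
  \<comment> \<open>Of the two vectors \<open>w k\<close> and \<open>axis k 1\<close> one is
    interior and absorbs \<open>y\<close>, while the other is only in the closure: for \<rho> > 2 it
    is \<open>w k\<close>, for type 2 it is \<open>axis k 1\<close>. Measuring \<open>y\<close> by
    the smaller coefficient \<open>b\<close> fits both cases.\<close>
  have "\<exists>\<epsilon>>0. \<forall>k y a b. 0 < b \<and> b \<le> a \<and> norm y < \<epsilon> * b \<longrightarrow> (a/2) *\<^sub>R w k + b *\<^sub>R axis k 1 + y \<in> \<Gamma>"
  proof (cases "2 < \<rho>")
    case True
    then have "w k \<in> \<Gamma>" for k using reflected_ones_in_cone(2)[OF \<Gamma>] by (simp add: w_def)
    then obtain r where r: "r > 0" "\<And>k. ball (w k) r \<subseteq> \<Gamma>" using open_cone_uniform_ball[OF \<Gamma>(1)] by metis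
    have "(a/2) *\<^sub>R w k + b *\<^sub>R axis k 1 + y \<in> \<Gamma>" if "0 < b" "b \<le> a" "norm y < (r/2) * b" for k y a b
    proof -
      have a: "a > 0" using that by simp
      have "norm y < (r/2) * a" using that r by (smt (verit) half_gt_zero mult_left_mono)
      then have "w k + (2/a) *\<^sub>R y \<in> ball (w k) r" using a by (simp add: dist_norm field_simps)
      then have "(a/2) *\<^sub>R (w k + (2/a) *\<^sub>R y) \<in> \<Gamma>" using r(2) a \<Gamma>(1) unfolding open_cone_def by (meson half_gt_zero subsetD)
      then have "(a/2) *\<^sub>R (w k + (2/a) *\<^sub>R y) + b *\<^sub>R axis k 1 \<in> \<Gamma>"
        using cone_add_closure[OF \<Gamma>(1,3)] cone_closure_scale[OF \<Gamma>(1) ax_cl that(1)] by blast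
      then show ?thesis using a by (simp add: scaleR_add_right add_ac)
    qed
    then show ?thesis using r(1) by (intro exI[of _ "r/2"]) auto
  next
    case False
    have "axis k 1 \<in> \<Gamma>" for k
    proof -
      have "axis k 1 \<notin> frontier \<Gamma>" using False \<rho> unfolding type2_cone_def type1_cone_def by blast
      then show ?thesis using ax_cl[of k] \<Gamma>(1) interior_open unfolding frontier_def open_cone_def by blast
    qed
    then obtain r where r: "r > 0" "\<And>k::'n. ball (axis k 1) r \<subseteq> \<Gamma>" using open_cone_uniform_ball[OF \<Gamma>(1), of "\<lambda>k. axis k 1"] by metis
    have "(a/2) *\<^sub>R w k + b *\<^sub>R axis k 1 + y \<in> \<Gamma>" if "0 < b" "b \<le> a" "norm y < r * b" for k y a b
    proof -
      have a: "a > 0" using that by simp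
      have "axis k 1 + (1/b) *\<^sub>R y \<in> ball (axis k 1) r" using that by (simp add: dist_norm field_simps)
      then have "b *\<^sub>R (axis k 1 + (1/b) *\<^sub>R y) \<in> \<Gamma>" using r(2) that(1) \<Gamma>(1) unfolding open_cone_def by blast
      then have "b *\<^sub>R (axis k 1 + (1/b) *\<^sub>R y) + (a/2) *\<^sub>R w k \<in> \<Gamma>"
        using cone_add_closure[OF \<Gamma>(1,3)] cone_closure_scale[OF \<Gamma>(1) w_cl, of "a/2"] a by simp
      then show ?thesis using that by (simp add: scaleR_add_right add_ac)
    qed
    then show ?thesis using r(1) by blast
  qed
  then obtain \<epsilon> where \<epsilon>: "\<epsilon> > 0" "\<And>k y a b. 0 < b \<Longrightarrow> b \<le> a \<Longrightarrow> norm y < \<epsilon> * b \<Longrightarrow>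
      (a/2) *\<^sub>R w k + b *\<^sub>R axis k 1 + y \<in> \<Gamma>" by metis
  \<comment> \<open>The factor \<open>CARD('n)\<close> pays for bounding the norm by the sum of the
    absolute values of the components, the factor 2 for a strict inequality.\<close>
  define \<delta> where "\<delta> = \<epsilon> / (2 * CARD('n))"
  have \<delta>: "\<delta> > 0" using \<epsilon>(1) by (simp add: \<delta>_def)
  show thesis
  proof (rule that[OF \<delta>])
    fix p r :: "'n \<Rightarrow> real" and m \<alpha> \<beta> :: real
    assume p: "\<And>i. 0 \<le> p i" "(\<Sum>i\<in>UNIV. p i) = m" "0 < m" and \<beta>: "0 < \<beta>" "\<beta> \<le> \<alpha>"
      and r: "\<And>i. \<bar>r i\<bar> \<le> \<delta> * \<beta> * m"
    \<comment> \<open>The weights \<open>p k\<close> add up to \<open>m\<close>, so the remainder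
      \<open>r\<close> is shared out by giving the same vector \<open>r / m\<close> to every
      summand.\<close>
    define y where "y = (\<chi> i. r i / m)"
    have "\<bar>y $ i\<bar> \<le> \<delta> * \<beta>" for i
      using r[of i] p(3) by (simp add: y_def divide_le_eq)
    then have "norm y \<le> (\<Sum>i\<in>(UNIV::'n set). \<delta> * \<beta>)"
      by (intro order_trans[OF norm_le_l1_cart] sum_mono)
    also have "\<dots> = (\<epsilon> * \<beta>) / 2" by (simp add: \<delta>_def)
    also have "\<dots> < \<epsilon> * \<beta>" using \<epsilon>(1) \<beta>(1) by simp
    finally have "(\<alpha>/2) *\<^sub>R w k + \<beta> *\<^sub>R axis k 1 + y \<in> \<Gamma>" for k using \<epsilon>(2) \<beta> by blast
    from cone_positive_combination[OF \<Gamma>(1,3) this p(1)]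
    have "(\<Sum>k\<in>UNIV. p k *\<^sub>R ((\<alpha>/2) *\<^sub>R w k + \<beta> *\<^sub>R axis k 1 + y)) \<in> \<Gamma>" using p by simp
    moreover have "(\<Sum>k\<in>UNIV. p k *\<^sub>R ((\<alpha>/2) *\<^sub>R w k + \<beta> *\<^sub>R axis k 1 + y)) =
      (\<chi> i. \<alpha> * (m / 2 - p i) + \<beta> * p i + r i)"
    proof (rule vec_eq_iff[THEN iffD2], rule allI)
      fix i
      have "(\<Sum>k\<in>UNIV. p k *\<^sub>R ((\<alpha>/2) *\<^sub>R w k + \<beta> *\<^sub>R axis k 1 + y)) $ i =
        (\<Sum>k\<in>UNIV. (\<alpha>/2 + r i / m) * p k + (if k = i then (\<beta> - \<alpha>) * p i else 0))"
        unfolding sum_component by (intro sum.cong) (auto simp: w_def y_def axis_def algebra_simps)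
      also have "\<dots> = (\<alpha>/2 + r i / m) * m + (\<beta> - \<alpha>) * p i"
        by (simp add: sum.distrib sum_distrib_left[symmetric] p(2))
      also have "\<dots> = \<alpha> * (m / 2 - p i) + \<beta> * p i + r i"
        using p(3) by (simp add: field_simps)
      finally show "(\<Sum>k\<in>UNIV. p k *\<^sub>R ((\<alpha>/2) *\<^sub>R w k + \<beta> *\<^sub>R axis k 1 + y)) $ i =
        (\<chi> i. \<alpha> * (m / 2 - p i) + \<beta> * p i + r i) $ i" by simp
    qed
    ultimately show "(\<chi> i. \<alpha> * (m / 2 - p i) + \<beta> * p i + r i) \<in> \<Gamma>" by simp
  qed
qed

section \<open>Curvature in coordinates\<close>

definition metric_on :: "(real^'n::finite) set \<Rightarrow> (real^'n \<Rightarrow> real^'n^'n) \<Rightarrow> bool"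
  where "metric_on S h \<longleftrightarrow> smooth_domain S \<and> smooth_on S h \<and>
    (\<forall>x\<in>S. transpose (h x) = h x \<and> (\<forall>v. v \<noteq> 0 \<longrightarrow> v \<bullet> (h x *v v) > 0))"

lemma metric_onD:
  assumes "metric_on S h"
  shows "smooth_domain S" "smooth_on S h" "x \<in> S \<Longrightarrow> transpose (h x) = h x"
    "x \<in> S \<Longrightarrow> v \<noteq> 0 \<Longrightarrow> v \<bullet> (h x *v v) > 0"
  using assms by (auto simp: metric_on_def)

lemma matrix_inv_symmetric:
  fixes h :: "real^'n::finite^'n"
  assumes "invertible h" "transpose h = h"
  shows "transpose (matrix_inv h) = matrix_inv h"
proof -
  have "transpose (matrix_inv h) ** h = mat 1"
    using matrix_inv_right[OF assms(1)] assms(2) by (metis matrix_transpose_mul transpose_mat)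
  then have "transpose (matrix_inv h) ** h ** matrix_inv h = matrix_inv h" by simp
  then show ?thesis by (simp add: matrix_mul_assoc[symmetric] matrix_inv_right[OF assms(1)])
qed

lemma metric_on_inv:
  assumes "metric_on S h" "x \<in> S"
  shows "invertible (h x)" "h x ** matrix_inv (h x) = mat 1" "matrix_inv (h x) ** h x = mat 1"
    "transpose (matrix_inv (h x)) = matrix_inv (h x)"
  using positive_definite_invertible[of "h x"] metric_onD[OF assms(1)] assms(2)
    matrix_inv_right matrix_inv_left matrix_inv_symmetric by blast+

lemma metric_on_nth_commute:
  assumes "metric_on S h" "x \<in> S"
  shows "h x $ i $ j = h x $ j $ i" "matrix_inv (h x) $ i $ j = matrix_inv (h x) $ j $ i"
  using metric_onD(3)[OF assms] metric_on_inv(4)[OF assms]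
  by (simp_all add: vec_eq_iff transpose_def)

lemma metric_on_partial_commute:
  assumes "metric_on S h" "x \<in> S"
  shows "partial i S (\<lambda>y. h y $ j $ l) x = partial i S (\<lambda>y. h y $ l $ j) x"
  using assms(2) by (intro partial_cong metric_on_nth_commute[OF assms(1)])

text \<open>The index form in which raising and then lowering an index, or the reverse, is undone by
  one rewriting.\<close>

lemma matrix_inverse_sum:
  fixes A B :: "real^'n::finite^'n"
  assumes "A ** B = mat 1"
  shows "(\<Sum>k\<in>UNIV. A $ j $ k * (\<Sum>m\<in>UNIV. B $ k $ m * a m)) = a j"
proof -
  have "A *v (B *v (\<chi> m. a m)) = (\<chi> m. a m)"
    using assms by (simp add: matrix_vector_mul_assoc)
  then have "(A *v (B *v (\<chi> m. a m))) $ j = a j" by simp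
  then show ?thesis by (simp add: matrix_vector_mult_def)
qed

lemma christoffel_sym:
  assumes "metric_on S h" "x \<in> S"
  shows "christoffel S h k i j x = christoffel S h k j i x"
  unfolding christoffel_def using metric_on_partial_commute[OF assms] by (simp add: add.commute)

text \<open>These are the Christoffel symbols of the first kind: lowering the upper index cancels
  the inverse metric.\<close>

lemma christoffel_lower:
  assumes "metric_on S h" "x \<in> S"
  shows "(\<Sum>k\<in>UNIV. h x $ j $ k * christoffel S h k i l x) =
    (1/2) * (partial i S (\<lambda>y. h y $ l $ j) x + partial l S (\<lambda>y. h y $ i $ j) x - partial j S (\<lambda>y. h y $ i $ l) x)"
proof -
  have "(\<Sum>k\<in>UNIV. h x $ j $ k * christoffel S h k i l x) = (1/2) *
    (\<Sum>k\<in>UNIV. h x $ j $ k * (\<Sum>m\<in>UNIV. matrix_inv (h x) $ k $ m *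
      (partial i S (\<lambda>y. h y $ l $ m) x + partial l S (\<lambda>y. h y $ i $ m) x - partial m S (\<lambda>y. h y $ i $ l) x)))"
    unfolding christoffel_def by (simp only: sum_distrib_left mult.left_commute)
  then show ?thesis unfolding matrix_inverse_sum[OF metric_on_inv(2)[OF assms]] .
qed

text \<open>Metric compatibility: the covariant derivative of \<open>h\<close> vanishes.\<close>

lemma christoffel_metric:
  assumes "metric_on S h" "x \<in> S"
  shows "partial i S (\<lambda>y. h y $ j $ l) x =
    (\<Sum>k\<in>UNIV. h x $ j $ k * christoffel S h k i l x) + (\<Sum>k\<in>UNIV. h x $ l $ k * christoffel S h k i j x)"
  unfolding christoffel_lower[OF assms] using metric_on_partial_commute[OF assms, of _ j l]
    metric_on_partial_commute[OF assms, of _ i l] metric_on_partial_commute[OF assms, of _ i j] by (simp add: field_simps)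

text \<open>The Levi-Civita connection is the only torsion-free metric one. This identifies the connection
  both of a conformal metric and of a pulled back metric without differentiating an inverse matrix.\<close>

lemma christoffel_unique:
  assumes h: "metric_on S h" "x \<in> S"
    and sym: "\<And>k i j. C k i j = C k j i"
    and compat: "\<And>i j l. partial i S (\<lambda>y. h y $ j $ l) x =
      (\<Sum>k\<in>UNIV. h x $ j $ k * C k i l) + (\<Sum>k\<in>UNIV. h x $ l $ k * C k i j)"
  shows "christoffel S h k i j x = C k i j"
proof -
  \<comment> \<open>The cyclic combination of Koszul's formula: with \<open>C\<close> symmetric, all
    terms but two equal ones cancel.\<close>
  have "partial i S (\<lambda>y. h y $ j $ l) x + partial j S (\<lambda>y. h y $ i $ l) x - partial l S (\<lambda>y. h y $ i $ j) x
      = 2 * (\<Sum>m\<in>UNIV. h x $ l $ m * C m i j)" for l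
    unfolding compat using sym by simp
  then have "christoffel S h k i j x =
      (\<Sum>l\<in>UNIV. matrix_inv (h x) $ k $ l * (\<Sum>m\<in>UNIV. h x $ l $ m * C m i j))"
    unfolding christoffel_def by (simp add: sum_distrib_left mult.left_commute)
  then show ?thesis by (simp add: matrix_inverse_sum[OF metric_on_inv(3)[OF h]])
qed

section \<open>Differentiating component functions, and the Ricci tensor in components\<close>

lemma smooth_on_christoffel:
  assumes "metric_on S h"
  shows "smooth_on S (christoffel S h k i j)"
proof -
  note S = metric_onD(1)[OF assms] and h = metric_onD(2)[OF assms]
  have "smooth_on S (\<lambda>x. matrix_inv (h x))"
    by (rule smooth_on_matrix_inv[OF S h metric_on_inv(1)[OF assms]])
  then show ?thesis unfolding christoffel_def[abs_def]
    by (intro smooth_on_mult smooth_on_const smooth_on_sum smooth_on_add smooth_on_diff smooth_on_nth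
        smooth_on_partial S h)
qed

lemma partial_nth:
  assumes "smooth_domain S" "x \<in> S" "smooth_on S A"
  shows "partial i S (\<lambda>y. A y $ j) x = partial i S A x $ j"
  by (rule partial_bounded_linear[OF assms(1,2) bounded_linear_vec_nth
        smooth_on_imp_differentiable[OF assms(3,2)]])

lemma partial_nth2:
  fixes A :: "real^'n::finite \<Rightarrow> real^'m::finite^'k::finite"
  assumes "smooth_domain S" "x \<in> S" "smooth_on S A"
  shows "partial i S (\<lambda>y. A y $ j $ l) x = partial i S A x $ j $ l"
  using partial_nth[OF assms(1,2) smooth_on_nth[OF assms(1,3)]] partial_nth[OF assms] by simp

lemmas smooth_partial_add = partial_add[OF _ _ smooth_on_imp_differentiable smooth_on_imp_differentiable]
lemmas smooth_partial_bilinear = partial_bilinear[OF _ _ _ smooth_on_imp_differentiable smooth_on_imp_differentiable]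

lemma smooth_partial_mult:
  fixes f g :: "real^'n::finite \<Rightarrow> real"
  assumes "smooth_domain S" "x \<in> S" "smooth_on S f" "smooth_on S g"
  shows "partial i S (\<lambda>x. f x * g x) x = f x * partial i S g x + partial i S f x * g x"
  by (rule smooth_partial_bilinear[OF assms(1,2) bounded_bilinear_mult assms(3,2,4,2)])

lemma smooth_partial_sum:
  assumes "smooth_domain S" "x \<in> S" "\<And>k. k \<in> K \<Longrightarrow> smooth_on S (f k)"
  shows "partial i S (\<lambda>x. \<Sum>k\<in>K. f k x) x = (\<Sum>k\<in>K. partial i S (f k) x)"
  using assms(3)
proof (induction K rule: infinite_finite_induct)
  case (insert k K)
  have "partial i S (\<lambda>x. f k x + (\<Sum>k\<in>K. f k x)) x = partial i S (f k) x + partial i S (\<lambda>x. \<Sum>k\<in>K. f k x) x"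
    using insert.prems by (intro smooth_partial_add[OF assms(1,2) _ assms(2) _ assms(2)] smooth_on_sum[OF assms(1)]) auto
  then show ?case using insert by simp
qed (use partial_const[OF assms(1,2)] in auto)

lemma smooth_partial_diff:
  assumes "smooth_domain S" "x \<in> S" "smooth_on S f" "smooth_on S g"
  shows "partial i S (\<lambda>x. f x - g x) x = partial i S f x - partial i S g x"
proof -
  have "partial i S (\<lambda>x. f x + - g x) x = partial i S f x + partial i S (\<lambda>x. - g x) x"
    by (intro smooth_partial_add[OF assms(1,2) _ assms(2) _ assms(2)] smooth_on_minus assms)
  moreover have "partial i S (\<lambda>x. - g x) x = - partial i S g x"
    by (rule partial_bounded_linear[OF assms(1,2) bounded_linear_minus[OF bounded_linear_ident]
          smooth_on_imp_differentiable[OF assms(4,2)]])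
  ultimately show ?thesis by simp
qed

text \<open>The contracted symbol, summed over its upper and first lower index, is kept as a factor:
  it behaves more simply than the full symbol, both for symmetry and under conformal change.\<close>

lemma ricci_nth:
  assumes "metric_on S h" "x \<in> S"
  shows "ricci S h x $ j $ k = (\<Sum>i\<in>UNIV. partial i S (christoffel S h i j k) x)
    - (\<Sum>i\<in>UNIV. partial j S (christoffel S h i i k) x)
    + (\<Sum>m\<in>UNIV. (\<Sum>i\<in>UNIV. christoffel S h i i m x) * christoffel S h m j k x)
    - (\<Sum>i\<in>UNIV. \<Sum>m\<in>UNIV. christoffel S h i j m x * christoffel S h m i k x)"
proof -
  have "(\<Sum>i\<in>UNIV. \<Sum>m\<in>UNIV. christoffel S h i i m x * christoffel S h m j k x) =
    (\<Sum>m\<in>UNIV. (\<Sum>i\<in>UNIV. christoffel S h i i m x) * christoffel S h m j k x)"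
    by (subst sum.swap) (simp add: sum_distrib_right)
  then show ?thesis by (simp add: ricci_def riemann_def sum.distrib sum_subtractf)
qed

subsection \<open>Symmetry of the Ricci tensor\<close>

text \<open>Obtained by differentiating the product of the inverse and \<open>h\<close>, which is
  constant.\<close>

lemma partial_matrix_inv:
  assumes "metric_on S h" "x \<in> S"
  shows "partial i S (\<lambda>y. matrix_inv (h y) $ a $ b) x =
    - (matrix_inv (h x) ** partial i S h x ** matrix_inv (h x)) $ a $ b"
proof -
  note S = metric_onD(1)[OF assms(1)] and h = metric_onD(2)[OF assms(1)]
  have hi: "smooth_on S (\<lambda>x. matrix_inv (h x))"
    by (rule smooth_on_matrix_inv[OF S h metric_on_inv(1)[OF assms(1)]])
  let ?H = "matrix_inv (h x)" and ?K = "partial i S (\<lambda>x. matrix_inv (h x)) x"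
  have "?H ** partial i S h x + ?K ** h x = 0"
  proof (simp add: vec_eq_iff, intro allI)
    fix a b
    have "partial i S (\<lambda>y. \<Sum>c\<in>UNIV. matrix_inv (h y) $ a $ c * h y $ c $ b) x = 0"
    proof -
      have "partial i S (\<lambda>y. \<Sum>c\<in>UNIV. matrix_inv (h y) $ a $ c * h y $ c $ b) x = partial i S (\<lambda>y. mat 1 $ a $ b) x"
        by (rule partial_cong[OF _ assms(2)])
          (use metric_on_inv(3)[OF assms(1)] in \<open>simp add: vec_eq_iff matrix_matrix_mult_def\<close>)
      then show ?thesis using partial_const[OF S assms(2)] by simp
    qed
    moreover have "partial i S (\<lambda>y. \<Sum>c\<in>UNIV. matrix_inv (h y) $ a $ c * h y $ c $ b) x =
      (\<Sum>c\<in>UNIV. matrix_inv (h x) $ a $ c * partial i S h x $ c $ b + ?K $ a $ c * h x $ c $ b)"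
      by (subst smooth_partial_sum[OF S assms(2)], intro smooth_on_mult smooth_on_nth S h hi)
        (intro sum.cong refl, subst smooth_partial_mult[OF S assms(2)],
          auto intro!: smooth_on_nth S h hi simp: partial_nth2[OF S assms(2)] h hi)
    ultimately show "(?H ** partial i S h x) $ a $ b + (?K ** h x) $ a $ b = 0"
      by (simp add: matrix_matrix_mult_def sum.distrib)
  qed
  then have "?K ** h x = - (?H ** partial i S h x)" by (simp add: add_eq_0_iff)
  moreover have "- A ** B = - (A ** B)" for A B :: "real^'n^'n"
    by (simp add: vec_eq_iff matrix_matrix_mult_def sum_negf)
  ultimately have "?K ** h x ** ?H = - (?H ** partial i S h x ** ?H)" by simp
  moreover have "?K ** h x ** ?H = ?K"
    by (simp add: matrix_mul_assoc[symmetric] metric_on_inv(2)[OF assms])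
  ultimately have "?K = - (?H ** partial i S h x ** ?H)" by simp
  then show ?thesis using partial_nth2[OF S assms(2) hi] by simp
qed

text \<open>Symmetry cancels two of the three derivatives of the metric. The rest is the derivative
  of \<open>ln (sqrt (det h))\<close>, written without determinants.\<close>

lemma christoffel_trace:
  assumes "metric_on S h" "x \<in> S"
  shows "(\<Sum>i\<in>UNIV. christoffel S h i i k x) =
    (1/2) * (\<Sum>i\<in>UNIV. \<Sum>l\<in>UNIV. matrix_inv (h x) $ i $ l * partial k S (\<lambda>y. h y $ i $ l) x)"
proof -
  let ?H = "matrix_inv (h x)" and ?D = "\<lambda>i j l. partial i S (\<lambda>y. h y $ j $ l) x"
  have "(\<Sum>i\<in>UNIV. \<Sum>l\<in>UNIV. ?H $ i $ l * ?D i k l) = (\<Sum>i\<in>UNIV. \<Sum>l\<in>UNIV. ?H $ i $ l * ?D l i k)"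
    by (subst sum.swap) (simp add: metric_on_nth_commute(2)[OF assms] metric_on_partial_commute[OF assms, of _ k])
  then have "(\<Sum>i\<in>UNIV. \<Sum>l\<in>UNIV. ?H $ i $ l * (?D i k l + ?D k i l - ?D l i k)) =
    (\<Sum>i\<in>UNIV. \<Sum>l\<in>UNIV. ?H $ i $ l * ?D k i l)"
    by (simp add: algebra_simps sum.distrib sum_subtractf)
  then show ?thesis by (simp only: christoffel_def sum_distrib_left[symmetric])
qed

text \<open>This is the term of the Ricci tensor whose symmetry is not seen by renaming indices; in
  effect it is a second derivative of \<open>ln (sqrt (det h))\<close>. Its two parts are symmetric
  because partial derivatives commute and because the trace of a product does not depend on the
  order.\<close>

lemma partial_christoffel_trace_commute:
  assumes "metric_on S h" "x \<in> S"
  shows "(\<Sum>i\<in>UNIV. partial j S (christoffel S h i i k) x) = (\<Sum>i\<in>UNIV. partial k S (christoffel S h i i j) x)"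
proof -
  note S = metric_onD(1)[OF assms(1)] and h = metric_onD(2)[OF assms(1)]
  have hi: "smooth_on S (\<lambda>x. matrix_inv (h x))"
    by (rule smooth_on_matrix_inv[OF S h metric_on_inv(1)[OF assms(1)]])
  let ?H = "matrix_inv (h x)" and ?P = "\<lambda>j. partial j S h x"
  have *: "(\<Sum>i\<in>UNIV. partial j S (christoffel S h i i k) x) =
    (1/2) * (\<Sum>i\<in>UNIV. \<Sum>l\<in>UNIV. ?H $ i $ l * partial j S (partial k S (\<lambda>y. h y $ i $ l)) x)
     - (1/2) * trace (?H ** ?P j ** (?H ** ?P k))" for j k
  proof -
    have "(\<Sum>i\<in>UNIV. partial j S (christoffel S h i i k) x) = partial j S (\<lambda>x. \<Sum>i\<in>UNIV. christoffel S h i i k x) x"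
      by (rule smooth_partial_sum[OF S assms(2) smooth_on_christoffel[OF assms(1)], symmetric])
    also have "\<dots> = partial j S (\<lambda>x. (1/2) * (\<Sum>i\<in>UNIV. \<Sum>l\<in>UNIV. matrix_inv (h x) $ i $ l * partial k S (\<lambda>y. h y $ i $ l) x)) x"
      by (rule partial_cong[OF christoffel_trace[OF assms(1)] assms(2)])
    also have "\<dots> = (1/2) * partial j S (\<lambda>x. \<Sum>i\<in>UNIV. \<Sum>l\<in>UNIV. matrix_inv (h x) $ i $ l * partial k S (\<lambda>y. h y $ i $ l) x) x"
      by (intro partial_bounded_linear[OF S assms(2) bounded_linear_mult_right] smooth_on_imp_differentiable[OF _ assms(2)]
          smooth_on_sum smooth_on_mult smooth_on_nth smooth_on_partial S h hi)
    also have "partial j S (\<lambda>x. \<Sum>i\<in>UNIV. \<Sum>l\<in>UNIV. matrix_inv (h x) $ i $ l * partial k S (\<lambda>y. h y $ i $ l) x) x =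
      (\<Sum>i\<in>UNIV. \<Sum>l\<in>UNIV. partial j S (\<lambda>x. matrix_inv (h x) $ i $ l * partial k S (\<lambda>y. h y $ i $ l) x) x)"
      by (subst smooth_partial_sum[OF S assms(2)], intro smooth_on_sum smooth_on_mult smooth_on_nth smooth_on_partial S h hi)
        (intro sum.cong refl smooth_partial_sum[OF S assms(2)] smooth_on_mult smooth_on_nth smooth_on_partial S h hi)
    also have "\<dots> = (\<Sum>i\<in>UNIV. \<Sum>l\<in>UNIV. ?H $ i $ l * partial j S (partial k S (\<lambda>y. h y $ i $ l)) x
        - (?H ** ?P j ** ?H) $ i $ l * ?P k $ i $ l)"
      by (intro sum.cong refl, subst smooth_partial_mult[OF S assms(2)])
        (auto intro!: smooth_on_nth smooth_on_partial S h hi simp: partial_matrix_inv[OF assms] partial_nth2[OF S assms(2) h])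
    also have "\<dots> = (\<Sum>i\<in>UNIV. \<Sum>l\<in>UNIV. ?H $ i $ l * partial j S (partial k S (\<lambda>y. h y $ i $ l)) x)
        - (\<Sum>i\<in>UNIV. \<Sum>l\<in>UNIV. (?H ** ?P j ** ?H) $ i $ l * ?P k $ l $ i)"
      using metric_on_partial_commute[OF assms] by (simp add: sum_subtractf partial_nth2[OF S assms(2) h])
    also have "(\<Sum>i\<in>UNIV. \<Sum>l\<in>UNIV. (?H ** ?P j ** ?H) $ i $ l * ?P k $ l $ i) = trace (?H ** ?P j ** ?H ** ?P k)"
      unfolding trace_def by (subst (4) matrix_matrix_mult_def) simp
    finally show ?thesis by (simp add: matrix_mul_assoc right_diff_distrib)
  qed
  have "partial j S (partial k S (\<lambda>y. h y $ i $ l)) x = partial k S (partial j S (\<lambda>y. h y $ i $ l)) x" for i l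
    by (intro partial_commute S assms smooth_on_nth h)
  then show ?thesis unfolding * using trace_mul_sym[of "?H ** ?P j" "?H ** ?P k"] by simp
qed

text \<open>It makes the matrix of the Schouten tensor symmetric, without which the diagonalisation
  in an orthonormal frame would not apply.\<close>

lemma ricci_sym:
  assumes "metric_on S h" "x \<in> S"
  shows "ricci S h x $ j $ k = ricci S h x $ k $ j"
proof -
  have 1: "partial i S (christoffel S h i j k) x = partial i S (christoffel S h i k j) x" for i
    by (rule partial_cong[OF christoffel_sym[OF assms(1)] assms(2)])
  have 2: "(\<Sum>i\<in>UNIV. \<Sum>m\<in>UNIV. christoffel S h i j m x * christoffel S h m i k x) =
    (\<Sum>i\<in>UNIV. \<Sum>m\<in>UNIV. christoffel S h i k m x * christoffel S h m i j x)"
    by (subst sum.swap) (simp add: christoffel_sym[OF assms, of _ _ j] christoffel_sym[OF assms, of _ _ k] mult.commute)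
  show ?thesis unfolding ricci_nth[OF assms] 2 partial_christoffel_trace_commute[OF assms, of j]
    using 1 christoffel_sym[OF assms, of _ j k] by simp
qed

lemma transpose_schouten:
  assumes "metric_on S h" "x \<in> S"
  shows "transpose (schouten S h x) = schouten S h x"
  using ricci_sym[OF assms] metric_on_nth_commute(1)[OF assms]
  by (simp add: schouten_def vec_eq_iff transpose_def)

subsection \<open>Conformal change of the metric\<close>

definition gradient :: "(real^'n::finite) set \<Rightarrow> (real^'n \<Rightarrow> real^'n^'n) \<Rightarrow> (real^'n \<Rightarrow> real) \<Rightarrow> 'n \<Rightarrow> real^'n \<Rightarrow> real"
  where "gradient S h u l x = (\<Sum>m\<in>UNIV. matrix_inv (h x) $ l $ m * partial m S u x)"

definition gradient_sq :: "(real^'n::finite) set \<Rightarrow> (real^'n \<Rightarrow> real^'n^'n) \<Rightarrow> (real^'n \<Rightarrow> real) \<Rightarrow> real^'n \<Rightarrow> real"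
  where "gradient_sq S h u x = (\<Sum>m\<in>UNIV. partial m S u x * gradient S h u m x)"

definition hessian :: "(real^'n::finite) set \<Rightarrow> (real^'n \<Rightarrow> real^'n^'n) \<Rightarrow> (real^'n \<Rightarrow> real) \<Rightarrow> 'n \<Rightarrow> 'n \<Rightarrow> real^'n \<Rightarrow> real"
  where "hessian S h u j k x =
    partial j S (partial k S u) x - (\<Sum>m\<in>UNIV. christoffel S h m j k x * partial m S u x)"

text \<open>The divergence of the gradient, which is the form in which it arises from contracting
  the curvature. Its agreement with the trace of the Hessian is
  \<open>hessian_trace\<close>.\<close>

definition laplacian :: "(real^'n::finite) set \<Rightarrow> (real^'n \<Rightarrow> real^'n^'n) \<Rightarrow> (real^'n \<Rightarrow> real) \<Rightarrow> real^'n \<Rightarrow> real"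
  where "laplacian S h u x = (\<Sum>i\<in>UNIV. partial i S (gradient S h u i) x)
    + (\<Sum>m\<in>UNIV. (\<Sum>i\<in>UNIV. christoffel S h i i m x) * gradient S h u m x)"

lemma smooth_on_gradient:
  assumes "metric_on S h" "smooth_on S u"
  shows "smooth_on S (gradient S h u l)"
  unfolding gradient_def[abs_def]
  by (intro smooth_on_sum smooth_on_mult smooth_on_nth smooth_on_partial smooth_on_matrix_inv
      metric_on_inv(1)[OF assms(1)] metric_onD[OF assms(1)] assms(2))

lemma gradient_lower:
  assumes "metric_on S h" "x \<in> S"
  shows "(\<Sum>l\<in>UNIV. h x $ k $ l * gradient S h u l x) = partial k S u x"
  unfolding gradient_def by (rule matrix_inverse_sum[OF metric_on_inv(2)[OF assms]])

lemma metric_on_conformal: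
  assumes h: "metric_on S h" and u: "smooth_on S u"
  shows "metric_on S (\<lambda>x. exp (2 * u x) *\<^sub>R h x)"
  unfolding metric_on_def
proof (intro conjI ballI allI impI)
  show "smooth_domain S" by (rule metric_onD(1)[OF h])
  show "smooth_on S (\<lambda>x. exp (2 * u x) *\<^sub>R h x)"
    by (intro smooth_on_scaleR smooth_on_exp smooth_on_mult smooth_on_const u metric_onD[OF h])
  fix x assume x: "x \<in> S"
  show "transpose (exp (2 * u x) *\<^sub>R h x) = exp (2 * u x) *\<^sub>R h x"
    using metric_onD(3)[OF h x] by (simp add: transpose_scalar)
  fix v :: "real^'a" assume "v \<noteq> 0"
  from metric_onD(4)[OF h x this] show "0 < v \<bullet> ((exp (2 * u x) *\<^sub>R h x) *v v)"
    by (simp add: scaleR_matrix_vector_assoc[symmetric])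
qed

text \<open>The right side is symmetric and compatible with the conformal metric; compatibility is
  the product rule together with lowering the index of the gradient. Uniqueness of the connection
  does the rest.\<close>

lemma christoffel_conformal:
  assumes h: "metric_on S h" and u: "smooth_on S u" and x: "x \<in> S"
  shows "christoffel S (\<lambda>x. exp (2 * u x) *\<^sub>R h x) l i m x =
    christoffel S h l i m x + ((if l = m then partial i S u x else 0) + (if l = i then partial m S u x else 0)
      - gradient S h u l x * h x $ i $ m)"
proof (rule christoffel_unique[OF metric_on_conformal[OF h u] x])
  note S = metric_onD(1)[OF h] and sh = metric_onD(2)[OF h]
  let ?d = "\<lambda>i. partial i S u x" and ?U = "\<lambda>l. gradient S h u l x" and ?G = "\<lambda>l i m. christoffel S h l i m x"
  let ?T = "\<lambda>k i j. (if k = j then ?d i else 0) + (if k = i then ?d j else 0) - ?U k * h x $ i $ j"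
  show "?G k i j + ?T k i j = ?G k j i + ?T k j i" for k i j
    using christoffel_sym[OF h x] metric_on_nth_commute(1)[OF h x, of i j] by simp
  fix i j l
  have T: "(\<Sum>k\<in>UNIV. h x $ j $ k * ?T k i l) = h x $ j $ l * ?d i + h x $ j $ i * ?d l - ?d j * h x $ i $ l" for j l
  proof -
    have "(\<Sum>k\<in>UNIV. h x $ j $ k * ?T k i l) = h x $ j $ l * ?d i + h x $ j $ i * ?d l - (\<Sum>k\<in>UNIV. h x $ j $ k * ?U k) * h x $ i $ l"
      by (simp add: distrib_left right_diff_distrib sum.distrib sum_subtractf sum_distrib_right mult.assoc
          if_distrib[of "\<lambda>z. _ * z"] cong: if_cong)
    then show ?thesis by (simp add: gradient_lower[OF h x])
  qed
  have D: "(\<Sum>k\<in>UNIV. (c *\<^sub>R h x) $ j $ k * (f k + f' k)) =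
      c * ((\<Sum>k\<in>UNIV. h x $ j $ k * f k) + (\<Sum>k\<in>UNIV. h x $ j $ k * f' k))" for c j f f'
    by (simp add: distrib_left sum.distrib sum_distrib_left mult.assoc)
  have "partial i S (\<lambda>y. (exp (2 * u y) *\<^sub>R h y) $ j $ l) x =
      exp (2 * u x) * partial i S (\<lambda>y. h y $ j $ l) x + partial i S (\<lambda>y. exp (2 * u y)) x * h x $ j $ l"
    by (simp, rule smooth_partial_mult[OF S x]) (intro smooth_on_exp smooth_on_mult smooth_on_const smooth_on_nth S u sh)+
  also have "partial i S (\<lambda>y. exp (2 * u y)) x = (2 * exp (2 * u x)) * ?d i"
    by (rule partial_real_compose[OF S x smooth_on_imp_differentiable[OF u x], of "\<lambda>t. exp (2 * t)"])
      (auto intro!: derivative_eq_intros)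
  also have "partial i S (\<lambda>y. h y $ j $ l) x = (\<Sum>k\<in>UNIV. h x $ j $ k * ?G k i l) + (\<Sum>k\<in>UNIV. h x $ l $ k * ?G k i j)"
    by (rule christoffel_metric[OF h x])
  finally show "partial i S (\<lambda>y. (exp (2 * u y) *\<^sub>R h y) $ j $ l) x =
      (\<Sum>k\<in>UNIV. (exp (2 * u x) *\<^sub>R h x) $ j $ k * (?G k i l + ?T k i l)) +
      (\<Sum>k\<in>UNIV. (exp (2 * u x) *\<^sub>R h x) $ l $ k * (?G k i j + ?T k i j))"
    using metric_on_nth_commute(1)[OF h x, of l j] metric_on_nth_commute(1)[OF h x, of i l] metric_on_nth_commute(1)[OF h x, of i j]
    unfolding D T by (simp add: algebra_simps)
qed

text \<open>The index algebra of the quadratic part of the Ricci tensor at one point: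
  \<open>d\<close> is the differential, \<open>U\<close> the gradient and \<open>T\<close> the
  difference of the two connections. By metric compatibility the sum multiplied by
  \<open>U i\<close> is the derivative of \<open>h $ j $ k\<close> along \<open>i\<close>; it
  cancels against the same term in the differentiated part of the curvature.\<close>

lemma conformal_quadratic_terms:
  fixes G :: "'n::finite \<Rightarrow> 'n \<Rightarrow> 'n \<Rightarrow> real" and d U :: "'n \<Rightarrow> real" and h :: "real^'n^'n"
  assumes G: "\<And>k i j. G k i j = G k j i" and h: "\<And>i j. h $ i $ j = h $ j $ i"
    and U: "\<And>i. (\<Sum>k\<in>UNIV. h $ i $ k * U k) = d i"
  defines "T \<equiv> \<lambda>l i m. (if l = m then d i else 0) + (if l = i then d m else 0) - U l * h $ i $ m"
  shows "(\<Sum>i\<in>UNIV. \<Sum>m\<in>UNIV. (G i j m + T i j m) * (G m i k + T m i k)) =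
    (\<Sum>i\<in>UNIV. \<Sum>m\<in>UNIV. G i j m * G m i k)
    + 2 * (\<Sum>i\<in>UNIV. G i j k * d i) + (\<Sum>i\<in>UNIV. G i i j) * d k + (\<Sum>i\<in>UNIV. G i i k) * d j
    - (\<Sum>i\<in>UNIV. U i * ((\<Sum>a\<in>UNIV. h $ j $ a * G a i k) + (\<Sum>a\<in>UNIV. h $ k $ a * G a i j)))
    + (real CARD('n) + 2) * d j * d k - 2 * (\<Sum>i\<in>UNIV. d i * U i) * h $ j $ k"
proof -
  note exp = distrib_left distrib_right left_diff_distrib right_diff_distrib sum.distrib sum_subtractf
    if_distrib[of "\<lambda>z. _ * z"] if_distrib[of "\<lambda>z. z * _"]
  have U': "(\<Sum>k\<in>UNIV. U k * h $ i $ k) = d i" "(\<Sum>k\<in>UNIV. U k * h $ k $ i) = d i" for i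
    using U[of i] h by (simp_all add: mult.commute)
  have A: "(\<Sum>i\<in>UNIV. \<Sum>m\<in>UNIV. G i j m * T m i k) = (\<Sum>i\<in>UNIV. G i j k * d i) + (\<Sum>i\<in>UNIV. G i i j) * d k
      - (\<Sum>i\<in>UNIV. U i * (\<Sum>a\<in>UNIV. h $ k $ a * G a i j))"
  proof -
    have "(\<Sum>i\<in>UNIV. \<Sum>m\<in>UNIV. G i j m * T m i k) = (\<Sum>i\<in>UNIV. G i j k * d i) + (\<Sum>i\<in>UNIV. G i j i * d k)
      - (\<Sum>i\<in>UNIV. \<Sum>m\<in>UNIV. G i j m * (U m * h $ i $ k))"
      by (simp add: T_def exp cong: if_cong)
    also have "(\<Sum>i\<in>UNIV. \<Sum>m\<in>UNIV. G i j m * (U m * h $ i $ k)) = (\<Sum>i\<in>UNIV. U i * (\<Sum>a\<in>UNIV. h $ k $ a * G a i j))"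
      by (subst sum.swap) (simp add: sum_distrib_left G[of _ j] h[of _ k] mult_ac)
    finally show ?thesis by (simp add: sum_distrib_right G[of _ j])
  qed
  have B: "(\<Sum>i\<in>UNIV. \<Sum>m\<in>UNIV. T i j m * G m i k) = (\<Sum>i\<in>UNIV. G i j k * d i) + (\<Sum>i\<in>UNIV. G i i k) * d j
      - (\<Sum>i\<in>UNIV. U i * (\<Sum>a\<in>UNIV. h $ j $ a * G a i k))"
  proof -
    have "(\<Sum>m\<in>UNIV. if P then f m else 0) = (if P then sum f UNIV else 0)" for P and f :: "'n \<Rightarrow> real"
      by simp
    then show ?thesis
      by (simp add: T_def exp cong: if_cong) (simp add: sum_distrib_left sum_distrib_right mult_ac)
  qed
  have C: "(\<Sum>i\<in>UNIV. \<Sum>m\<in>UNIV. T i j m * T m i k) =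
      (real CARD('n) + 2) * d j * d k - 2 * (\<Sum>i\<in>UNIV. d i * U i) * h $ j $ k"
  proof -
    have T1: "(\<Sum>i\<in>UNIV. T i j k * d i) = 2 * d j * d k - (\<Sum>i\<in>UNIV. d i * U i) * h $ j $ k"
      by (simp add: T_def exp cong: if_cong) (simp add: sum_distrib_left sum_distrib_right mult_ac)
    have T2: "(\<Sum>i\<in>UNIV. T i j i * d k) = real CARD('n) * d j * d k"
      using U'(1)[of j] by (simp add: T_def exp sum_distrib_right[symmetric] cong: if_cong)
    have T3: "(\<Sum>i\<in>UNIV. T i j m * h $ i $ k) = h $ m $ k * d j + h $ j $ k * d m - d k * h $ j $ m" for m
    proof -
      have "(\<Sum>i\<in>UNIV. U i * h $ j $ m * h $ i $ k) = (\<Sum>i\<in>UNIV. U i * h $ i $ k) * h $ j $ m"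
        unfolding sum_distrib_right by (simp add: mult_ac)
      then show ?thesis by (simp add: T_def exp U' mult_ac cong: if_cong)
    qed
    have "(\<Sum>i\<in>UNIV. \<Sum>m\<in>UNIV. T i j m * T m i k) = (\<Sum>i\<in>UNIV. T i j k * d i) + (\<Sum>i\<in>UNIV. T i j i * d k)
      - (\<Sum>i\<in>UNIV. \<Sum>m\<in>UNIV. T i j m * (U m * h $ i $ k))"
      by (subst (2) T_def) (simp add: exp cong: if_cong)
    also have "(\<Sum>i\<in>UNIV. \<Sum>m\<in>UNIV. T i j m * (U m * h $ i $ k)) = (\<Sum>m\<in>UNIV. U m * (\<Sum>i\<in>UNIV. T i j m * h $ i $ k))"
      by (subst sum.swap) (simp add: sum_distrib_left mult_ac)
    also have "\<dots> = (\<Sum>m\<in>UNIV. U m * h $ m $ k) * d j + (\<Sum>m\<in>UNIV. d m * U m) * h $ j $ k - d k * (\<Sum>m\<in>UNIV. U m * h $ j $ m)"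
      unfolding T3 by (simp add: exp sum_distrib_left sum_distrib_right mult_ac)
    finally show ?thesis unfolding T1 T2 U' by (simp add: algebra_simps)
  qed
  have "(\<Sum>i\<in>UNIV. \<Sum>m\<in>UNIV. (G i j m + T i j m) * (G m i k + T m i k)) =
    (\<Sum>i\<in>UNIV. \<Sum>m\<in>UNIV. G i j m * G m i k) + (\<Sum>i\<in>UNIV. \<Sum>m\<in>UNIV. G i j m * T m i k)
    + ((\<Sum>i\<in>UNIV. \<Sum>m\<in>UNIV. T i j m * G m i k) + (\<Sum>i\<in>UNIV. \<Sum>m\<in>UNIV. T i j m * T m i k))"
    by (simp only: distrib_left distrib_right sum.distrib add.assoc add.commute add.left_commute)
  then show ?thesis unfolding A B C by (simp add: distrib_left sum.distrib)
qed

text \<open>The four sums of \<open>ricci_nth\<close> are expanded in turn. The terms that contain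
  Christoffel symbols recombine into the covariant Hessian and the Laplacian.\<close>

lemma ricci_conformal:
  fixes h :: "real^'n::finite \<Rightarrow> real^'n^'n"
  assumes h: "metric_on S h" and u: "smooth_on S u" and x: "x \<in> S"
  shows "ricci S (\<lambda>x. exp (2 * u x) *\<^sub>R h x) x $ j $ k = ricci S h x $ j $ k
    - (real CARD('n) - 2) * (hessian S h u j k x - partial j S u x * partial k S u x)
    - (laplacian S h u x + (real CARD('n) - 2) * gradient_sq S h u x) * h x $ j $ k"
proof -
  note S = metric_onD(1)[OF h] and sh = metric_onD(2)[OF h]
  note su = smooth_on_partial[OF u] and sU = smooth_on_gradient[OF h u] and sG = smooth_on_christoffel[OF h]
  let ?hh = "\<lambda>x. exp (2 * u x) *\<^sub>R h x"
  let ?d = "\<lambda>i. partial i S u x" and ?U = "\<lambda>l. gradient S h u l x" and ?G = "\<lambda>l i m. christoffel S h l i m x"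
  let ?n = "real CARD('n)"
  note chr = christoffel_conformal[OF h u]
  \<comment> \<open>The two Kronecker deltas contribute \<open>?n + 1\<close> copies of the
    differential, and the gradient term removes one.\<close>
  have tr: "(\<Sum>i\<in>UNIV. christoffel S ?hh i i m y) = (\<Sum>i\<in>UNIV. christoffel S h i i m y) + ?n * partial m S u y"
    if y: "y \<in> S" for m y
  proof -
    have "(\<Sum>i\<in>UNIV. gradient S h u i y * h y $ i $ m) = partial m S u y"
      using gradient_lower[OF h y, of m u] metric_on_nth_commute(1)[OF h y, of m] by (simp add: mult.commute)
    then show ?thesis by (simp add: chr[OF y] sum.distrib sum_subtractf)
  qed
  have T1: "(\<Sum>i\<in>UNIV. partial i S (christoffel S ?hh i j k) x) =
      (\<Sum>i\<in>UNIV. partial i S (christoffel S h i j k) x) + 2 * partial j S (partial k S u) x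
      - (\<Sum>i\<in>UNIV. partial i S (gradient S h u i) x) * h x $ j $ k - (\<Sum>i\<in>UNIV. ?U i * partial i S (\<lambda>y. h y $ j $ k) x)"
  proof -
    have "partial i S (christoffel S ?hh i j k) x = partial i S (christoffel S h i j k) x +
      ((if i = k then partial i S (partial j S u) x else 0) + (if i = j then partial i S (partial k S u) x else 0)
       - (?U i * partial i S (\<lambda>y. h y $ j $ k) x + partial i S (gradient S h u i) x * h x $ j $ k))" for i
    proof -
      have i1: "smooth_on S (\<lambda>x. if i = k then partial j S u x else 0)" "smooth_on S (\<lambda>x. if i = j then partial k S u x else 0)"
        by (cases "i = k"; cases "i = j"; auto intro: su smooth_on_const[OF S])+
      have i2: "smooth_on S (\<lambda>x. gradient S h u i x * h x $ j $ k)"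
        by (intro smooth_on_mult smooth_on_nth S sU sh)
      have "partial i S (christoffel S ?hh i j k) x = partial i S (\<lambda>x. christoffel S h i j k x +
        ((if i = k then partial j S u x else 0) + (if i = j then partial k S u x else 0) - gradient S h u i x * h x $ j $ k)) x"
        by (rule partial_cong[OF chr x])
      also have "\<dots> = partial i S (christoffel S h i j k) x + (partial i S (\<lambda>x. if i = k then partial j S u x else 0) x
        + partial i S (\<lambda>x. if i = j then partial k S u x else 0) x - partial i S (\<lambda>x. gradient S h u i x * h x $ j $ k) x)"
        using i1 i2 sG by (simp add: smooth_partial_add[OF S x _ x _ x] smooth_partial_diff[OF S x] smooth_on_add[OF S] smooth_on_diff[OF S])
      also have "partial i S (\<lambda>x. if i = k then partial j S u x else 0) x = (if i = k then partial i S (partial j S u) x else 0)"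
        by (simp add: partial_const[OF S x])
      also have "partial i S (\<lambda>x. if i = j then partial k S u x else 0) x = (if i = j then partial i S (partial k S u) x else 0)"
        by (simp add: partial_const[OF S x])
      also have "partial i S (\<lambda>x. gradient S h u i x * h x $ j $ k) x =
        ?U i * partial i S (\<lambda>y. h y $ j $ k) x + partial i S (gradient S h u i) x * h x $ j $ k"
        by (intro smooth_partial_mult[OF S x] smooth_on_nth S sU sh)
      finally show ?thesis .
    qed
    then show ?thesis using partial_commute[OF S x u, of k j]
      by (simp add: sum.distrib sum_subtractf sum_distrib_right)
  qed
  have T2: "(\<Sum>i\<in>UNIV. partial j S (christoffel S ?hh i i k) x) =
      (\<Sum>i\<in>UNIV. partial j S (christoffel S h i i k) x) + ?n * partial j S (partial k S u) x"
  proof -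
    have "(\<Sum>i\<in>UNIV. partial j S (christoffel S ?hh i i k) x) = partial j S (\<lambda>x. \<Sum>i\<in>UNIV. christoffel S ?hh i i k x) x"
      by (rule smooth_partial_sum[OF S x smooth_on_christoffel[OF metric_on_conformal[OF h u]], symmetric])
    also have "\<dots> = partial j S (\<lambda>x. (\<Sum>i\<in>UNIV. christoffel S h i i k x) + ?n * partial k S u x) x"
      by (rule partial_cong[OF tr x])
    also have "\<dots> = partial j S (\<lambda>x. \<Sum>i\<in>UNIV. christoffel S h i i k x) x + partial j S (\<lambda>x. ?n * partial k S u x) x"
      by (intro smooth_partial_add[OF S x _ x _ x] smooth_on_sum smooth_on_mult smooth_on_const S sG su)
    also have "partial j S (\<lambda>x. ?n * partial k S u x) x = ?n * partial j S (partial k S u) x"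
      by (rule partial_bounded_linear[OF S x bounded_linear_mult_right smooth_on_imp_differentiable[OF su x]])
    also have "partial j S (\<lambda>x. \<Sum>i\<in>UNIV. christoffel S h i i k x) x = (\<Sum>i\<in>UNIV. partial j S (christoffel S h i i k) x)"
      by (rule smooth_partial_sum[OF S x sG])
    finally show ?thesis .
  qed
  have T3: "(\<Sum>m\<in>UNIV. (\<Sum>i\<in>UNIV. christoffel S ?hh i i m x) * christoffel S ?hh m j k x) =
      (\<Sum>m\<in>UNIV. (\<Sum>i\<in>UNIV. ?G i i m) * ?G m j k) + (\<Sum>i\<in>UNIV. ?G i i k) * ?d j + (\<Sum>i\<in>UNIV. ?G i i j) * ?d k
      - (\<Sum>m\<in>UNIV. (\<Sum>i\<in>UNIV. ?G i i m) * ?U m) * h x $ j $ k + ?n * (\<Sum>m\<in>UNIV. ?G m j k * ?d m)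
      + 2 * ?n * ?d j * ?d k - ?n * gradient_sq S h u x * h x $ j $ k"
  proof -
    have *: "(\<Sum>m\<in>UNIV. (g m + ?n * ?d m) * (?G m j k + ((if m = k then ?d j else 0) + (if m = j then ?d k else 0) - ?U m * h x $ j $ k)))
      = (\<Sum>m\<in>UNIV. g m * ?G m j k) + g k * ?d j + g j * ?d k - (\<Sum>m\<in>UNIV. g m * ?U m) * h x $ j $ k
      + ?n * (\<Sum>m\<in>UNIV. ?G m j k * ?d m) + 2 * ?n * ?d j * ?d k - ?n * (\<Sum>m\<in>UNIV. ?d m * ?U m) * h x $ j $ k" for g
      by (simp add: distrib_left distrib_right left_diff_distrib right_diff_distrib sum.distrib sum_subtractf
          if_distrib[of "\<lambda>z. _ * z"] cong: if_cong)
        (simp add: sum_distrib_left sum_distrib_right mult_ac)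
    show ?thesis unfolding tr[OF x] unfolding chr[OF x] * gradient_sq_def ..
  qed
  have T4: "(\<Sum>i\<in>UNIV. \<Sum>m\<in>UNIV. christoffel S ?hh i j m x * christoffel S ?hh m i k x) =
    (\<Sum>i\<in>UNIV. \<Sum>m\<in>UNIV. ?G i j m * ?G m i k)
    + 2 * (\<Sum>i\<in>UNIV. ?G i j k * ?d i) + (\<Sum>i\<in>UNIV. ?G i i j) * ?d k + (\<Sum>i\<in>UNIV. ?G i i k) * ?d j
    - (\<Sum>i\<in>UNIV. ?U i * partial i S (\<lambda>y. h y $ j $ k) x)
    + (?n + 2) * ?d j * ?d k - 2 * gradient_sq S h u x * h x $ j $ k"
    unfolding chr[OF x] gradient_sq_def christoffel_metric[OF h x, of _ j k]
    by (rule conformal_quadratic_terms[OF christoffel_sym[OF h x] metric_on_nth_commute(1)[OF h x] gradient_lower[OF h x]])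
  show ?thesis
    unfolding ricci_nth[OF h x] ricci_nth[OF metric_on_conformal[OF h u] x] T1 T2 T3 T4 hessian_def laplacian_def
    by (simp add: algebra_simps)
qed

text \<open>Writing the differential as \<open>h\<close> times the gradient and using compatibility
  shows that the Hessian is the covariant derivative of the gradient with lowered index. Contraction
  with the inverse metric raises it again.\<close>

lemma hessian_trace:
  assumes h: "metric_on S h" and u: "smooth_on S u" and x: "x \<in> S"
  shows "(\<Sum>j\<in>UNIV. \<Sum>k\<in>UNIV. matrix_inv (h x) $ j $ k * hessian S h u j k x) = laplacian S h u x"
proof -
  note S = metric_onD(1)[OF h] and sh = metric_onD(2)[OF h]
  note sU = smooth_on_gradient[OF h u]
  let ?H = "matrix_inv (h x)" and ?U = "\<lambda>l. gradient S h u l x" and ?G = "\<lambda>l i m. christoffel S h l i m x"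
  have hess: "hessian S h u j k x = (\<Sum>l\<in>UNIV. h x $ k $ l * partial j S (gradient S h u l) x)
      + (\<Sum>a\<in>UNIV. h x $ k $ a * (\<Sum>l\<in>UNIV. ?G a j l * ?U l))" for j k
  proof -
    have "partial j S (partial k S u) x = partial j S (\<lambda>y. \<Sum>l\<in>UNIV. h y $ k $ l * gradient S h u l y) x"
      by (rule partial_cong[OF gradient_lower[OF h, symmetric] x])
    also have "\<dots> = (\<Sum>l\<in>UNIV. partial j S (\<lambda>y. h y $ k $ l * gradient S h u l y) x)"
      by (intro smooth_partial_sum[OF S x] smooth_on_mult smooth_on_nth S sh sU)
    also have "\<dots> = (\<Sum>l\<in>UNIV. h x $ k $ l * partial j S (gradient S h u l) x + partial j S (\<lambda>y. h y $ k $ l) x * ?U l)"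
      by (intro sum.cong refl smooth_partial_mult[OF S x] smooth_on_nth S sh sU)
    also have "\<dots> = (\<Sum>l\<in>UNIV. h x $ k $ l * partial j S (gradient S h u l) x)
        + (\<Sum>l\<in>UNIV. (\<Sum>a\<in>UNIV. h x $ k $ a * ?G a j l) * ?U l) + (\<Sum>l\<in>UNIV. (\<Sum>a\<in>UNIV. h x $ l $ a * ?G a j k) * ?U l)"
      by (simp add: sum.distrib christoffel_metric[OF h x] distrib_right)
    also have "(\<Sum>l\<in>UNIV. (\<Sum>a\<in>UNIV. h x $ k $ a * ?G a j l) * ?U l) = (\<Sum>a\<in>UNIV. h x $ k $ a * (\<Sum>l\<in>UNIV. ?G a j l * ?U l))"
      unfolding sum_distrib_left sum_distrib_right by (subst sum.swap) (simp add: mult_ac)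
    also have "(\<Sum>l\<in>UNIV. (\<Sum>a\<in>UNIV. h x $ l $ a * ?G a j k) * ?U l) = (\<Sum>a\<in>UNIV. ?G a j k * (\<Sum>l\<in>UNIV. h x $ a $ l * ?U l))"
      unfolding sum_distrib_left sum_distrib_right
      by (subst sum.swap) (simp add: mult_ac metric_on_nth_commute(1)[OF h x])
    finally show ?thesis unfolding hessian_def gradient_lower[OF h x] by simp
  qed
  have "(\<Sum>j\<in>UNIV. \<Sum>k\<in>UNIV. ?H $ j $ k * hessian S h u j k x) =
    (\<Sum>j\<in>UNIV. (\<Sum>k\<in>UNIV. ?H $ j $ k * (\<Sum>l\<in>UNIV. h x $ k $ l * partial j S (gradient S h u l) x)))
    + (\<Sum>j\<in>UNIV. (\<Sum>k\<in>UNIV. ?H $ j $ k * (\<Sum>a\<in>UNIV. h x $ k $ a * (\<Sum>l\<in>UNIV. ?G a j l * ?U l))))"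
    unfolding hess by (simp add: distrib_left sum.distrib)
  also have "\<dots> = (\<Sum>j\<in>UNIV. partial j S (gradient S h u j) x) + (\<Sum>j\<in>UNIV. \<Sum>l\<in>UNIV. ?G j j l * ?U l)"
    by (simp add: matrix_inverse_sum[OF metric_on_inv(3)[OF h x]])
  also have "(\<Sum>j\<in>UNIV. \<Sum>l\<in>UNIV. ?G j j l * ?U l) = (\<Sum>m\<in>UNIV. (\<Sum>i\<in>UNIV. ?G i i m) * ?U m)"
    by (subst sum.swap) (simp add: sum_distrib_right)
  finally show ?thesis by (simp add: laplacian_def)
qed

lemma matrix_inv_unique:
  fixes A B :: "real^'n::finite^'n"
  assumes "A ** B = mat 1"
  shows "matrix_inv A = B"
proof -
  have "invertible A" using assms invertible_right_inverse by blast
  then have "matrix_inv A ** (A ** B) = B" by (simp add: matrix_mul_assoc matrix_inv_left)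
  then show ?thesis by (simp add: assms)
qed

lemma matrix_inv_scaleR:
  fixes A :: "real^'n::finite^'n"
  assumes "invertible A" "c \<noteq> 0"
  shows "matrix_inv (c *\<^sub>R A) = inverse c *\<^sub>R matrix_inv A"
  by (rule matrix_inv_unique)
    (use assms in \<open>simp add: scalar_matrix_assoc[symmetric] matrix_scalar_ac matrix_inv_right\<close>)

text \<open>The normalisation of the Schouten tensor is the one for which the Laplacian terms of the
  Ricci tensor and of the scalar curvature cancel, so second derivatives enter through the Hessian
  alone.\<close>

lemma schouten_conformal:
  fixes h :: "real^'n::finite \<Rightarrow> real^'n^'n"
  assumes n: "CARD('n) \<ge> 3" and h: "metric_on S h" and u: "smooth_on S u" and x: "x \<in> S"
  shows "schouten S (\<lambda>x. exp (2 * u x) *\<^sub>R h x) x $ j $ k = schouten S h x $ j $ k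
    - hessian S h u j k x + partial j S u x * partial k S u x - (1/2) * gradient_sq S h u x * h x $ j $ k"
proof -
  let ?hh = "\<lambda>x. exp (2 * u x) *\<^sub>R h x" and ?H = "matrix_inv (h x)" and ?d = "\<lambda>i. partial i S u x"
  let ?n = "real CARD('n)" and ?L = "laplacian S h u x" and ?Q = "gradient_sq S h u x" and ?R = "scalar_curvature S h x"
  have n': "?n \<ge> 3" using n by linarith
  have HH: "matrix_inv (?hh x) = exp (- (2 * u x)) *\<^sub>R ?H"
    using matrix_inv_scaleR[OF metric_on_inv(1)[OF h x], of "exp (2 * u x)"] by (simp add: exp_minus)
  have s1: "(\<Sum>j\<in>UNIV. \<Sum>k\<in>UNIV. ?H $ j $ k * (?d j * ?d k)) = ?Q"
    by (simp add: gradient_sq_def gradient_def sum_distrib_left mult_ac)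
  have s2: "(\<Sum>j\<in>UNIV. \<Sum>k\<in>UNIV. ?H $ j $ k * h x $ j $ k) = ?n"
  proof -
    have "(\<Sum>k\<in>UNIV. ?H $ j $ k * h x $ k $ j) = 1" for j
      using metric_on_inv(3)[OF h x] by (simp add: vec_eq_iff matrix_matrix_mult_def mat_def)
    then show ?thesis using metric_on_nth_commute(1)[OF h x] by simp
  qed
  have "scalar_curvature S ?hh x = exp (- (2 * u x)) * (\<Sum>j\<in>UNIV. \<Sum>k\<in>UNIV. ?H $ j $ k * ricci S ?hh x $ j $ k)"
    unfolding scalar_curvature_def HH by (simp add: sum_distrib_left mult_ac)
  also have "(\<Sum>j\<in>UNIV. \<Sum>k\<in>UNIV. ?H $ j $ k * ricci S ?hh x $ j $ k) =
     (\<Sum>j\<in>UNIV. \<Sum>k\<in>UNIV. ?H $ j $ k * ricci S h x $ j $ k)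
     - (?n - 2) * ((\<Sum>j\<in>UNIV. \<Sum>k\<in>UNIV. ?H $ j $ k * hessian S h u j k x) - (\<Sum>j\<in>UNIV. \<Sum>k\<in>UNIV. ?H $ j $ k * (?d j * ?d k)))
     - (?L + (?n - 2) * ?Q) * (\<Sum>j\<in>UNIV. \<Sum>k\<in>UNIV. ?H $ j $ k * h x $ j $ k)"
    unfolding ricci_conformal[OF h u x] sum_distrib_left right_diff_distrib sum_subtractf
    by (simp add: mult_ac)
  also have "\<dots> = ?R - (?n - 2) * (?L - ?Q) - (?L + (?n - 2) * ?Q) * ?n"
    unfolding hessian_trace[OF h u x] s1 s2 scalar_curvature_def ..
  finally have R: "scalar_curvature S ?hh x * exp (2 * u x) = ?R - (?n - 2) * (?L - ?Q) - (?L + (?n - 2) * ?Q) * ?n"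
    by (simp add: exp_minus field_simps)
  have "schouten S ?hh x $ j $ k = 1 / (?n - 2) *
    (ricci S ?hh x $ j $ k - 1 / (2 * (?n - 1)) * (scalar_curvature S ?hh x * exp (2 * u x)) * h x $ j $ k)"
    by (simp add: schouten_def mult_ac)
  also have "\<dots> = 1 / (?n - 2) * (ricci S h x $ j $ k - 1 / (2 * (?n - 1)) * ?R * h x $ j $ k)
    - hessian S h u j k x + ?d j * ?d k - (1/2) * ?Q * h x $ j $ k"
    unfolding R ricci_conformal[OF h u x] using n' by (simp add: divide_simps) (simp add: algebra_simps power2_eq_square)
  finally show ?thesis by (simp add: schouten_def)
qed

subsection \<open>Change of coordinates\<close>

lemma matrix_add_rdistrib: "(A + B) ** C = A ** C + B ** (C :: real^'n::finite^'m::finite)"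
  by (simp add: vec_eq_iff matrix_matrix_mult_def distrib_right sum.distrib)

lemma matrix_diff_ldistrib: "A ** (B - C) = A ** B - A ** (C :: real^'n::finite^'m::finite)"
  by (simp add: vec_eq_iff matrix_matrix_mult_def right_diff_distrib sum_subtractf)

lemma matrix_diff_rdistrib: "(A - B) ** C = A ** C - B ** (C :: real^'n::finite^'m::finite)"
  by (simp add: vec_eq_iff matrix_matrix_mult_def left_diff_distrib sum_subtractf)

lemma transpose_add: "transpose (A + B) = transpose A + transpose (B :: real^'n::finite^'m::finite)"
  by (simp add: vec_eq_iff transpose_def)

lemma bounded_bilinear_matrix_mult:
  "bounded_bilinear ((**) :: real^'n::finite^'m::finite \<Rightarrow> real^'k::finite^'n \<Rightarrow> real^'k^'m)"
  unfolding bilinear_conv_bounded_bilinear[symmetric] bilinear_def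
  by (intro conjI allI linearI)
    (simp_all add: vec_eq_iff matrix_matrix_mult_def distrib_right distrib_left sum.distrib sum_distrib_left mult_ac)

lemma bounded_linear_transpose: "bounded_linear (transpose :: real^'n::finite^'m::finite \<Rightarrow> real^'m^'n)"
  unfolding linear_conv_bounded_linear[symmetric]
  by (intro linearI) (simp_all add: vec_eq_iff transpose_def)

definition jacobian_on :: "(real^'n::finite) set \<Rightarrow> (real^'n \<Rightarrow> real^'m::finite) \<Rightarrow> real^'n \<Rightarrow> real^'n^'m"
  where "jacobian_on S f x = (\<chi> a i. partial i S f x $ a)"

text \<open>The coefficient in direction \<open>i\<close> of the matrix-valued connection form, with
  the upper index as row.\<close>

definition connection_matrix :: "(real^'n::finite) set \<Rightarrow> (real^'n \<Rightarrow> real^'n^'n) \<Rightarrow> 'n \<Rightarrow> real^'n \<Rightarrow> real^'n^'n"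
  where "connection_matrix S h i x = (\<chi> l m. christoffel S h l i m x)"

lemma smooth_on_jacobian:
  "smooth_domain S \<Longrightarrow> smooth_on S f \<Longrightarrow> smooth_on S (jacobian_on S f)"
  by (intro smooth_on_vecI) (simp_all add: jacobian_on_def smooth_on_nth smooth_on_partial)

lemma partial_jacobian_commute:
  assumes "smooth_domain S" "smooth_on S f" "x \<in> S"
  shows "partial i S (jacobian_on S f) x $ a $ j = partial j S (jacobian_on S f) x $ a $ i"
proof -
  have *: "partial i S (jacobian_on S f) x $ a $ j = partial i S (partial j S (\<lambda>y. f y $ a)) x" for i j
  proof -
    have "partial i S (jacobian_on S f) x $ a $ j = partial i S (\<lambda>y. jacobian_on S f y $ a $ j) x"
      using partial_nth2[OF assms(1,3) smooth_on_jacobian[OF assms(1,2)]] by simp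
    also have "\<dots> = partial i S (partial j S (\<lambda>y. f y $ a)) x"
      by (rule partial_cong[OF _ assms(3)]) (simp add: jacobian_on_def partial_nth[OF assms(1) _ assms(2)])
    finally show ?thesis .
  qed
  show ?thesis unfolding * by (intro partial_commute assms smooth_on_nth)
qed

lemma smooth_on_connection_matrix:
  "metric_on S h \<Longrightarrow> smooth_on S (connection_matrix S h i)"
  by (intro smooth_on_vecI metric_onD(1)) (simp_all add: connection_matrix_def smooth_on_christoffel)

lemma partial_metric_matrix:
  assumes "metric_on S h" "x \<in> S"
  shows "partial i S h x = h x ** connection_matrix S h i x + transpose (h x ** connection_matrix S h i x)"
  using christoffel_metric[OF assms] partial_nth2[OF metric_onD(1)[OF assms(1)] assms(2) metric_onD(2)[OF assms(1)]]
  by (simp add: vec_eq_iff transpose_def matrix_matrix_mult_def connection_matrix_def)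

lemma partial_compose_jacobian:
  fixes f :: "real^'m::finite \<Rightarrow> 'b::real_normed_vector" and g :: "real^'n::finite \<Rightarrow> real^'m"
  assumes "smooth_domain S" "x \<in> S" "g ` S \<subseteq> T" "smooth_on S g" "smooth_on T f"
  shows "partial i S (\<lambda>x. f (g x)) x = (\<Sum>a\<in>UNIV. (jacobian_on S g x $ a $ i) *\<^sub>R partial a T f (g x))"
proof -
  have "g x \<in> T" using assms(2,3) by auto
  from partial_compose[OF assms(1-3) smooth_on_imp_differentiable[OF assms(4,2)] smooth_on_imp_differentiable[OF assms(5) this]]
  show ?thesis by (simp add: jacobian_on_def)
qed

lemma sum_rotate:
  "(\<Sum>a\<in>A. \<Sum>b\<in>B. \<Sum>c\<in>C. g a b c) = (\<Sum>b\<in>B. \<Sum>c\<in>C. \<Sum>a\<in>A. g a b c)"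
  by (rule trans[OF sum.swap sum.cong[OF refl sum.swap]])

text \<open>Models the overlap of two charts: \<open>f\<close> is the transition map, and
  \<open>h\<close> and \<open>k\<close> are the components of one metric in the two charts. The
  Jacobian is invertible because \<open>h\<close> is.\<close>

locale isometry_on =
  fixes S T :: "(real^'n::finite) set" and h k :: "real^'n \<Rightarrow> real^'n^'n" and f :: "real^'n \<Rightarrow> real^'n"
  assumes h: "metric_on S h" and k: "metric_on T k"
    and f: "smooth_on S f" and fS: "f ` S \<subseteq> T"
    and pullback: "\<And>x. x \<in> S \<Longrightarrow> h x = transpose (jacobian_on S f x) ** k (f x) ** jacobian_on S f x"
begin

abbreviation "J \<equiv> jacobian_on S f"

text \<open>The pullback of the connection form of \<open>k\<close>, before the gauge transformation
  by the Jacobian.\<close>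

definition pullback_connection :: "'n \<Rightarrow> real^'n \<Rightarrow> real^'n^'n"
  where "pullback_connection i x = (\<Sum>a\<in>UNIV. (J x $ a $ i) *\<^sub>R connection_matrix T k a (f x))"

lemmas S = metric_onD(1)[OF h]

lemma J_smooth: "smooth_on S J"
  by (rule smooth_on_jacobian[OF S f])

lemma J_inv:
  assumes "x \<in> S"
  shows "J x ** matrix_inv (J x) = mat 1" "matrix_inv (J x) ** J x = mat 1"
proof -
  have "det (h x) \<noteq> 0" using metric_on_inv(1)[OF h assms] invertible_det_nz by blast
  then have "det (J x) \<noteq> 0" unfolding pullback[OF assms] by (auto simp: det_mul)
  then show "J x ** matrix_inv (J x) = mat 1" "matrix_inv (J x) ** J x = mat 1"
    using matrix_inv_right matrix_inv_left invertible_det_nz by blast+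
qed

lemma pullback_connection_nth:
  "pullback_connection i x $ b $ c = (\<Sum>a\<in>UNIV. J x $ a $ i * christoffel T k b a c (f x))"
  by (simp add: pullback_connection_def connection_matrix_def)

text \<open>The right side is symmetric because second derivatives of \<open>f\<close> commute, and
  compatible with \<open>h\<close> by differentiating the pullback identity; hence it is the
  Levi-Civita connection of \<open>h\<close>.\<close>

lemma connection_transform:
  assumes x: "x \<in> S"
  shows "connection_matrix S h i x = matrix_inv (J x) ** (partial i S J x + pullback_connection i x ** J x)"
proof -
  have fx: "f x \<in> T" using x fS by auto
  define W where "W i = partial i S J x + pullback_connection i x ** J x" for i
  define C where "C l i m = (matrix_inv (J x) ** W i) $ l $ m" for l i m
  have Wsym: "W i $ b $ m = W m $ b $ i" for i b m
  proof -
    have "(\<Sum>c\<in>UNIV. (\<Sum>a\<in>UNIV. J x $ a $ i * christoffel T k b a c (f x)) * J x $ c $ m) =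
        (\<Sum>c\<in>UNIV. (\<Sum>a\<in>UNIV. J x $ a $ m * christoffel T k b a c (f x)) * J x $ c $ i)"
      unfolding sum_distrib_right by (subst sum.swap) (simp add: mult_ac christoffel_sym[OF k fx, of b])
    then show ?thesis
      using partial_jacobian_commute[OF S f x] by (simp add: W_def matrix_matrix_mult_def pullback_connection_nth)
  qed
  have hW: "h x ** (matrix_inv (J x) ** W i) = transpose (J x) ** k (f x) ** W i" for i
    using J_inv(1)[OF x] by (simp add: pullback[OF x] matrix_mul_assoc[symmetric]) (simp add: matrix_mul_assoc)
  have kf: "partial i S (\<lambda>x. k (f x)) x = k (f x) ** pullback_connection i x + transpose (k (f x) ** pullback_connection i x)" for i
  proof -
    have "partial i S (\<lambda>x. k (f x)) x = (\<Sum>a\<in>UNIV. (J x $ a $ i) *\<^sub>R (k (f x) ** connection_matrix T k a (f x)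
        + transpose (k (f x) ** connection_matrix T k a (f x))))"
      unfolding partial_compose_jacobian[OF S x fS f metric_onD(2)[OF k]] partial_metric_matrix[OF k fx] ..
    also have "\<dots> = k (f x) ** pullback_connection i x + transpose (k (f x) ** pullback_connection i x)"
    proof -
      have "(\<Sum>a\<in>UNIV. (J x $ a $ i) *\<^sub>R (k (f x) ** connection_matrix T k a (f x))) = k (f x) ** pullback_connection i x"
        unfolding vec_eq_iff pullback_connection_def matrix_matrix_mult_def
        by (simp add: sum_distrib_left, subst sum.swap) (simp add: mult_ac)
      moreover have "(\<Sum>a\<in>UNIV. (J x $ a $ i) *\<^sub>R transpose (k (f x) ** connection_matrix T k a (f x))) =
          transpose (\<Sum>a\<in>UNIV. (J x $ a $ i) *\<^sub>R (k (f x) ** connection_matrix T k a (f x)))"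
        by (simp add: vec_eq_iff transpose_def)
      ultimately show ?thesis by (simp add: scaleR_add_right sum.distrib)
    qed
    finally show ?thesis .
  qed
  have compat: "partial i S h x = h x ** (matrix_inv (J x) ** W i) + transpose (h x ** (matrix_inv (J x) ** W i))" for i
  proof -
    have sT: "smooth_on S (\<lambda>x. transpose (J x))" by (rule smooth_on_bounded_linear[OF S bounded_linear_transpose J_smooth])
    have sk: "smooth_on S (\<lambda>x. k (f x))" by (rule smooth_on_compose[OF S fS f metric_onD(2)[OF k]])
    have "partial i S h x = partial i S (\<lambda>x. transpose (J x) ** k (f x) ** J x) x"
      by (rule partial_cong[OF pullback x])
    also have "\<dots> = transpose (J x) ** k (f x) ** partial i S J x + partial i S (\<lambda>x. transpose (J x) ** k (f x)) x ** J x"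
      by (rule smooth_partial_bilinear[OF S x bounded_bilinear_matrix_mult smooth_on_bilinear[OF S bounded_bilinear_matrix_mult sT sk] x J_smooth x])
    also have "partial i S (\<lambda>x. transpose (J x) ** k (f x)) x =
        transpose (J x) ** partial i S (\<lambda>x. k (f x)) x + partial i S (\<lambda>x. transpose (J x)) x ** k (f x)"
      by (rule smooth_partial_bilinear[OF S x bounded_bilinear_matrix_mult sT x sk x])
    also have "partial i S (\<lambda>x. transpose (J x)) x = transpose (partial i S J x)"
      by (rule partial_bounded_linear[OF S x bounded_linear_transpose smooth_on_imp_differentiable[OF J_smooth x]])
    finally show ?thesis
      unfolding hW kf using metric_onD(3)[OF k fx]
      by (simp add: W_def matrix_add_ldistrib matrix_add_rdistrib transpose_add matrix_transpose_mul matrix_mul_assoc)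
  qed
  have "christoffel S h l i m x = C l i m" for l i m
  proof (rule christoffel_unique[OF h x])
    show "C k i j = C k j i" for k i j
      unfolding C_def matrix_matrix_mult_def using Wsym by simp
    show "partial i S (\<lambda>y. h y $ j $ l) x = (\<Sum>k\<in>UNIV. h x $ j $ k * C k i l) + (\<Sum>k\<in>UNIV. h x $ l $ k * C k i j)" for i j l
      unfolding partial_nth2[OF S x metric_onD(2)[OF h]] compat C_def
      by (simp add: matrix_matrix_mult_def transpose_def)
  qed
  then show ?thesis by (simp add: vec_eq_iff connection_matrix_def C_def W_def)
qed

text \<open>Clearing the inverse gives an identity that can be differentiated by the product rule
  alone.\<close>

lemma connection_transform':
  assumes x: "x \<in> S"
  shows "J x ** connection_matrix S h i x = partial i S J x + pullback_connection i x ** J x"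
  unfolding connection_transform[OF x] by (simp add: matrix_mul_assoc J_inv[OF x])

lemma pullback_connection_smooth: "smooth_on S (pullback_connection i)"
  unfolding pullback_connection_def[abs_def]
  by (intro smooth_on_sum smooth_on_scaleR smooth_on_nth J_smooth S smooth_on_compose[OF S fS f] smooth_on_connection_matrix[OF k])

lemma partial_pullback_connection:
  assumes x: "x \<in> S"
  shows "partial j S (pullback_connection i) x $ b $ c =
    (\<Sum>a\<in>UNIV. J x $ a $ i * (\<Sum>d\<in>UNIV. J x $ d $ j * partial d T (christoffel T k b a c) (f x)))
    + (\<Sum>a\<in>UNIV. partial j S J x $ a $ i * christoffel T k b a c (f x))"
proof -
  have sG: "smooth_on S (\<lambda>x. christoffel T k b a c (f x))" for a
    by (rule smooth_on_compose[OF S fS f smooth_on_christoffel[OF k]])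
  have "partial j S (pullback_connection i) x $ b $ c = partial j S (\<lambda>x. \<Sum>a\<in>UNIV. J x $ a $ i * christoffel T k b a c (f x)) x"
    unfolding partial_nth2[OF S x pullback_connection_smooth, symmetric] pullback_connection_nth ..
  also have "\<dots> = (\<Sum>a\<in>UNIV. partial j S (\<lambda>x. J x $ a $ i * christoffel T k b a c (f x)) x)"
    by (intro smooth_partial_sum[OF S x] smooth_on_mult smooth_on_nth J_smooth S sG)
  also have "\<dots> = (\<Sum>a\<in>UNIV. J x $ a $ i * partial j S (\<lambda>x. christoffel T k b a c (f x)) x
      + partial j S (\<lambda>x. J x $ a $ i) x * christoffel T k b a c (f x))"
    by (intro sum.cong refl smooth_partial_mult[OF S x] smooth_on_nth J_smooth S sG)
  finally show ?thesis
    by (simp add: sum.distrib partial_nth2[OF S x J_smooth] partial_compose_jacobian[OF S x fS f smooth_on_christoffel[OF k]])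
qed

text \<open>The curvature is that of the matrix-valued connection form, on which a change of coordinates
  acts as a pullback followed by a gauge transformation by the Jacobian.\<close>

lemma curvature_transform:
  assumes x: "x \<in> S"
  shows "(J x ** (\<chi> l m. riemann S h l m i j x)) =
    (\<chi> b c. \<Sum>d\<in>UNIV. J x $ d $ i * (\<Sum>a\<in>UNIV. J x $ a $ j * riemann T k b c d a (f x))) ** J x"
proof -
  let ?\<Gamma> = "\<lambda>i. connection_matrix S h i x" and ?G = "\<lambda>i. pullback_connection i x"
  let ?D\<Gamma> = "\<lambda>i j. partial i S (connection_matrix S h j) x" and ?DG = "\<lambda>i j. partial i S (pullback_connection j) x"
  let ?DJ = "\<lambda>i. partial i S J x"
  note sC = smooth_on_connection_matrix[OF h] and sP = pullback_connection_smooth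
  have R: "(\<chi> l m. riemann S h l m i j x) = ?D\<Gamma> i j - ?D\<Gamma> j i + (?\<Gamma> i ** ?\<Gamma> j - ?\<Gamma> j ** ?\<Gamma> i)"
    by (simp add: vec_eq_iff riemann_def matrix_matrix_mult_def partial_nth2[OF S x sC, symmetric] sum_subtractf)
      (simp add: connection_matrix_def)
  have D: "J x ** ?D\<Gamma> i j + ?DJ i ** ?\<Gamma> j = partial i S (partial j S J) x + (?G j ** ?DJ i + ?DG i j ** J x)" for i j
  proof -
    have "J x ** ?D\<Gamma> i j + ?DJ i ** ?\<Gamma> j = partial i S (\<lambda>x. J x ** connection_matrix S h j x) x"
      by (rule smooth_partial_bilinear[OF S x bounded_bilinear_matrix_mult J_smooth x sC x, symmetric])
    also have "\<dots> = partial i S (\<lambda>x. partial j S J x + pullback_connection j x ** J x) x"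
      by (rule partial_cong[OF connection_transform' x])
    also have "\<dots> = partial i S (partial j S J) x + partial i S (\<lambda>x. pullback_connection j x ** J x) x"
      by (rule smooth_partial_add[OF S x smooth_on_partial[OF J_smooth] x
            smooth_on_bilinear[OF S bounded_bilinear_matrix_mult sP J_smooth] x])
    also have "partial i S (\<lambda>x. pullback_connection j x ** J x) x = ?G j ** ?DJ i + ?DG i j ** J x"
      by (rule smooth_partial_bilinear[OF S x bounded_bilinear_matrix_mult sP x J_smooth x])
    finally show ?thesis .
  qed
  have DD: "partial i S (partial j S J) x = partial j S (partial i S J) x"
  proof -
    have "partial i S (partial j S J) x $ a $ b = partial i S (partial j S (\<lambda>y. J y $ a $ b)) x" for i j a b
      unfolding partial_nth2[OF S x smooth_on_partial[OF J_smooth], symmetric]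
      by (rule partial_cong[OF _ x]) (simp add: partial_nth2[OF S _ J_smooth])
    then show ?thesis
      using partial_commute[OF S x smooth_on_nth[OF S smooth_on_nth[OF S J_smooth]]] by (simp add: vec_eq_iff)
  qed
  \<comment> \<open>Products of a derivative of \<open>J\<close> with a connection matrix are added
    and subtracted so that \<open>D\<close> applies. The second derivatives of \<open>J\<close> then
    cancel by \<open>DD\<close>.\<close>
  have "J x ** (\<chi> l m. riemann S h l m i j x) = (J x ** ?D\<Gamma> i j + ?DJ i ** ?\<Gamma> j) - (J x ** ?D\<Gamma> j i + ?DJ j ** ?\<Gamma> i)
      + ((J x ** ?\<Gamma> i) ** ?\<Gamma> j - ?DJ i ** ?\<Gamma> j) - ((J x ** ?\<Gamma> j) ** ?\<Gamma> i - ?DJ j ** ?\<Gamma> i)"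
    by (simp add: R matrix_add_ldistrib matrix_diff_ldistrib matrix_mul_assoc)
  also have "\<dots> = ?DG i j ** J x - ?DG j i ** J x + (?G j ** ?DJ i - ?G i ** ?DJ j) + (?G i ** (J x ** ?\<Gamma> j) - ?G j ** (J x ** ?\<Gamma> i))"
    unfolding D DD connection_transform'[OF x, of i] connection_transform'[OF x, of j] 
    by (simp add: matrix_add_rdistrib matrix_mul_assoc[symmetric] connection_transform'[OF x])
  also have "\<dots> = (?DG i j - ?DG j i + (?G i ** ?G j - ?G j ** ?G i)) ** J x"
    unfolding connection_transform'[OF x]
    by (simp add: matrix_add_ldistrib matrix_add_rdistrib matrix_diff_rdistrib matrix_mul_assoc)
  \<comment> \<open>What is left is the curvature of the pulled back form. The derivatives of the
    Jacobian cancel in the antisymmetrisation by \<open>2\<close>.\<close>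
  also have "?DG i j - ?DG j i + (?G i ** ?G j - ?G j ** ?G i) =
    (\<chi> b c. \<Sum>d\<in>UNIV. J x $ d $ i * (\<Sum>a\<in>UNIV. J x $ a $ j * riemann T k b c d a (f x)))"
  proof (simp add: vec_eq_iff, intro allI)
    fix b c
    let ?C = "\<lambda>b a c. christoffel T k b a c (f x)" and ?P = "\<lambda>d b a c. partial d T (christoffel T k b a c) (f x)"
    have 1: "(\<Sum>a\<in>UNIV. J x $ a $ j * (\<Sum>d\<in>UNIV. J x $ d $ i * ?P d b a c)) =
       (\<Sum>d\<in>UNIV. J x $ d $ i * (\<Sum>a\<in>UNIV. J x $ a $ j * ?P d b a c))"
      unfolding sum_distrib_left by (subst sum.swap) (simp add: mult_ac)
    have 2: "(\<Sum>a\<in>UNIV. partial i S J x $ a $ j * ?C b a c) = (\<Sum>a\<in>UNIV. partial j S J x $ a $ i * ?C b a c)"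
      using partial_jacobian_commute[OF S f x] by simp
    have 3: "(pullback_connection i x ** pullback_connection j x) $ b $ c =
       (\<Sum>d\<in>UNIV. J x $ d $ i * (\<Sum>a\<in>UNIV. J x $ a $ j * (\<Sum>e\<in>UNIV. ?C b d e * ?C e a c)))"
    proof -
      have "(pullback_connection i x ** pullback_connection j x) $ b $ c =
        (\<Sum>e\<in>UNIV. \<Sum>d\<in>UNIV. \<Sum>a\<in>UNIV. J x $ d $ i * (J x $ a $ j * (?C b d e * ?C e a c)))"
        by (simp add: matrix_matrix_mult_def pullback_connection_nth sum_product mult_ac)
      also have "\<dots> = (\<Sum>d\<in>UNIV. \<Sum>a\<in>UNIV. \<Sum>e\<in>UNIV. J x $ d $ i * (J x $ a $ j * (?C b d e * ?C e a c)))"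
        by (rule sum_rotate)
      finally show ?thesis by (simp add: sum_distrib_left)
    qed
    have 4: "(pullback_connection j x ** pullback_connection i x) $ b $ c =
       (\<Sum>d\<in>UNIV. J x $ d $ i * (\<Sum>a\<in>UNIV. J x $ a $ j * (\<Sum>e\<in>UNIV. ?C b a e * ?C e d c)))"
    proof -
      have "(pullback_connection j x ** pullback_connection i x) $ b $ c =
        (\<Sum>e\<in>UNIV. \<Sum>a\<in>UNIV. \<Sum>d\<in>UNIV. J x $ d $ i * (J x $ a $ j * (?C b a e * ?C e d c)))"
        by (simp add: matrix_matrix_mult_def pullback_connection_nth sum_product mult_ac)
      also have "\<dots> = (\<Sum>e\<in>UNIV. \<Sum>d\<in>UNIV. \<Sum>a\<in>UNIV. J x $ d $ i * (J x $ a $ j * (?C b a e * ?C e d c)))"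
        by (rule sum.cong[OF refl sum.swap])
      also have "\<dots> = (\<Sum>d\<in>UNIV. \<Sum>a\<in>UNIV. \<Sum>e\<in>UNIV. J x $ d $ i * (J x $ a $ j * (?C b a e * ?C e d c)))"
        by (rule sum_rotate)
      finally show ?thesis by (simp add: sum_distrib_left)
    qed
    show "partial i S (pullback_connection j) x $ b $ c - partial j S (pullback_connection i) x $ b $ c +
       ((pullback_connection i x ** pullback_connection j x) $ b $ c - (pullback_connection j x ** pullback_connection i x) $ b $ c) =
       (\<Sum>d\<in>UNIV. J x $ d $ i * (\<Sum>a\<in>UNIV. J x $ a $ j * riemann T k b c d a (f x)))"
      unfolding partial_pullback_connection[OF x] 1 2 3 4 riemann_def
      by (simp add: distrib_left right_diff_distrib sum.distrib sum_subtractf)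
  qed
  finally show ?thesis .
qed

text \<open>After multiplication by the inverse Jacobian the curvature is contracted over its upper
  and a form index; there the Jacobian meets its inverse and both disappear.\<close>

lemma ricci_transform:
  assumes x: "x \<in> S"
  shows "ricci S h x = transpose (J x) ** ricci T k (f x) ** J x"
proof -
  have "ricci S h x $ j $ m = (transpose (J x) ** ricci T k (f x) ** J x) $ j $ m" for j m
  proof -
    define N where "N d = (\<chi> b c. \<Sum>a\<in>UNIV. J x $ a $ j * riemann T k b c d a (f x)) ** J x" for d
    have "(\<chi> l m. riemann S h l m i j x) = (\<Sum>d\<in>UNIV. (J x $ d $ i) *\<^sub>R (matrix_inv (J x) ** N d))" for i
    proof -
      have "matrix_inv (J x) ** (J x ** (\<chi> l m. riemann S h l m i j x)) =
         matrix_inv (J x) ** ((\<chi> b c. \<Sum>d\<in>UNIV. J x $ d $ i * (\<Sum>a\<in>UNIV. J x $ a $ j * riemann T k b c d a (f x))) ** J x)"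
        unfolding curvature_transform[OF x] ..
      also have "(\<chi> b c. \<Sum>d\<in>UNIV. J x $ d $ i * (\<Sum>a\<in>UNIV. J x $ a $ j * riemann T k b c d a (f x))) ** J x =
         (\<Sum>d\<in>UNIV. (J x $ d $ i) *\<^sub>R N d)"
        unfolding vec_eq_iff N_def matrix_matrix_mult_def
        by (simp add: sum_distrib_right sum_distrib_left, subst sum.swap) (simp add: mult_ac)
      also have "matrix_inv (J x) ** (\<Sum>d\<in>UNIV. (J x $ d $ i) *\<^sub>R N d) = (\<Sum>d\<in>UNIV. (J x $ d $ i) *\<^sub>R (matrix_inv (J x) ** N d))"
        unfolding vec_eq_iff matrix_matrix_mult_def
        by (simp add: sum_distrib_left, subst sum.swap) (simp add: mult_ac)
      finally show ?thesis by (simp add: matrix_mul_assoc J_inv[OF x])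
    qed
    then have "riemann S h i m i j x = (\<Sum>d\<in>UNIV. J x $ d $ i * (matrix_inv (J x) ** N d) $ i $ m)" for i
      by (simp add: vec_eq_iff)
    then have "ricci S h x $ j $ m = (\<Sum>d\<in>UNIV. \<Sum>i\<in>UNIV. J x $ d $ i * (matrix_inv (J x) ** N d) $ i $ m)"
      by (simp add: ricci_def) (rule sum.swap)
    also have "\<dots> = (\<Sum>d\<in>UNIV. (J x ** (matrix_inv (J x) ** N d)) $ d $ m)"
    proof -
      have "(A ** B) $ d $ m = (\<Sum>i\<in>UNIV. A $ d $ i * B $ i $ m)" for A B :: "real^'n^'n" and d
        by (simp add: matrix_matrix_mult_def)
      from this[of "J x"] show ?thesis by simp
    qed
    also have "\<dots> = (\<Sum>d\<in>UNIV. N d $ d $ m)"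
      by (simp add: matrix_mul_assoc J_inv[OF x])
    also have "\<dots> = (\<Sum>d\<in>UNIV. \<Sum>c\<in>UNIV. \<Sum>a\<in>UNIV. J x $ a $ j * riemann T k d c d a (f x) * J x $ c $ m)"
      by (simp add: N_def matrix_matrix_mult_def sum_distrib_right)
    also have "\<dots> = (\<Sum>c\<in>UNIV. \<Sum>a\<in>UNIV. \<Sum>d\<in>UNIV. J x $ a $ j * riemann T k d c d a (f x) * J x $ c $ m)"
      by (rule sum_rotate)
    also have "\<dots> = (transpose (J x) ** ricci T k (f x) ** J x) $ j $ m"
      by (simp add: matrix_matrix_mult_def transpose_def ricci_def sum_distrib_right sum_distrib_left)
    finally show ?thesis .
  qed
  then show ?thesis by (simp add: vec_eq_iff)
qed

lemma scalar_curvature_trace: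
  "metric_on U g \<Longrightarrow> y \<in> U \<Longrightarrow> scalar_curvature U g y = trace (matrix_inv (g y) ** ricci U g y)"
  unfolding scalar_curvature_def trace_def matrix_matrix_mult_def by (simp add: ricci_sym)

text \<open>The product of the inverse metric with the Ricci matrix is conjugated by the Jacobian,
  which preserves its trace.\<close>

lemma scalar_curvature_transform:
  assumes x: "x \<in> S"
  shows "scalar_curvature S h x = scalar_curvature T k (f x)"
proof -
  have fx: "f x \<in> T" using x fS by auto
  let ?K = "matrix_inv (J x)" and ?k = "matrix_inv (k (f x))"
  have t: "transpose ?K ** transpose (J x) = mat 1" "transpose (J x) ** transpose ?K = mat 1"
    using J_inv[OF x] by (simp_all add: matrix_transpose_mul[symmetric])
  have "h x ** (?K ** ?k ** transpose ?K) = transpose (J x) ** (k (f x) ** ((J x ** ?K) ** ?k)) ** transpose ?K"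
    unfolding pullback[OF x] by (simp only: matrix_mul_assoc)
  also have "\<dots> = mat 1" using J_inv(1)[OF x] metric_on_inv(2)[OF k fx] t by simp
  finally have hi: "matrix_inv (h x) = ?K ** ?k ** transpose ?K" by (rule matrix_inv_unique)
  have "matrix_inv (h x) ** ricci S h x = ?K ** ?k ** (transpose ?K ** transpose (J x)) ** ricci T k (f x) ** J x"
    unfolding hi ricci_transform[OF x] by (simp only: matrix_mul_assoc)
  also have "\<dots> = ?K ** (?k ** ricci T k (f x) ** J x)" unfolding t by (simp add: matrix_mul_assoc)
  finally have *: "matrix_inv (h x) ** ricci S h x = ?K ** (?k ** ricci T k (f x) ** J x)" .
  have "trace (matrix_inv (h x) ** ricci S h x) = trace ((?k ** ricci T k (f x) ** J x) ** ?K)"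
    unfolding * by (rule trace_mul_sym)
  also have "(?k ** ricci T k (f x) ** J x) ** ?K = ?k ** ricci T k (f x)"
    using J_inv(1)[OF x] by (simp add: matrix_mul_assoc[symmetric])
  finally show ?thesis by (simp add: scalar_curvature_trace[OF h x] scalar_curvature_trace[OF k fx])
qed

lemma schouten_transform:
  assumes x: "x \<in> S"
  shows "schouten S h x = transpose (J x) ** schouten T k (f x) ** J x"
proof -
  have "A ** (c *\<^sub>R B) = c *\<^sub>R (A ** B)" "(c *\<^sub>R A) ** B = c *\<^sub>R (A ** B)" for A B :: "real^'n^'n" and c
    by (simp_all add: vec_eq_iff matrix_matrix_mult_def sum_distrib_left mult_ac)
  then show ?thesis
    unfolding schouten_def scalar_curvature_transform[OF x] ricci_transform[OF x] pullback[OF x]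
    by (simp only: matrix_diff_ldistrib matrix_diff_rdistrib)
qed

end

lemma christoffel_subset:
  assumes "metric_on S h" "smooth_domain T" "T \<subseteq> S" "x \<in> T"
  shows "christoffel T h k i j x = christoffel S h k i j x"
proof -
  note S = metric_onD(1)[OF assms(1)] and h = metric_onD(2)[OF assms(1)]
  have "partial i T (\<lambda>y. h y $ j $ l) x = partial i S (\<lambda>y. h y $ j $ l) x" for i j l
    using assms by (intro partial_subset[OF S assms(2-4)] smooth_on_imp_differentiable smooth_on_nth S h) auto
  then show ?thesis by (simp add: christoffel_def)
qed

text \<open>\<open>schouten_tensor\<close> is computed on the full image of a chart, while two
  charts can be compared only on their overlap.\<close>

lemma schouten_subset:
  assumes "metric_on S h" "smooth_domain T" "T \<subseteq> S" "x \<in> T"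
  shows "schouten T h x = schouten S h x"
proof -
  have x: "x \<in> S" using assms(3,4) by auto
  have "partial a T (christoffel T h k i j) x = partial a S (christoffel S h k i j) x" for a k i j
  proof -
    have "partial a T (christoffel T h k i j) x = partial a T (christoffel S h k i j) x"
      by (rule partial_cong[OF christoffel_subset[OF assms(1-3)] assms(4)])
    also have "\<dots> = partial a S (christoffel S h k i j) x"
      by (rule partial_subset[OF metric_onD(1)[OF assms(1)] assms(2-4) smooth_on_imp_differentiable[OF smooth_on_christoffel[OF assms(1)] x]])
    finally show ?thesis .
  qed
  then have "riemann T h l k i j x = riemann S h l k i j x" for l k i j
    by (simp add: riemann_def christoffel_subset[OF assms])
  then show ?thesis by (simp add: schouten_def ricci_def scalar_curvature_def)
qed

section \<open>Generic functions\<close>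

text \<open>
  The library proves Sard's theorem for index types that are well-ordered; this copy of a finite
  type carries such an order.
\<close>

typedef 'n ordered_index = "UNIV :: 'n set"
  morphisms index_of index_mk by simp

definition index_code :: "'n::finite \<Rightarrow> nat"
  where "index_code = (SOME f. inj f)"

lemma inj_index_code: "inj (index_code :: 'n::finite \<Rightarrow> nat)"
proof -
  have "\<exists>f :: 'n \<Rightarrow> nat. inj f" using finite_imp_inj_to_nat_seg[of "UNIV :: 'n set"] by blast
  then show ?thesis unfolding index_code_def by (rule someI_ex)
qed

instance ordered_index :: (finite) finite
proof
  have "UNIV = index_mk ` (UNIV :: 'a set)" using index_of_inverse by (metis UNIV_I surj_def)
  then show "finite (UNIV :: 'a ordered_index set)" by (metis finite finite_imageI)
qed

instantiation ordered_index :: (finite) wellorder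
begin

definition less_eq_ordered_index :: "'a ordered_index \<Rightarrow> 'a ordered_index \<Rightarrow> bool"
  where "less_eq_ordered_index x y \<longleftrightarrow> index_code (index_of x) \<le> index_code (index_of y)"

definition less_ordered_index :: "'a ordered_index \<Rightarrow> 'a ordered_index \<Rightarrow> bool"
  where "less_ordered_index x y \<longleftrightarrow> index_code (index_of x) < index_code (index_of y)"

instance
proof
  fix x y z :: "'a ordered_index"
  show "x \<le> y \<Longrightarrow> y \<le> x \<Longrightarrow> x = y"
    by (metis inj_index_code injD index_of_inject less_eq_ordered_index_def order_antisym)
next
  fix P :: "'a ordered_index \<Rightarrow> bool" and a
  assume step: "\<And>x. (\<And>y. y < x \<Longrightarrow> P y) \<Longrightarrow> P x"
  show "P a"
  proof (induction "index_code (index_of a)" arbitrary: a rule: less_induct)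
    case less
    then show ?case using step by (simp add: less_ordered_index_def)
  qed
qed (auto simp: less_eq_ordered_index_def less_ordered_index_def)

end

lemma index_of_mk [simp]: "index_of (index_mk i) = i"
  by (simp add: index_mk_inverse)

lemma card_ordered_index: "CARD('n ordered_index) = CARD('n::finite)"
  by (rule bij_betw_same_card[of index_of], rule bij_betwI[of _ _ _ index_mk]) (auto simp: index_of_inverse)

text \<open>Sard's theorem for maps between spaces of equal dimension. \<open>T\<close> and its
  inverse \<open>U\<close> relabel the coordinates by the ordered index type and back; both preserve
  negligible sets.\<close>

lemma negligible_singular_image:
  fixes f :: "real^'n::finite \<Rightarrow> real^'n"
  assumes der: "\<And>x. x \<in> S \<Longrightarrow> (f has_derivative f' x) (at x within S)"
    and sing: "\<And>x. x \<in> S \<Longrightarrow> \<exists>v. v \<noteq> 0 \<and> f' x v = 0"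
  shows "negligible (f ` S)"
proof -
  define T :: "real^'n \<Rightarrow> real^'n ordered_index" where "T x = (\<chi> i. x $ index_of i)" for x
  define U :: "real^'n ordered_index \<Rightarrow> real^'n" where "U y = (\<chi> i. y $ index_mk i)" for y
  have TU: "T (U y) = y" "U (T x) = x" for x y
    by (simp_all add: T_def U_def vec_eq_iff index_of_inverse)
  have T: "linear T" and U: "linear U"
    by (auto intro!: linearI simp: T_def U_def vec_eq_iff)
  have bT: "bounded_linear T" and bU: "bounded_linear U"
    using T U by (simp_all add: linear_conv_bounded_linear)
  let ?F = "\<lambda>y. T (f (U y))"
  have "negligible (?F ` (T ` S))"
  proof (rule baby_Sard)
    fix y assume "y \<in> T ` S"
    then have Uy: "U y \<in> S" and sub: "U ` (T ` S) = S" by (auto simp: TU image_image)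
    have "(U has_derivative U) (at y within T ` S)"
      by (rule bounded_linear_imp_has_derivative[OF bU])
    moreover have "(f has_derivative f' (U y)) (at (U y) within U ` (T ` S))"
      using der[OF Uy] sub by simp
    ultimately have "((\<lambda>y. f (U y)) has_derivative (\<lambda>v. f' (U y) (U v))) (at y within T ` S)"
      by (rule has_derivative_in_compose)
    from bounded_linear.has_derivative[OF bT this]
    show der': "(?F has_derivative (\<lambda>v. T (f' (U y) (U v)))) (at y within T ` S)" .
    obtain v where v: "v \<noteq> 0" "f' (U y) v = 0" using sing[OF Uy] by blast
    let ?M = "matrix (\<lambda>v. T (f' (U y) (U v)))"
    have "?M *v (T v) = T (f' (U y) (U (T v)))"
      using matrix_works[of "\<lambda>v. T (f' (U y) (U v))"] has_derivative_linear[OF der']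
      by (simp add: linear_matrix_vector_mul_eq)
    also have "\<dots> = 0" using v TU T by (simp add: linear_0)
    finally have "?M *v (T v) = 0" .
    moreover have "T v \<noteq> 0" using v(1) TU U linear_0 by metis
    ultimately have "\<not> invertible ?M"
      by (metis matrix_left_invertible_ker invertible_left_inverse)
    then show "rank ?M < CARD('n ordered_index)" using det_eq_0_rank invertible_det_nz by blast
  qed simp
  moreover have "?F ` (T ` S) = T ` (f ` S)" by (simp add: image_image TU)
  ultimately have "negligible (T ` (f ` S))" by simp
  then have "negligible (U ` (T ` (f ` S)))"
    by (rule negligible_differentiable_image_negligible[rotated])
      (simp_all add: card_ordered_index linear_imp_differentiable_on[OF U])
  then show ?thesis by (simp add: image_image TU)
qed

section \<open>Nondegenerate critical points in coordinates\<close>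

definition grad_on :: "(real^'n::finite) set \<Rightarrow> (real^'n \<Rightarrow> real) \<Rightarrow> real^'n \<Rightarrow> real^'n"
  where "grad_on S u x = (\<chi> i. partial i S u x)"

definition hess_on :: "(real^'n::finite) set \<Rightarrow> (real^'n \<Rightarrow> real) \<Rightarrow> real^'n \<Rightarrow> real^'n^'n"
  where "hess_on S u x = (\<chi> i j. partial j S (partial i S u) x)"

text \<open>Positive exactly at the points that are not degenerate critical points. As a single
  continuous function it allows compactness arguments.\<close>

definition nondegeneracy :: "(real^'n::finite) set \<Rightarrow> (real^'n \<Rightarrow> real) \<Rightarrow> real^'n \<Rightarrow> real"
  where "nondegeneracy S u x = (norm (grad_on S u x))\<^sup>2 + (det (hess_on S u x))\<^sup>2"

lemma nondegeneracy_pos_iff: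
  "0 < nondegeneracy S u x \<longleftrightarrow> grad_on S u x \<noteq> 0 \<or> det (hess_on S u x) \<noteq> 0"
  by (simp add: nondegeneracy_def sum_power2_gt_zero_iff)

lemma smooth_on_grad_on:
  "smooth_domain S \<Longrightarrow> smooth_on S u \<Longrightarrow> smooth_on S (grad_on S u)"
  by (intro smooth_on_vecI) (simp_all add: grad_on_def smooth_on_partial)

lemma grad_on_has_derivative:
  assumes "smooth_domain S" "smooth_on S u" "x \<in> S"
  shows "(grad_on S u has_derivative (*v) (hess_on S u x)) (at x within S)"
proof -
  have "(\<Sum>i\<in>UNIV. (v $ i) *\<^sub>R partial i S (grad_on S u) x) = hess_on S u x *v v" for v
  proof -
    have "partial i S (grad_on S u) x $ j = partial i S (partial j S u) x" for i j
      using partial_nth[OF assms(1,3) smooth_on_grad_on[OF assms(1,2)], of i j] by (simp add: grad_on_def)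
    then show ?thesis by (simp add: vec_eq_iff hess_on_def matrix_vector_mult_def mult.commute)
  qed
  then show ?thesis
    using has_derivative_partial[OF smooth_on_imp_differentiable[OF smooth_on_grad_on[OF assms(1,2)] assms(3)]] by simp
qed

text \<open>By Sard the values of the gradient map at points with singular Hessian form a null set,
  so they miss some \<open>b\<close> in the ball. A linear function with gradient \<open>- b\<close>
  shifts the gradient and leaves the Hessian unchanged.\<close>

lemma exists_regular_value:
  fixes u :: "real^'n::finite \<Rightarrow> real"
  assumes S: "smooth_domain S" and u: "smooth_on S u" and e: "0 < e"
  obtains a where "norm a < e" "\<And>x. x \<in> S \<Longrightarrow> grad_on S u x + a = 0 \<Longrightarrow> det (hess_on S u x) \<noteq> 0"
proof -
  let ?C = "{x \<in> S. det (hess_on S u x) = 0}"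
  have neg: "negligible (grad_on S u ` ?C)"
  proof (rule negligible_singular_image)
    fix x assume x: "x \<in> ?C"
    show "(grad_on S u has_derivative (*v) (hess_on S u x)) (at x within ?C)"
      by (rule has_derivative_subset[OF grad_on_has_derivative[OF S u]]) (use x in auto)
    have "\<not> invertible (hess_on S u x)" using x invertible_det_nz by blast
    then show "\<exists>v. v \<noteq> 0 \<and> hess_on S u x *v v = 0"
      by (metis matrix_left_invertible_ker invertible_left_inverse)
  qed
  have "\<not> ball 0 e \<subseteq> grad_on S u ` ?C"
  proof
    assume "ball 0 e \<subseteq> grad_on S u ` ?C"
    with neg have "negligible (ball 0 e :: (real^'n) set)"
      by (rule negligible_subset)
    then show False using open_not_negligible[OF open_ball] e by (metis ball_eq_empty not_less)
  qed
  then obtain b where "b \<in> ball 0 e" and b2: "b \<notin> grad_on S u ` ?C" by blast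
  then have b: "norm b < e" by simp
  show thesis
  proof (rule that[of "- b"])
    show "norm (- b) < e" using b by simp
    show "det (hess_on S u x) \<noteq> 0" if "x \<in> S" "grad_on S u x + - b = 0" for x
      using b2 that by force
  qed
qed

text \<open>The Hessian is injective, hence bounded below by some \<open>B\<close>; near
  \<open>x\<close> the error of linearising the gradient is at most half of that.\<close>

lemma nondegenerate_critical_isolated:
  fixes u :: "real^'n::finite \<Rightarrow> real"
  assumes S: "smooth_domain S" and u: "smooth_on S u" and x: "x \<in> S"
    and crit: "grad_on S u x = 0" and nd: "0 < nondegeneracy S u x"
  obtains d where "0 < d" "\<And>y. y \<in> S \<Longrightarrow> dist y x < d \<Longrightarrow> y \<noteq> x \<Longrightarrow> grad_on S u y \<noteq> 0"
proof -
  let ?L = "(*v) (hess_on S u x)"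
  have "det (hess_on S u x) \<noteq> 0" using nd crit by (simp add: nondegeneracy_pos_iff)
  then have "inj ?L" using invertible_det_nz invertible_left_inverse matrix_left_invertible_injective by blast
  then obtain B where B: "B > 0" "\<And>v. B * norm v \<le> norm (?L v)"
    using linear_inj_bounded_below_pos[of ?L] by auto
  have "B / 2 > 0" using B by simp
  then obtain d where d: "d > 0" "\<And>y. y \<in> S \<Longrightarrow> norm (y - x) < d \<Longrightarrow>
      norm (grad_on S u y - grad_on S u x - ?L (y - x)) \<le> B / 2 * norm (y - x)"
    using grad_on_has_derivative[OF S u x] unfolding has_derivative_within_alt by metis
  show thesis
  proof (rule that[OF d(1)])
    fix y assume y: "y \<in> S" "dist y x < d" "y \<noteq> x"
    show "grad_on S u y \<noteq> 0"
    proof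
      assume "grad_on S u y = 0"
      then have "norm (?L (y - x)) \<le> B / 2 * norm (y - x)"
        using d(2)[OF y(1)] y(2) crit by (simp add: dist_norm)
      then have "B * norm (y - x) \<le> B / 2 * norm (y - x)" using B(2)[of "y - x"] by linarith
      then show False using B(1) y(3) by simp
    qed
  qed
qed

text \<open>The minimum over the slice at 0 is positive, and uniform continuity on the compact set
  \<open>cball 0 1 \<times> K\<close> keeps the change below it.\<close>

lemma continuous_positive_near_compact:
  fixes F :: "'a::euclidean_space \<times> 'b::metric_space \<Rightarrow> real"
  assumes F: "continuous_on (UNIV \<times> K) F" and K: "compact K" and pos: "\<And>x. x \<in> K \<Longrightarrow> 0 < F (0, x)"
  obtains e where "0 < e" "\<And>a x. norm a < e \<Longrightarrow> x \<in> K \<Longrightarrow> 0 < F (a, x)"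
proof (cases "K = {}")
  case True
  then show ?thesis using that[of 1] by auto
next
  case False
  have "continuous_on K (\<lambda>x. F (0, x))"
    by (rule continuous_on_compose2[OF F]) (auto intro!: continuous_intros)
  from continuous_attains_inf[OF K False this]
  obtain y where y: "y \<in> K" "\<And>x. x \<in> K \<Longrightarrow> F (0, y) \<le> F (0, x)" by blast
  have "uniformly_continuous_on (cball 0 1 \<times> K) F"
    by (intro compact_uniformly_continuous continuous_on_subset[OF F] compact_Times K) auto
  then obtain d where d: "d > 0" "\<And>p q. p \<in> cball 0 1 \<times> K \<Longrightarrow> q \<in> cball 0 1 \<times> K \<Longrightarrow> dist q p < d \<Longrightarrow> dist (F q) (F p) < F (0, y)"
    unfolding uniformly_continuous_on_def using pos[OF y(1)] by metis
  show ?thesis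
  proof (rule that[of "min d 1"])
    show "0 < min d 1" using d by simp
    fix a :: 'a and x assume a: "norm a < min d 1" and x: "x \<in> K"
    have "dist (F (a, x)) (F (0, x)) < F (0, y)"
      using d(2)[of "(0, x)" "(a, x)"] a x by (simp add: dist_Pair_Pair)
    then show "0 < F (a, x)" using y(2)[OF x] by (auto simp: dist_real_def)
  qed
qed

lemma partial_linear_combination:
  fixes u :: "real^'n::finite \<Rightarrow> real" and w :: "'n \<Rightarrow> real^'n \<Rightarrow> real"
  assumes S: "smooth_domain S" "x \<in> S" and u: "smooth_on S u" and w: "\<And>l. smooth_on S (w l)"
  shows "partial i S (\<lambda>x. u x + (\<Sum>l\<in>UNIV. a $ l * w l x)) x = partial i S u x + (\<Sum>l\<in>UNIV. a $ l * partial i S (w l) x)"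
proof -
  have 1: "smooth_on S (\<lambda>x. a $ l * w l x)" for l by (intro smooth_on_mult smooth_on_const S w)
  have "partial i S (\<lambda>x. u x + (\<Sum>l\<in>UNIV. a $ l * w l x)) x = partial i S u x + partial i S (\<lambda>x. \<Sum>l\<in>UNIV. a $ l * w l x) x"
    by (rule smooth_partial_add[OF S u S(2) smooth_on_sum[OF S(1) 1] S(2)])
  also have "partial i S (\<lambda>x. \<Sum>l\<in>UNIV. a $ l * w l x) x = (\<Sum>l\<in>UNIV. partial i S (\<lambda>x. a $ l * w l x) x)"
    by (rule smooth_partial_sum[OF S 1])
  also have "\<dots> = (\<Sum>l\<in>UNIV. a $ l * partial i S (w l) x)"
    by (intro sum.cong refl partial_bounded_linear[OF S bounded_linear_mult_right] smooth_on_imp_differentiable[OF w S(2)])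
  finally show ?thesis .
qed

lemma grad_on_linear_combination:
  fixes u :: "real^'n::finite \<Rightarrow> real" and w :: "'n \<Rightarrow> real^'n \<Rightarrow> real"
  assumes S: "smooth_domain S" "x \<in> S" and u: "smooth_on S u" and w: "\<And>l. smooth_on S (w l)"
  shows "grad_on S (\<lambda>x. u x + (\<Sum>l\<in>UNIV. a $ l * w l x)) x = (\<chi> i. partial i S u x + (\<Sum>l\<in>UNIV. a $ l * partial i S (w l) x))"
    and "hess_on S (\<lambda>x. u x + (\<Sum>l\<in>UNIV. a $ l * w l x)) x =
      (\<chi> i j. partial j S (partial i S u) x + (\<Sum>l\<in>UNIV. a $ l * partial j S (partial i S (w l)) x))"
proof -
  note * = partial_linear_combination[OF S(1) _ u w]
  show "grad_on S (\<lambda>x. u x + (\<Sum>l\<in>UNIV. a $ l * w l x)) x = (\<chi> i. partial i S u x + (\<Sum>l\<in>UNIV. a $ l * partial i S (w l) x))"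
    by (simp add: grad_on_def *[OF S(2)])
  have "partial j S (partial i S (\<lambda>x. u x + (\<Sum>l\<in>UNIV. a $ l * w l x))) x =
      partial j S (partial i S u) x + (\<Sum>l\<in>UNIV. a $ l * partial j S (partial i S (w l)) x)" for i j
  proof -
    have "partial j S (partial i S (\<lambda>x. u x + (\<Sum>l\<in>UNIV. a $ l * w l x))) x =
      partial j S (\<lambda>x. partial i S u x + (\<Sum>l\<in>UNIV. a $ l * partial i S (w l) x)) x"
      by (rule partial_cong[OF * S(2)])
    also have "\<dots> = partial j S (partial i S u) x + (\<Sum>l\<in>UNIV. a $ l * partial j S (partial i S (w l)) x)"
      by (rule partial_linear_combination[OF S smooth_on_partial[OF u] smooth_on_partial[OF w]])
    finally show ?thesis .
  qed
  then show "hess_on S (\<lambda>x. u x + (\<Sum>l\<in>UNIV. a $ l * w l x)) x =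
      (\<chi> i j. partial j S (partial i S u) x + (\<Sum>l\<in>UNIV. a $ l * partial j S (partial i S (w l)) x))"
    by (simp add: hess_on_def)
qed

lemma nondegeneracy_stable:
  fixes u :: "real^'n::finite \<Rightarrow> real" and w :: "'n \<Rightarrow> real^'n \<Rightarrow> real"
  assumes S: "smooth_domain S" and u: "smooth_on S u" and w: "\<And>l. smooth_on S (w l)"
    and K: "compact K" "K \<subseteq> S" and nd: "\<And>x. x \<in> K \<Longrightarrow> 0 < nondegeneracy S u x"
  obtains e where "0 < e"
    "\<And>a x. norm a < e \<Longrightarrow> x \<in> K \<Longrightarrow> 0 < nondegeneracy S (\<lambda>x. u x + (\<Sum>l\<in>UNIV. a $ l * w l x)) x"
proof -
  \<comment> \<open>The nondegeneracy of the perturbed function, written out so that its joint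
    continuity in the coefficients and the point is apparent.\<close>
  define F where "F = (\<lambda>(a, x). (norm (\<chi> i. partial i S u x + (\<Sum>l\<in>UNIV. a $ l * partial i S (w l) x)))\<^sup>2
    + (det (\<chi> i j. partial j S (partial i S u) x + (\<Sum>l\<in>UNIV. a $ l * partial j S (partial i S (w l)) x)))\<^sup>2)"
  have F: "F (a, x) = nondegeneracy S (\<lambda>x. u x + (\<Sum>l\<in>UNIV. a $ l * w l x)) x" if "x \<in> K" for a x
    using K(2) that by (simp add: F_def nondegeneracy_def grad_on_linear_combination[OF S _ u w] subset_iff)
  have c: "continuous_on (UNIV \<times> K) (\<lambda>p. f (snd p))" if "smooth_on S f" for f :: "real^'n \<Rightarrow> real"
    by (rule continuous_on_compose2[OF smooth_on_imp_continuous_on[OF that] continuous_on_snd[OF continuous_on_id]])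
      (use K(2) in auto)
  have "continuous_on (UNIV \<times> K) F"
    unfolding F_def case_prod_unfold det_def
    by (simp, intro continuous_intros c smooth_on_partial u w)
  from continuous_positive_near_compact[OF this K(1)]
  obtain e where "0 < e" "\<And>a x. norm a < e \<Longrightarrow> x \<in> K \<Longrightarrow> 0 < F (a, x)"
    using F[of _ 0] nd by (auto simp: F)
  then show thesis using that F by metis
qed

section \<open>Smooth functions on a manifold with boundary\<close>

text \<open>A smooth domain is the intersection of an open and a closed set, hence locally compact,
  also at boundary points.\<close>

lemma smooth_domain_compact_ball:
  assumes "smooth_domain S" "x \<in> S"
  obtains R where "0 < R" "\<And>s. s \<le> R \<Longrightarrow> compact (cball x s \<inter> S)"
proof -
  obtain T H where T: "open T" "closed H" "S = T \<inter> H"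
    using assms(1)
  proof (cases rule: smooth_domainE)
    case (1 T)
    then show ?thesis using that[of T UNIV] by simp
  next
    case (2 T k)
    moreover have "closed {x::real^'a. 0 \<le> x $ k}" by (intro closed_Collect_le continuous_intros)
    ultimately show ?thesis using that[of T] by blast
  qed
  have "x \<in> T" using assms(2) T by simp
  then obtain R where R: "0 < R" "cball x R \<subseteq> T" using T(1) open_contains_cball by metis
  have "compact (cball x s \<inter> S)" if "s \<le> R" for s
  proof -
    have "cball x s \<subseteq> T" using R(2) that subset_cball by blast
    then have "cball x s \<inter> S = cball x s \<inter> H" using T(3) by blast
    then show ?thesis using T(2) by (simp add: compact_Int_closed)
  qed
  then show thesis using that R(1) by blast
qed

lemma smooth_on_congI:
  "smooth_on S g \<Longrightarrow> (\<And>x. x \<in> S \<Longrightarrow> f x = g x) \<Longrightarrow> smooth_on S f"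
  using smooth_on_cong by blast

locale smooth_manifold =
  fixes X :: "'a topology" and \<A> :: "('a, 'n::finite) chart set"
  assumes manifold: "smooth_manifold_with_boundary X \<A>"
begin

section \<open>Charts, their inverses and smooth functions\<close>

abbreviation img :: "('a, 'n) chart \<Rightarrow> (real^'n) set"
  where "img c \<equiv> snd c ` fst c"

abbreviation param :: "('a, 'n) chart \<Rightarrow> real^'n \<Rightarrow> 'a"
  where "param c \<equiv> inv_into (fst c) (snd c)"

lemma Hausdorff: "Hausdorff_space X"
  using manifold by (simp add: smooth_manifold_with_boundary_def)

lemma
  assumes "c \<in> \<A>"
  shows chart_open: "openin X (fst c)"
    and chart_domain: "smooth_domain (img c)"
    and chart_homeo: "homeomorphic_map (subtopology X (fst c)) (top_of_set (img c)) (snd c)"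
proof -
  have "is_chart X (fst c, snd c)"
    using assms manifold by (simp add: smooth_manifold_with_boundary_def)
  then show "openin X (fst c)" "smooth_domain (img c)"
    "homeomorphic_map (subtopology X (fst c)) (top_of_set (img c)) (snd c)"
    unfolding is_chart_def smooth_domain_def by (simp_all add: split_beta)
qed

lemma chart_subset: "c \<in> \<A> \<Longrightarrow> fst c \<subseteq> topspace X"
  using chart_open openin_subset by blast

lemma chart_exists: "p \<in> topspace X \<Longrightarrow> \<exists>c\<in>\<A>. p \<in> fst c"
  using manifold unfolding smooth_manifold_with_boundary_def by blast

lemma chart_inj:
  assumes "c \<in> \<A>"
  shows "inj_on (snd c) (fst c)"
proof -
  have "topspace (subtopology X (fst c)) = fst c" using chart_subset[OF assms] by auto
  then show ?thesis using homeomorphic_imp_injective_map[OF chart_homeo[OF assms]] by simp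
qed

lemma param_chart: "c \<in> \<A> \<Longrightarrow> p \<in> fst c \<Longrightarrow> param c (snd c p) = p"
  using chart_inj inv_into_f_f by metis

lemma chart_param: "x \<in> img c \<Longrightarrow> snd c (param c x) = x"
  by (rule f_inv_into_f)

lemma param_in: "x \<in> img c \<Longrightarrow> param c x \<in> fst c"
  by (rule inv_into_into)

lemma chart_image_open:
  assumes "c \<in> \<A>" "openin X W" "W \<subseteq> fst c"
  shows "openin (top_of_set (img c)) (snd c ` W)"
proof -
  have "openin (subtopology X (fst c)) W" using assms(2,3) openin_subtopology by (metis inf.absorb_iff1)
  then show ?thesis using homeomorphic_imp_open_map[OF chart_homeo[OF assms(1)]] open_map_def by blast
qed

lemma param_image_open:
  assumes c: "c \<in> \<A>" and V: "openin (top_of_set (img c)) V"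
  shows "openin X (param c ` V)"
proof -
  have "V \<subseteq> img c" using openin_imp_subset[OF V] .
  have eq: "param c ` V = {p \<in> fst c. snd c p \<in> V}"
  proof (intro set_eqI iffI)
    fix p assume "p \<in> param c ` V"
    then obtain x where x: "x \<in> V" "p = param c x" by blast
    then have "x \<in> img c" using \<open>V \<subseteq> img c\<close> by blast
    then show "p \<in> {p \<in> fst c. snd c p \<in> V}"
      using x chart_param param_in by simp
  next
    fix p assume p: "p \<in> {p \<in> fst c. snd c p \<in> V}"
    then have "p = param c (snd c p)" using param_chart[OF c] by simp
    then show "p \<in> param c ` V" using p by blast
  qed
  have "openin (subtopology X (fst c)) {p \<in> topspace (subtopology X (fst c)). snd c p \<in> V}"
    using homeomorphic_imp_continuous_map[OF chart_homeo[OF c]] V by (rule openin_continuous_map_preimage)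
  moreover have "topspace (subtopology X (fst c)) = fst c" using chart_subset[OF c] by auto
  ultimately show ?thesis using chart_open[OF c] eq by (metis openin_trans_full)
qed

lemma param_continuous:
  assumes c: "c \<in> \<A>"
  shows "continuous_map (top_of_set (img c)) X (param c)"
  unfolding continuous_map_def
proof (intro conjI allI impI)
  show "param c \<in> topspace (top_of_set (img c)) \<rightarrow> topspace X"
    using param_in chart_subset[OF c] by auto
  fix W assume W: "openin X W"
  have "{x \<in> topspace (top_of_set (img c)). param c x \<in> W} = snd c ` (W \<inter> fst c)"
    using param_chart[OF c] chart_param param_in by force
  moreover have "openin (top_of_set (img c)) (snd c ` (W \<inter> fst c))"
    using W chart_open[OF c] by (intro chart_image_open[OF c]) auto
  ultimately show "openin (top_of_set (img c)) {x \<in> topspace (top_of_set (img c)). param c x \<in> W}" by simp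
qed

text \<open>Here the Hausdorff property enters: it makes the complement open, so that objects
  supported in a compact part of a chart can be extended trivially to the manifold.\<close>

lemma param_compact_closed:
  assumes c: "c \<in> \<A>" and K: "compact K" "K \<subseteq> img c"
  shows "closedin X (param c ` K)"
proof -
  have "compactin (top_of_set (img c)) K" using K by (simp add: compactin_subtopology)
  then have "compactin X (param c ` K)" using image_compactin param_continuous[OF c] by blast
  then show ?thesis using compactin_imp_closedin Hausdorff by blast
qed

lemma overlap_domain:
  assumes "c \<in> \<A>" "openin X W" "W \<subseteq> fst c"
  shows "smooth_domain (snd c ` W)"
  using smooth_domain_openin[OF chart_domain chart_image_open] assms by blast

lemma transition_smooth:
  assumes "c \<in> \<A>" "d \<in> \<A>"
  shows "smooth_on (snd c ` (fst c \<inter> fst d)) (\<lambda>x. snd d (param c x))"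
  using assms manifold unfolding smooth_manifold_with_boundary_def transition_def
  by (auto simp: comp_def split: prod.splits)

lemma smooth_functionD:
  "smooth_function \<A> u \<Longrightarrow> c \<in> \<A> \<Longrightarrow> smooth_on (img c) (\<lambda>x. u (param c x))"
  unfolding smooth_function_def by (auto simp: comp_def split: prod.splits)

lemma smooth_functionI:
  "(\<And>c. c \<in> \<A> \<Longrightarrow> smooth_on (img c) (\<lambda>x. u (param c x))) \<Longrightarrow> smooth_function \<A> u"
  unfolding smooth_function_def by (auto simp: comp_def split: prod.splits)

text \<open>One chart near each point suffices, since the transition maps carry smoothness to every
  other chart.\<close>

lemma smooth_functionI_local:
  assumes loc: "\<And>p. p \<in> topspace X \<Longrightarrow> \<exists>c\<in>\<A>. \<exists>W. openin X W \<and> p \<in> W \<and> W \<subseteq> fst c \<and>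
    smooth_on (snd c ` W) (\<lambda>x. u (param c x))"
  shows "smooth_function \<A> u"
proof (rule smooth_functionI, rule smooth_on_local)
  fix d y assume d: "d \<in> \<A>" and y: "y \<in> img d"
  let ?p = "param d y"
  have p: "?p \<in> fst d" using y param_in by blast
  then obtain c W where c: "c \<in> \<A>" and W: "openin X W" "?p \<in> W" "W \<subseteq> fst c"
    and sm: "smooth_on (snd c ` W) (\<lambda>x. u (param c x))"
    using loc chart_subset[OF d] by blast
  let ?V = "snd d ` (W \<inter> fst d)"
  have Wd: "openin X (W \<inter> fst d)" "W \<inter> fst d \<subseteq> fst d" using W chart_open[OF d] by auto
  obtain N where N: "open N" "?V = img d \<inter> N"
    using chart_image_open[OF d Wd] unfolding openin_open by blast
  have domV: "smooth_domain ?V" by (rule overlap_domain[OF d Wd])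
  have "smooth_on ?V (\<lambda>x. snd c (param d x))"
    by (rule smooth_on_subset[OF overlap_domain[OF d _ _] domV _ transition_smooth[OF d c]])
      (use W(3) chart_open[OF c] chart_open[OF d] in auto)
  moreover have "(\<lambda>x. snd c (param d x)) ` ?V \<subseteq> snd c ` W"
    using param_chart[OF d] by auto
  ultimately have "smooth_on ?V (\<lambda>x. u (param c (snd c (param d x))))"
    using smooth_on_compose[OF domV _ _ sm] by blast
  moreover have "u (param d x) = u (param c (snd c (param d x)))" if "x \<in> ?V" for x
    using that param_chart[OF d] param_chart[OF c] W(3) by auto
  ultimately have "smooth_on ?V (\<lambda>x. u (param d x))" by (rule smooth_on_congI)
  moreover have "y \<in> ?V"
    by (rule image_eqI[of _ _ ?p]) (use chart_param[OF y] W(2) p in auto)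
  then have "y \<in> N" using N(2) by simp
  ultimately show "\<exists>N. open N \<and> y \<in> N \<and> smooth_on (img d \<inter> N) (\<lambda>x. u (param d x))"
    using N by metis
qed

lemma smooth_function_const: "smooth_function \<A> (\<lambda>p. k)"
  by (rule smooth_functionI) (rule smooth_on_const[OF chart_domain])

lemma smooth_function_add:
  "smooth_function \<A> u \<Longrightarrow> smooth_function \<A> v \<Longrightarrow> smooth_function \<A> (\<lambda>p. u p + v p)"
  by (rule smooth_functionI) (intro smooth_on_add chart_domain smooth_functionD)

lemma smooth_function_cmult:
  "smooth_function \<A> u \<Longrightarrow> smooth_function \<A> (\<lambda>p. k * u p)"
  by (rule smooth_functionI) (intro smooth_on_mult smooth_on_const chart_domain smooth_functionD)

lemma smooth_function_sum:
  "(\<And>i. i \<in> I \<Longrightarrow> smooth_function \<A> (u i)) \<Longrightarrow> smooth_function \<A> (\<lambda>p. \<Sum>i\<in>I. u i p)"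
  by (rule smooth_functionI) (intro smooth_on_sum chart_domain smooth_functionD)

text \<open>The chart domain and the complement of the image of \<open>K\<close> form an open cover;
  on the second set the function is zero.\<close>

lemma smooth_function_extend:
  assumes c: "c \<in> \<A>" and f: "smooth_on (img c) f" and K: "compact K" "K \<subseteq> img c"
    and zero: "\<And>x. x \<in> img c \<Longrightarrow> x \<notin> K \<Longrightarrow> f x = 0"
  shows "smooth_function \<A> (\<lambda>p. if p \<in> fst c then f (snd c p) else 0)"
proof (rule smooth_functionI_local)
  fix p assume p: "p \<in> topspace X"
  let ?u = "\<lambda>p. if p \<in> fst c then f (snd c p) else 0"
  show "\<exists>c\<in>\<A>. \<exists>W. openin X W \<and> p \<in> W \<and> W \<subseteq> fst c \<and> smooth_on (snd c ` W) (\<lambda>x. ?u (param c x))"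
  proof (cases "p \<in> fst c")
    case True
    have "smooth_on (img c) (\<lambda>x. ?u (param c x))"
      by (rule smooth_on_congI[OF f]) (simp add: param_in chart_param)
    then show ?thesis using c chart_open[OF c] True by blast
  next
    case False
    obtain d where d: "d \<in> \<A>" "p \<in> fst d" using chart_exists[OF p] by blast
    let ?W = "fst d - param c ` K"
    have W: "openin X ?W" by (intro openin_diff chart_open d param_compact_closed c K)
    have u0: "?u q = 0" if "q \<in> ?W" for q
      using that zero[of "snd c q"] param_chart[OF c, of q] by force
    have "smooth_on (snd d ` ?W) (\<lambda>x. ?u (param d x))"
    proof (rule smooth_on_congI[OF smooth_on_const[OF overlap_domain[OF d(1) W], of 0]])
      fix x assume "x \<in> snd d ` ?W"
      then obtain q where q: "q \<in> ?W" "x = snd d q" by blast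
      then have *: "param d x = q" using param_chart[OF d(1)] by simp
      show "?u (param d x) = 0" unfolding * by (rule u0[OF q(1)])
    qed auto
    moreover have "p \<in> ?W" using d(2) False K(2) param_in by blast
    ultimately show ?thesis using d(1) W by blast
  qed
qed

section \<open>Critical points and their independence of the chart\<close>

definition critical :: "('a \<Rightarrow> real) \<Rightarrow> 'a \<Rightarrow> bool"
  where "critical u p \<longleftrightarrow> (\<exists>c\<in>\<A>. p \<in> fst c \<and> grad_on (img c) (\<lambda>x. u (param c x)) (snd c p) = 0)"

lemma grad_on_subset:
  assumes "smooth_domain S" "smooth_domain T" "T \<subseteq> S" "x \<in> T" "smooth_on S u"
  shows "grad_on T u x = grad_on S u x"
  using assms by (auto simp: grad_on_def vec_eq_iff intro!: partial_subset smooth_on_imp_differentiable)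

lemma grad_on_cong:
  "(\<And>y. y \<in> S \<Longrightarrow> u y = v y) \<Longrightarrow> x \<in> S \<Longrightarrow> grad_on S u x = grad_on S v x"
  using partial_cong[of S u v x] by (simp add: grad_on_def vec_eq_iff)

lemma grad_on_compose:
  assumes "smooth_domain S" "x \<in> S" "g ` S \<subseteq> T" "smooth_on S g" "smooth_on T u"
  shows "grad_on S (\<lambda>y. u (g y)) x = transpose (jacobian_on S g x) *v grad_on T u (g x)"
  unfolding vec_eq_iff
  using partial_compose_jacobian[OF assms]
  by (simp add: grad_on_def matrix_vector_mult_def transpose_def del: transpose_matrix_vector)

text \<open>Criticality is defined through some chart; by the chain rule the gradient in
  \<open>d\<close> is the transposed Jacobian of the transition map applied to that in the other
  chart, so its vanishing carries over.\<close>

lemma critical_iff: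
  assumes u: "smooth_function \<A> u" and d: "d \<in> \<A>" "p \<in> fst d"
  shows "critical u p \<longleftrightarrow> grad_on (img d) (\<lambda>x. u (param d x)) (snd d p) = 0"
proof
  assume "critical u p"
  then obtain c where c: "c \<in> \<A>" "p \<in> fst c" and 0: "grad_on (img c) (\<lambda>x. u (param c x)) (snd c p) = 0"
    unfolding critical_def by blast
  let ?V = "snd d ` (fst d \<inter> fst c)"
  have V: "smooth_domain ?V" by (intro overlap_domain openin_Int chart_open c d) auto
  have pV: "snd d p \<in> ?V" using c d by auto
  have "grad_on (img d) (\<lambda>x. u (param d x)) (snd d p) = grad_on ?V (\<lambda>x. u (param d x)) (snd d p)"
    by (rule grad_on_subset[OF chart_domain[OF d(1)] V _ pV smooth_functionD[OF u d(1)], symmetric]) auto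
  also have "\<dots> = grad_on ?V (\<lambda>x. u (param c (snd c (param d x)))) (snd d p)"
    by (rule grad_on_cong[OF _ pV]) (use param_chart[OF d(1)] param_chart[OF c(1)] in auto)
  also have "\<dots> = transpose (jacobian_on ?V (\<lambda>x. snd c (param d x)) (snd d p)) *v
      grad_on (img c) (\<lambda>x. u (param c x)) (snd c (param d (snd d p)))"
    by (rule grad_on_compose[OF V pV _ transition_smooth[OF d(1) c(1)] smooth_functionD[OF u c(1)]])
      (use param_chart[OF d(1)] in auto)
  also have "\<dots> = 0" using 0 param_chart[OF d] by simp
  finally show "grad_on (img d) (\<lambda>x. u (param d x)) (snd d p) = 0" .
next
  assume "grad_on (img d) (\<lambda>x. u (param d x)) (snd d p) = 0"
  then show "critical u p" using d unfolding critical_def by blast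
qed

subsection \<open>Functions with finitely many critical points\<close>

text \<open>The factor 4 leaves room for nested balls: nondegeneracy is arranged on radius
  \<open>r\<close> by a perturbation that is linear on radius \<open>2 * r\<close> and supported in
  radius \<open>4 * r\<close>.\<close>

definition coordinate_ball :: "('a, 'n) chart \<Rightarrow> real^'n \<Rightarrow> real \<Rightarrow> bool"
  where "coordinate_ball c a r \<longleftrightarrow> c \<in> \<A> \<and> a \<in> img c \<and> 0 < r \<and> (\<forall>s\<le>4 * r. compact (cball a s \<inter> img c))"

lemma coordinate_ball_exists:
  assumes "c \<in> \<A>" "p \<in> fst c"
  obtains r where "coordinate_ball c (snd c p) r"
proof -
  obtain R where R: "0 < R" "\<And>s. s \<le> R \<Longrightarrow> compact (cball (snd c p) s \<inter> img c)"
    using smooth_domain_compact_ball[OF chart_domain[OF assms(1)]] assms(2) by blast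
  show thesis by (rule that[of "R/4"]) (use R assms in \<open>simp add: coordinate_ball_def\<close>)
qed

lemma finite_coordinate_cover:
  assumes "compact_space X"
  obtains F where "finite F" "\<And>c a r. (c, a, r) \<in> F \<Longrightarrow> coordinate_ball c a r"
    "\<And>p. p \<in> topspace X \<Longrightarrow> \<exists>(c, a, r)\<in>F. p \<in> fst c \<and> snd c p \<in> cball a r"
proof -
  have "\<exists>c r. p \<in> fst c \<and> coordinate_ball c (snd c p) r" if p: "p \<in> topspace X" for p
  proof -
    obtain c where "c \<in> \<A>" "p \<in> fst c" using chart_exists[OF p] by blast
    then show ?thesis using coordinate_ball_exists by metis
  qed
  then obtain c r where cr: "\<And>p. p \<in> topspace X \<Longrightarrow> p \<in> fst (c p)"
    "\<And>p. p \<in> topspace X \<Longrightarrow> coordinate_ball (c p) (snd (c p) p) (r p)" by metis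
  define B where "B p = param (c p) ` (img (c p) \<inter> ball (snd (c p) p) (r p))" for p
  have B_open: "openin X (B p)" if "p \<in> topspace X" for p
    unfolding B_def using cr(2)[OF that]
    by (intro param_image_open) (auto simp: coordinate_ball_def openin_open)
  have pB: "p \<in> B p" if "p \<in> topspace X" for p
  proof -
    have "snd (c p) p \<in> img (c p) \<inter> ball (snd (c p) p) (r p)"
      using cr[OF that] by (auto simp: coordinate_ball_def)
    then have "param (c p) (snd (c p) p) \<in> B p" unfolding B_def by blast
    then show ?thesis using param_chart cr[OF that] by (simp add: coordinate_ball_def)
  qed
  have "compactin X (topspace X)" using assms by (simp add: compact_space_def)
  then have "\<exists>G. finite G \<and> G \<subseteq> B ` topspace X \<and> topspace X \<subseteq> \<Union>G"
  proof -
    have "topspace X \<subseteq> \<Union>(B ` topspace X)" using pB by blast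
    then show ?thesis
      using compactinD[OF \<open>compactin X (topspace X)\<close>, of "B ` topspace X"] B_open by (metis imageE)
  qed
  then obtain P where P: "finite P" "P \<subseteq> topspace X" "topspace X \<subseteq> \<Union>(B ` P)"
    by (metis finite_subset_image)
  show thesis
  proof (rule that[of "(\<lambda>p. (c p, snd (c p) p, r p)) ` P"])
    show "finite ((\<lambda>p. (c p, snd (c p) p, r p)) ` P)" using P(1) by simp
    show "coordinate_ball c' a r'" if "(c', a, r') \<in> (\<lambda>p. (c p, snd (c p) p, r p)) ` P" for c' a r'
      using that cr(2) P(2) by auto
    fix q assume "q \<in> topspace X"
    then obtain p where p: "p \<in> P" "q \<in> B p" using P(3) by blast
    then obtain x where x: "x \<in> img (c p)" "x \<in> ball (snd (c p) p) (r p)" "q = param (c p) x"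
      unfolding B_def by blast
    then have "q \<in> fst (c p)" "snd (c p) q \<in> cball (snd (c p) p) (r p)"
      using param_in chart_param by auto
    then show "\<exists>(c', a, r')\<in>(\<lambda>p. (c p, snd (c p) p, r p)) ` P. q \<in> fst c' \<and> snd c' q \<in> cball a r'"
      using p(1) by force
  qed
qed

definition nondegenerate_on :: "('a \<Rightarrow> real) \<Rightarrow> ('a, 'n) chart \<Rightarrow> real^'n \<Rightarrow> real \<Rightarrow> bool"
  where "nondegenerate_on u c a r \<longleftrightarrow>
    (\<forall>x\<in>cball a r \<inter> img c. 0 < nondegeneracy (img c) (\<lambda>x. u (param c x)) x)"

lemma nondegeneracy_cong:
  assumes "\<And>y. y \<in> S \<Longrightarrow> u y = v y" "x \<in> S"
  shows "nondegeneracy S u x = nondegeneracy S v x"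
proof -
  have "partial j S (partial i S u) x = partial j S (partial i S v) x" for i j
    by (rule partial_cong[OF partial_cong assms(2)]) (use assms(1) in auto)
  then have "hess_on S u x = hess_on S v x" by (simp add: hess_on_def)
  then show ?thesis using grad_on_cong[OF assms] by (simp add: nondegeneracy_def)
qed

lemma nondegeneracy_Int_open:
  assumes "open N" "x \<in> S" "x \<in> N"
  shows "nondegeneracy (S \<inter> N) u x = nondegeneracy S u x"
proof -
  have "partial j (S \<inter> N) (partial i (S \<inter> N) u) x = partial j S (partial i S u) x" for i j
  proof -
    have "partial j (S \<inter> N) (partial i (S \<inter> N) u) x = partial j (S \<inter> N) (partial i S u) x"
      by (rule partial_cong) (use assms partial_Int_open[OF assms(1)] in auto)
    then show ?thesis using partial_Int_open[OF assms(1,3)] by simp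
  qed
  then show ?thesis
    by (simp add: nondegeneracy_def grad_on_def hess_on_def partial_Int_open[OF assms(1,3)])
qed

lemma partial_coordinate:
  assumes "smooth_domain S" "x \<in> S"
  shows "partial i S (\<lambda>x. x $ l) x = (if i = l then 1 else 0)"
  using partial_eqI[OF assms bounded_linear_imp_has_derivative[OF bounded_linear_vec_nth]]
  by (simp add: axis_def)

lemma nondegeneracy_add_linear:
  assumes S: "smooth_domain S" and u: "smooth_on S u" and x: "x \<in> S"
  shows "nondegeneracy S (\<lambda>x. u x + (\<Sum>l\<in>UNIV. b $ l * x $ l)) x =
    (norm (grad_on S u x + b))\<^sup>2 + (det (hess_on S u x))\<^sup>2"
proof -
  have w: "smooth_on S (\<lambda>x. x $ l)" for l by (intro smooth_on_nth smooth_on_ident S)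
  have p2: "partial j S (partial i S (\<lambda>x. x $ l)) x = 0" for i j l
  proof -
    have "partial j S (partial i S (\<lambda>x. x $ l)) x = partial j S (\<lambda>x. if i = l then 1 else 0) x"
      by (rule partial_cong[OF partial_coordinate[OF S] x])
    then show ?thesis by (simp add: partial_const[OF S x])
  qed
  have "grad_on S (\<lambda>x. u x + (\<Sum>l\<in>UNIV. b $ l * x $ l)) x = grad_on S u x + b"
    unfolding grad_on_linear_combination(1)[OF S x u w]
    by (simp add: vec_eq_iff grad_on_def partial_coordinate[OF S x] if_distrib[of "\<lambda>z. _ * z"] cong: if_cong)
  moreover have "hess_on S (\<lambda>x. u x + (\<Sum>l\<in>UNIV. b $ l * x $ l)) x = hess_on S u x"
    unfolding grad_on_linear_combination(2)[OF S x u w] by (simp add: hess_on_def p2)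
  ultimately show ?thesis by (simp add: nondegeneracy_def)
qed

text \<open>Adding a generic small linear function near one coordinate ball makes the critical points there
  nondegenerate by Sard's theorem, and does not spoil the finitely many balls already treated.\<close>

lemma nondegenerate_step:
  assumes F: "finite F" "\<And>c a r. (c, a, r) \<in> F \<Longrightarrow> coordinate_ball c a r \<and> nondegenerate_on u c a r"
    and u: "smooth_function \<A> u" and ball: "coordinate_ball c a r"
  obtains v where "smooth_function \<A> v" "nondegenerate_on v c a r"
    "\<And>c a r. (c, a, r) \<in> F \<Longrightarrow> nondegenerate_on v c a r"
proof -
  have c: "c \<in> \<A>" and r: "0 < r" and cpt: "compact (cball a (4 * r) \<inter> img c)"
    using ball by (auto simp: coordinate_ball_def)
  define w where "w l = (\<lambda>p. if p \<in> fst c then bump a (2 * r) (snd c p) * snd c p $ l else 0)" for l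
  have w: "smooth_function \<A> (w l)" for l
    unfolding w_def
  proof (rule smooth_function_extend[OF c _ cpt])
    show "smooth_on (img c) (\<lambda>x. bump a (2 * r) x * x $ l)"
      by (intro smooth_on_mult smooth_on_bump smooth_on_nth smooth_on_ident chart_domain[OF c])
    show "bump a (2 * r) x * x $ l = 0" if "x \<in> img c" "x \<notin> cball a (4 * r) \<inter> img c" for x
      using that bump_eq_0[of "2 * r" x a] r by (simp add: dist_commute)
  qed auto
  have "\<exists>e>0. \<forall>b. norm b < e \<longrightarrow> nondegenerate_on (\<lambda>p. u p + (\<Sum>l\<in>UNIV. b $ l * w l p)) c' a' r'"
    if "(c', a', r') \<in> F" for c' a' r'
  proof -
    have c': "c' \<in> \<A>" and cpt': "compact (cball a' r' \<inter> img c')" and nd: "nondegenerate_on u c' a' r'"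
      using F(2)[OF that] by (auto simp: coordinate_ball_def)
    obtain e where "0 < e" "\<And>b x. norm b < e \<Longrightarrow> x \<in> cball a' r' \<inter> img c' \<Longrightarrow>
        0 < nondegeneracy (img c') (\<lambda>x. u (param c' x) + (\<Sum>l\<in>UNIV. b $ l * w l (param c' x))) x"
      by (rule nondegeneracy_stable[where w = "\<lambda>l x. w l (param c' x)", OF chart_domain[OF c'] smooth_functionD[OF u c'] smooth_functionD[OF w c'] cpt'])
        (use nd in \<open>auto simp: nondegenerate_on_def\<close>)
    then show ?thesis by (auto simp: nondegenerate_on_def)
  qed
  then have "\<forall>d\<in>F. \<exists>e>0. \<forall>b. norm b < e \<longrightarrow>
      (case d of (c', a', r') \<Rightarrow> nondegenerate_on (\<lambda>p. u p + (\<Sum>l\<in>UNIV. b $ l * w l p)) c' a' r')"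
    by auto
  from bchoice[OF this] obtain E where "\<forall>d\<in>F. E d > 0 \<and> (\<forall>b. norm b < E d \<longrightarrow>
      (case d of (c', a', r') \<Rightarrow> nondegenerate_on (\<lambda>p. u p + (\<Sum>l\<in>UNIV. b $ l * w l p)) c' a' r'))" ..
  then have E: "\<And>d. d \<in> F \<Longrightarrow> 0 < E d" "\<And>d b. d \<in> F \<Longrightarrow> norm b < E d \<Longrightarrow>
      (case d of (c', a', r') \<Rightarrow> nondegenerate_on (\<lambda>p. u p + (\<Sum>l\<in>UNIV. b $ l * w l p)) c' a' r')"
    by blast+
  \<comment> \<open>Below the tolerances of the finitely many balls already treated; the 1 keeps the
    minimum meaningful when there are none.\<close>
  define e where "e = Min (insert 1 (E ` F))"
  have e: "0 < e" using F(1) E(1) by (simp add: e_def)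
  let ?N = "ball a (2 * r)" and ?u = "\<lambda>x. u (param c x)"
  let ?S = "img c \<inter> ?N"
  have S: "smooth_domain ?S" by (rule smooth_domain_Int[OF chart_domain[OF c]]) simp
  have su: "smooth_on ?S ?u"
    by (rule smooth_on_subset[OF chart_domain[OF c] S _ smooth_functionD[OF u c]]) auto
  obtain b where b: "norm b < e" "\<And>x. x \<in> ?S \<Longrightarrow> grad_on ?S ?u x + b = 0 \<Longrightarrow> det (hess_on ?S ?u x) \<noteq> 0"
    using exists_regular_value[OF S su e] by metis
  define v where "v p = u p + (\<Sum>l\<in>UNIV. b $ l * w l p)" for p
  show thesis
  proof (rule that[of v])
    show "smooth_function \<A> v"
      unfolding v_def[abs_def] by (intro smooth_function_add smooth_function_sum smooth_function_cmult u w)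
    show "nondegenerate_on v c' a' r'" if d: "(c', a', r') \<in> F" for c' a' r'
    proof -
      have "e \<le> E (c', a', r')" unfolding e_def using F(1) d by (intro Min_le) auto
      then show ?thesis using E(2)[OF d, of b] b(1) unfolding v_def[abs_def] by simp
    qed
    show "nondegenerate_on v c a r"
      unfolding nondegenerate_on_def
    proof
      fix x assume "x \<in> cball a r \<inter> img c"
      then have x: "x \<in> img c" "x \<in> ?N" "x \<in> ?S" using r by auto
      \<comment> \<open>The cutoff is 1 on the ball of radius \<open>2 * r\<close>, so there the
        perturbation is exactly the linear function provided by Sard's theorem.\<close>
      have "v (param c y) = ?u y + (\<Sum>l\<in>UNIV. b $ l * y $ l)" if "y \<in> ?S" for y
      proof -
        have "bump a (2 * r) y = 1" using bump_eq_1[of "2 * r" y a] r that by (simp add: dist_commute)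
        then show ?thesis using that by (simp add: v_def w_def param_in chart_param)
      qed
      then have "nondegeneracy ?S (\<lambda>x. v (param c x)) x = nondegeneracy ?S (\<lambda>y. ?u y + (\<Sum>l\<in>UNIV. b $ l * y $ l)) x"
        by (intro nondegeneracy_cong x(3))
      also have "\<dots> = (norm (grad_on ?S ?u x + b))\<^sup>2 + (det (hess_on ?S ?u x))\<^sup>2"
        by (rule nondegeneracy_add_linear[OF S su x(3)])
      also have "\<dots> > 0" using b(2)[OF x(3)] by (auto simp: sum_power2_gt_zero_iff)
      finally show "0 < nondegeneracy (img c) (\<lambda>x. v (param c x)) x"
        using nondegeneracy_Int_open[OF _ x(1,2)] by simp
    qed
  qed
qed

lemma nondegenerate_exists:
  assumes "finite F" "\<And>c a r. (c, a, r) \<in> F \<Longrightarrow> coordinate_ball c a r"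
  shows "\<exists>u. smooth_function \<A> u \<and> (\<forall>(c, a, r)\<in>F. nondegenerate_on u c a r)"
  using assms
proof (induction F)
  case empty
  then show ?case using smooth_function_const by auto
next
  case (insert d F)
  obtain c a r where d: "d = (c, a, r)" by (cases d)
  obtain u where u: "smooth_function \<A> u" "\<forall>(c, a, r)\<in>F. nondegenerate_on u c a r"
    using insert.IH insert.prems by auto
  have "coordinate_ball c' a' r' \<and> nondegenerate_on u c' a' r'" if "(c', a', r') \<in> F" for c' a' r'
    using u(2) insert.prems that by auto
  from nondegenerate_step[OF insert.hyps(1) this u(1), of c a r]
  obtain v where "smooth_function \<A> v" "nondegenerate_on v c a r"
    "\<And>c a r. (c, a, r) \<in> F \<Longrightarrow> nondegenerate_on v c a r"
    using insert.prems d by (metis insertI1)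
  then show ?case using d by (intro exI[of _ v]) auto
qed

text \<open>In each compact piece of the cover the critical points form a closed set. If it were
  infinite it would have a limit point in itself, contrary to the isolation of nondegenerate
  critical points.\<close>

lemma finite_critical_exists:
  assumes "compact_space X"
  obtains u where "smooth_function \<A> u" "finite {p \<in> topspace X. critical u p}"
proof -
  obtain F where F: "finite F" "\<And>c a r. (c, a, r) \<in> F \<Longrightarrow> coordinate_ball c a r"
    "\<And>p. p \<in> topspace X \<Longrightarrow> \<exists>(c, a, r)\<in>F. p \<in> fst c \<and> snd c p \<in> cball a r"
    by (rule finite_coordinate_cover[OF assms]) blast
  obtain u where u: "smooth_function \<A> u" "\<forall>(c, a, r)\<in>F. nondegenerate_on u c a r"
    using nondegenerate_exists[OF F(1,2)] by blast
  define Z where "Z = (\<lambda>(c, a, r). {x \<in> cball a r \<inter> img c. grad_on (img c) (\<lambda>x. u (param c x)) x = 0})"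
  have "finite (Z (c, a, r))" if d: "(c, a, r) \<in> F" for c a r
  proof (rule ccontr)
    assume inf: "infinite (Z (c, a, r))"
    have c: "c \<in> \<A>" and K: "compact (cball a r \<inter> img c)"
      using F(2)[OF d] by (auto simp: coordinate_ball_def)
    note S = chart_domain[OF c] and su = smooth_functionD[OF u(1) c]
    have "continuous_on (cball a r \<inter> img c) (grad_on (img c) (\<lambda>x. u (param c x)))"
      using smooth_on_imp_continuous_on[OF smooth_on_grad_on[OF S su]] continuous_on_subset by blast
    then have "closed (Z (c, a, r))"
      unfolding Z_def prod.case using compact_imp_closed[OF K] by (rule continuous_closed_preimage_constant)
    moreover have sub: "Z (c, a, r) \<subseteq> cball a r \<inter> img c" by (auto simp: Z_def)
    ultimately have "compact (Z (c, a, r))" using compact_Int_closed[OF K] by (metis inf.absorb2)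
    then obtain x where x: "x \<in> Z (c, a, r)" "x islimpt Z (c, a, r)"
      using inf compact_eq_Bolzano_Weierstrass by blast
    then have x': "x \<in> img c" "grad_on (img c) (\<lambda>x. u (param c x)) x = 0" "x \<in> cball a r \<inter> img c"
      by (auto simp: Z_def)
    have "nondegenerate_on u c a r" using u(2) d by auto
    then have "0 < nondegeneracy (img c) (\<lambda>x. u (param c x)) x"
      using x'(3) unfolding nondegenerate_on_def by blast
    from nondegenerate_critical_isolated[OF S su x'(1,2) this]
    obtain e where e: "0 < e" "\<And>y. y \<in> img c \<Longrightarrow> dist y x < e \<Longrightarrow> y \<noteq> x \<Longrightarrow> grad_on (img c) (\<lambda>x. u (param c x)) y \<noteq> 0"
      by metis
    obtain y where "y \<in> Z (c, a, r)" "y \<noteq> x" "dist y x < e"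
      using x(2) e(1) unfolding islimpt_approachable by blast
    then show False using e(2)[of y] by (auto simp: Z_def)
  qed
  then have fin: "finite (\<Union>(c, a, r)\<in>F. param c ` Z (c, a, r))" using F(1) by auto
  have "{p \<in> topspace X. critical u p} \<subseteq> (\<Union>(c, a, r)\<in>F. param c ` Z (c, a, r))"
  proof
    fix p assume p: "p \<in> {p \<in> topspace X. critical u p}"
    then obtain c a r where d: "(c, a, r) \<in> F" "p \<in> fst c" "snd c p \<in> cball a r" using F(3)[of p] by auto
    then have c: "c \<in> \<A>" using F(2) by (auto simp: coordinate_ball_def)
    have "snd c p \<in> Z (c, a, r)"
      using critical_iff[OF u(1) c d(2)] p d by (auto simp: Z_def)
    then have "p \<in> param c ` Z (c, a, r)" using param_chart[OF c d(2)] by force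
    then show "p \<in> (\<Union>(c, a, r)\<in>F. param c ` Z (c, a, r))" using d(1) by force
  qed
  then show thesis using that u(1) fin finite_subset by blast
qed

end

subsection \<open>Removing critical points through the boundary\<close>

lemma lipschitz_derivative_bound:
  fixes f :: "'a::real_normed_vector \<Rightarrow> real"
  assumes der: "(f has_derivative f') (at x)" and lip: "\<And>y. \<bar>f y - f x\<bar> \<le> L * norm (y - x)"
  shows "\<bar>f' v\<bar> \<le> L * norm v"
proof (cases "v = 0")
  case True
  then show ?thesis using linear_0[OF has_derivative_linear[OF der]] by simp
next
  case False
  interpret bounded_linear f' using der by (rule has_derivative_bounded_linear)
  show ?thesis
  proof (rule field_le_epsilon)
    fix e :: real assume e: "0 < e"
    define e' where "e' = e / norm v"
    have "0 < e'" using e False by (simp add: e'_def)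
    then obtain d where d: "0 < d" "\<And>y. norm (y - x) < d \<Longrightarrow> norm (f y - f x - f' (y - x)) \<le> e' * norm (y - x)"
      using der unfolding has_derivative_within_alt by blast
    define t where "t = d / (2 * norm v)"
    have t: "0 < t" using d(1) False by (simp add: t_def)
    have n: "norm (t *\<^sub>R v) < d" using d(1) False by (simp add: t_def)
    have "\<bar>f (x + t *\<^sub>R v) - f x - t * f' v\<bar> \<le> e' * (t * norm v)"
      using d(2)[of "x + t *\<^sub>R v"] n t by (simp add: scaleR)
    moreover have "\<bar>f (x + t *\<^sub>R v) - f x\<bar> \<le> L * (t * norm v)"
      using lip[of "x + t *\<^sub>R v"] t by simp
    ultimately have "\<bar>t * f' v\<bar> \<le> L * (t * norm v) + e' * (t * norm v)" by linarith
    then have "t * \<bar>f' v\<bar> \<le> t * (L * norm v + e' * norm v)"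
      using t by (simp add: abs_mult algebra_simps)
    then have "\<bar>f' v\<bar> \<le> L * norm v + e' * norm v" using t by simp
    then show "\<bar>f' v\<bar> \<le> L * norm v + e" using False by (simp add: e'_def)
  qed
qed

text \<open>Translates by \<open>w\<close> near \<open>a\<close> and fixes all points far from it.
  When \<open>L * norm w < 1\<close> for a Lipschitz constant \<open>L\<close> of the bump, the
  displacement is a contraction, which makes the map injective with invertible derivative.\<close>

definition push :: "real^'n::finite \<Rightarrow> real \<Rightarrow> real^'n \<Rightarrow> real^'n \<Rightarrow> real^'n"
  where "push a r w x = x + bump a r x *\<^sub>R w"

lemma smooth_on_push:
  assumes "smooth_domain S"
  shows "smooth_on S (push a r w)"
  unfolding push_def[abs_def]
  by (intro smooth_on_add smooth_on_ident smooth_on_scaleR smooth_on_bump smooth_on_const assms)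

lemma inj_push:
  assumes lip: "\<And>x y. \<bar>bump a r x - bump a r y\<bar> \<le> L * norm (x - y)" and w: "L * norm w < 1"
  shows "inj (push a r w)"
proof (rule injI)
  fix x y assume "push a r w x = push a r w y"
  then have "x - y = (bump a r y - bump a r x) *\<^sub>R w"
    by (simp add: push_def algebra_simps)
  then have "norm (x - y) = \<bar>bump a r y - bump a r x\<bar> * norm w" by simp
  also have "\<dots> \<le> L * norm (y - x) * norm w" by (intro mult_right_mono lip) simp
  finally have "norm (x - y) \<le> (L * norm w) * norm (x - y)" by (simp add: norm_minus_commute mult_ac)
  then have "(1 - L * norm w) * norm (x - y) \<le> 0" by (simp add: left_diff_distrib)
  then have "norm (x - y) \<le> 0" using w by (simp add: mult_le_0_iff)
  then show "x = y" by simp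
qed

text \<open>The Jacobian is the identity plus the rank-one matrix of \<open>w\<close> and the
  gradient \<open>?g\<close> of the bump. A vector killed by its transpose is
  \<open>- (w \<bullet> y)\<close> times \<open>?g\<close>, hence of norm at most
  \<open>L * norm w * norm y\<close>.\<close>

lemma push_jacobian_injective:
  fixes y :: "real^'n::finite"
  assumes lip: "\<And>x y. \<bar>bump a r x - bump a r y\<bar> \<le> L * norm (x - y)" and w: "L * norm w < 1"
    and S: "smooth_domain S" "x \<in> S" and y: "transpose (jacobian_on S (push a r w) x) *v y = 0"
  shows "y = 0"
proof -
  have U: "smooth_domain (UNIV :: (real^'n) set)" by (simp add: smooth_domain_def)
  let ?b = "bump a r :: real^'n \<Rightarrow> real" and ?g = "grad_on UNIV (bump a r) x"
  have b: "smooth_on UNIV ?b" by (rule smooth_on_bump[OF U])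
  have bS: "smooth_on S ?b" by (rule smooth_on_bump[OF S(1)])
  have "(?b has_derivative (\<lambda>v. \<Sum>i\<in>UNIV. (v $ i) *\<^sub>R partial i UNIV ?b x)) (at x)"
    using has_derivative_partial[OF smooth_on_imp_differentiable[OF b UNIV_I]] .
  from lipschitz_derivative_bound[OF this lip, of ?g]
  have "?g \<bullet> ?g \<le> L * norm ?g" by (simp add: grad_on_def inner_vec_def)
  then have "norm ?g * norm ?g \<le> L * norm ?g" by (simp add: norm_eq_sqrt_inner)
  \<comment> \<open>The Lipschitz bound for two points at distance 1 shows that \<open>L\<close> is
    nonnegative.\<close>
  moreover have "0 \<le> L * norm (0 - axis undefined 1 :: real^'n)" by (rule order_trans[OF abs_ge_zero lip])
  then have "0 \<le> L" by simp
  ultimately have g: "norm ?g \<le> L" by (cases "norm ?g = 0") auto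
  have "partial i S (push a r w) x = axis i 1 + partial i UNIV ?b x *\<^sub>R w" for i
  proof -
    have "partial i S (push a r w) x = partial i S (\<lambda>x. x) x + partial i S (\<lambda>x. ?b x *\<^sub>R w) x"
      unfolding push_def[abs_def]
      by (intro smooth_partial_add[OF S _ S(2) _ S(2)] smooth_on_ident smooth_on_scaleR smooth_on_const bS S(1))
    also have "partial i S (\<lambda>x. x) x = axis i 1"
      using partial_eqI[OF S has_derivative_ident] .
    also have "partial i S (\<lambda>x. ?b x *\<^sub>R w) x = partial i S ?b x *\<^sub>R w"
      by (rule partial_bounded_linear[OF S bounded_linear_scaleR_left smooth_on_imp_differentiable[OF bS S(2)]])
    also have "partial i S ?b x = partial i UNIV ?b x"
      by (rule partial_subset[OF U S(1) _ S(2) smooth_on_imp_differentiable[OF b UNIV_I]]) simp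
    finally show ?thesis .
  qed
  then have J: "jacobian_on S (push a r w) x $ j $ i = (if j = i then 1 else 0) + w $ j * ?g $ i" for i j
    by (simp add: jacobian_on_def grad_on_def axis_def mult.commute)
  have "(transpose (jacobian_on S (push a r w) x) *v y) $ i = (y + (w \<bullet> y) *\<^sub>R ?g) $ i" for i
  proof -
    have "(transpose (jacobian_on S (push a r w) x) *v y) $ i =
        (\<Sum>j\<in>UNIV. (if j = i then y $ i else 0) + (w $ j * y $ j) * ?g $ i)"
      unfolding matrix_vector_mult_def transpose_def
      by (simp add: J, intro sum.cong) (auto simp: algebra_simps)
    also have "\<dots> = y $ i + (\<Sum>j\<in>UNIV. w $ j * y $ j) * ?g $ i"
      by (simp add: sum.distrib sum_distrib_right)
    finally show ?thesis by (simp add: inner_vec_def)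
  qed
  then have "transpose (jacobian_on S (push a r w) x) *v y = y + (w \<bullet> y) *\<^sub>R ?g"
    by (simp only: vec_eq_iff) blast
  then have "y = - ((w \<bullet> y) *\<^sub>R ?g)" using y by (simp add: eq_neg_iff_add_eq_0)
  then have "norm y = \<bar>w \<bullet> y\<bar> * norm ?g" by (metis norm_minus_cancel norm_scaleR)
  also have "\<dots> \<le> (norm w * norm y) * L"
    by (intro mult_mono Cauchy_Schwarz_ineq2 g) auto
  finally have "(1 - L * norm w) * norm y \<le> 0" by (simp add: algebra_simps)
  then have "norm y \<le> 0" using w by (simp add: mult_le_0_iff)
  then show "y = 0" by simp
qed

context smooth_manifold
begin

text \<open>An injective local diffeomorphism, expressed by its effect on functions only.\<close>

definition regular_embedding :: "('a \<Rightarrow> 'a) \<Rightarrow> bool"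
  where "regular_embedding f \<longleftrightarrow> f ` topspace X \<subseteq> topspace X \<and> inj_on f (topspace X) \<and>
    (\<forall>u. smooth_function \<A> u \<longrightarrow> smooth_function \<A> (\<lambda>p. u (f p)) \<and>
      (\<forall>p\<in>topspace X. critical (\<lambda>p. u (f p)) p \<longrightarrow> critical u (f p)))"

lemma regular_embedding_compose:
  assumes f: "regular_embedding f" and g: "regular_embedding g"
  shows "regular_embedding (\<lambda>p. g (f p))"
  unfolding regular_embedding_def
proof (intro conjI allI impI ballI)
  show "(\<lambda>p. g (f p)) ` topspace X \<subseteq> topspace X"
    using f g unfolding regular_embedding_def image_subset_iff by blast
  show "inj_on (\<lambda>p. g (f p)) (topspace X)"
    using f g unfolding regular_embedding_def inj_on_def by (metis image_subset_iff)
  fix u assume u: "smooth_function \<A> u"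
  then have gu: "smooth_function \<A> (\<lambda>p. u (g p))" using g unfolding regular_embedding_def by blast
  then show "smooth_function \<A> (\<lambda>p. u (g (f p)))"
    using f unfolding regular_embedding_def by blast
  fix p assume p: "p \<in> topspace X" and "critical (\<lambda>p. u (g (f p))) p"
  then have "critical (\<lambda>p. u (g p)) (f p)" using f gu unfolding regular_embedding_def by blast
  moreover have "f p \<in> topspace X" using f p unfolding regular_embedding_def by blast
  ultimately show "critical u (g (f p))" using g u unfolding regular_embedding_def by blast
qed

section \<open>Extending a push in one chart to the whole manifold\<close>

definition push_map :: "('a, 'n) chart \<Rightarrow> real^'n \<Rightarrow> real \<Rightarrow> real^'n \<Rightarrow> 'a \<Rightarrow> 'a"
  where "push_map c a r w p = (if p \<in> fst c then param c (push a r w (snd c p)) else p)"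

text \<open>Two open sets cover the manifold: the chart domain, where the properties come from
  \<open>push\<close> in coordinates, and the complement of a compact subset of it, where the map is
  the identity.\<close>

lemma regular_embedding_push_map:
  assumes c: "c \<in> \<A>" and r: "0 < r" and cpt: "compact (cball a (2 * r) \<inter> img c)"
    and lip: "\<And>x y. \<bar>bump a r x - bump a r y\<bar> \<le> L * norm (x - y)" and w: "L * norm w < 1"
    and img: "\<And>x. x \<in> img c \<Longrightarrow> push a r w x \<in> img c"
  shows "regular_embedding (push_map c a r w)"
  unfolding regular_embedding_def
proof (intro conjI allI impI ballI)
  let ?f = "push_map c a r w" and ?K = "param c ` (cball a (2 * r) \<inter> img c)"
  have in_chart: "?f p \<in> fst c" "snd c (?f p) = push a r w (snd c p)" if "p \<in> fst c" for p
    using img[of "snd c p"] that by (auto simp: push_map_def param_in chart_param)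
  have out: "?f p = p" if "p \<notin> ?K" for p
  proof (cases "p \<in> fst c")
    case True
    have "snd c p \<notin> cball a (2 * r)"
      using that True param_chart[OF c True] by (metis IntI imageI)
    then have "bump a r (snd c p) = 0" by (intro bump_eq_0[OF r]) (simp add: dist_commute)
    then show ?thesis using True param_chart[OF c True] by (simp add: push_map_def push_def)
  qed (simp add: push_map_def)
  show "?f ` topspace X \<subseteq> topspace X"
    using in_chart chart_subset[OF c] by (auto simp: push_map_def)
  show "inj_on ?f (topspace X)"
  proof (rule inj_onI)
    fix p q assume pq: "?f p = ?f q"
    show "p = q"
    proof (cases "p \<in> fst c \<and> q \<in> fst c")
      case True
      then have "push a r w (snd c p) = push a r w (snd c q)" using in_chart pq by metis
      then have "snd c p = snd c q" using inj_push[OF lip w] by (simp add: inj_eq)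
      then show ?thesis using True param_chart[OF c] by metis
    next
      case False
      then show ?thesis using in_chart(1)[of p] in_chart(1)[of q] pq by (auto simp: push_map_def split: if_splits)
    qed
  qed
  fix u assume u: "smooth_function \<A> u"
  note S = chart_domain[OF c] and su = smooth_functionD[OF u c]
  have K: "closedin X ?K" by (rule param_compact_closed[OF c cpt]) simp
  have expr: "u (?f (param c x)) = u (param c (push a r w x))" if "x \<in> img c" for x
    using that by (simp add: push_map_def param_in chart_param)
  have push_img: "push a r w ` img c \<subseteq> img c" using img by blast
  have W: "openin X (fst d - ?K)" if "d \<in> \<A>" for d
    using chart_open[OF that] K by (rule openin_diff)
  have sW: "smooth_on (snd d ` (fst d - ?K)) (\<lambda>x. u (param d x))" if d: "d \<in> \<A>" for d
    by (rule smooth_on_subset[OF chart_domain[OF d] overlap_domain[OF d W[OF d]] _ smooth_functionD[OF u d]]) auto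
  have exprW: "u (?f (param d x)) = u (param d x)" if d: "d \<in> \<A>" and x: "x \<in> snd d ` (fst d - ?K)" for d x
  proof -
    have "param d x \<notin> ?K" using x param_chart[OF d] by auto
    then show ?thesis by (simp add: out)
  qed
  show fu: "smooth_function \<A> (\<lambda>p. u (?f p))"
  proof (rule smooth_functionI_local)
    fix p assume p: "p \<in> topspace X"
    show "\<exists>d\<in>\<A>. \<exists>W. openin X W \<and> p \<in> W \<and> W \<subseteq> fst d \<and> smooth_on (snd d ` W) (\<lambda>x. u (?f (param d x)))"
    proof (cases "p \<in> fst c")
      case True
      have "smooth_on (img c) (\<lambda>x. u (?f (param c x)))"
        by (rule smooth_on_congI[OF smooth_on_compose[OF S push_img smooth_on_push[OF S] su] expr])
      then show ?thesis using c chart_open[OF c] True by blast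
    next
      case False
      obtain d where d: "d \<in> \<A>" "p \<in> fst d" using chart_exists[OF p] by blast
      have "smooth_on (snd d ` (fst d - ?K)) (\<lambda>x. u (?f (param d x)))"
        by (rule smooth_on_congI[OF sW[OF d(1)] exprW[OF d(1)]])
      moreover have "p \<notin> ?K" using False param_in by auto
      ultimately show ?thesis using d W[OF d(1)] by blast
    qed
  qed
  fix p assume p: "p \<in> topspace X" and crit: "critical (\<lambda>p. u (?f p)) p"
  show "critical u (?f p)"
  proof (cases "p \<in> fst c")
    case True
    let ?x = "snd c p"
    have x: "?x \<in> img c" using True by blast
    have "0 = grad_on (img c) (\<lambda>x. u (?f (param c x))) ?x"
      using crit critical_iff[OF fu c True] by simp
    also have "\<dots> = grad_on (img c) (\<lambda>x. u (param c (push a r w x))) ?x"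
      by (rule grad_on_cong[OF expr x])
    also have "\<dots> = transpose (jacobian_on (img c) (push a r w) ?x) *v grad_on (img c) (\<lambda>x. u (param c x)) (push a r w ?x)"
      by (rule grad_on_compose[OF S x push_img smooth_on_push[OF S] su])
    finally have "grad_on (img c) (\<lambda>x. u (param c x)) (push a r w ?x) = 0"
      using push_jacobian_injective[OF lip w S x] by metis
    then show ?thesis using critical_iff[OF u c in_chart(1)[OF True]] in_chart(2)[OF True] by simp
  next
    case False
    obtain d where d: "d \<in> \<A>" "p \<in> fst d" using chart_exists[OF p] by blast
    have "p \<notin> ?K" using False param_in by auto
    then have x: "snd d p \<in> snd d ` (fst d - ?K)" using d by blast
    note V = overlap_domain[OF d(1) W[OF d(1)] Diff_subset]
    have sub: "snd d ` (fst d - ?K) \<subseteq> img d" by blast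
    have "grad_on (img d) (\<lambda>x. u (param d x)) (snd d p) = grad_on (snd d ` (fst d - ?K)) (\<lambda>x. u (param d x)) (snd d p)"
      by (rule grad_on_subset[OF chart_domain[OF d(1)] V sub x smooth_functionD[OF u d(1)], symmetric])
    also have "\<dots> = grad_on (snd d ` (fst d - ?K)) (\<lambda>x. u (?f (param d x))) (snd d p)"
      by (rule grad_on_cong[OF exprW[OF d(1), symmetric] x])
    also have "\<dots> = grad_on (img d) (\<lambda>x. u (?f (param d x))) (snd d p)"
      by (rule grad_on_subset[OF chart_domain[OF d(1)] V sub x smooth_functionD[OF fu d(1)]])
    also have "\<dots> = 0" using crit critical_iff[OF fu d] by simp
    finally show ?thesis using critical_iff[OF u d] False by (simp add: push_map_def)
  qed
qed

section \<open>Points missed by an embedding, and functions without critical points\<close>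

definition avoidable :: "'a \<Rightarrow> bool"
  where "avoidable p \<longleftrightarrow> (\<exists>f. regular_embedding f \<and> p \<notin> f ` topspace X)"

lemma param_ball_open:
  assumes "c \<in> \<A>"
  shows "openin X (param c ` (img c \<inter> ball a s))"
  by (rule param_image_open[OF assms]) (auto simp: openin_open)

lemma mem_param_ball:
  assumes "c \<in> \<A>" "p \<in> fst c" "0 < s"
  shows "p \<in> param c ` (img c \<inter> ball (snd c p) s)"
  using assms param_chart[OF assms(1,2)] by (intro image_eqI[of _ _ "snd c p"]) auto

text \<open>If \<open>f\<close> misses \<open>q\<close> and an injective push \<open>g\<close> takes
  \<open>q\<close> to \<open>q'\<close>, then \<open>g\<close> after \<open>f\<close> misses
  \<open>q'\<close>.\<close>

lemma avoidable_near_interior_point: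
  assumes c: "c \<in> \<A>" and p: "p \<in> fst c" and int: "snd c p \<in> interior (img c)"
  obtains W where "openin X W" "p \<in> W" "\<And>q q'. q \<in> W \<Longrightarrow> q' \<in> W \<Longrightarrow> avoidable q \<Longrightarrow> avoidable q'"
proof -
  let ?a = "snd c p"
  obtain R where R: "0 < R" "cball ?a R \<subseteq> img c" using int by (meson mem_interior_cball)
  define r where "r = R / 4"
  have r: "0 < r" "cball ?a (4 * r) \<subseteq> img c" using R by (auto simp: r_def)
  obtain L where L: "0 < L" "\<And>x y. \<bar>bump ?a r x - bump ?a r y\<bar> \<le> L * norm (x - y)"
    using bump_lipschitz[OF r(1)] by metis
  \<comment> \<open>The displacement is shorter than \<open>2 * s\<close>. The bound
    \<open>r / 2\<close> keeps the ball inside the region where the bump is 1 and pushed points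
    inside the chart; \<open>1 / (4 * L)\<close> gives \<open>L * norm w < 1\<close>.\<close>
  define s where "s = min (r / 2) (1 / (4 * L))"
  have s: "0 < s" "s \<le> r / 2" "s * (4 * L) \<le> 1" using r L by (auto simp: s_def min_def field_simps)
  have "cball ?a (2 * r) \<subseteq> cball ?a (4 * r)" using r(1) by (intro subset_cball) simp
  then have cpt: "compact (cball ?a (2 * r) \<inter> img c)" using r(2) by (simp add: inf.absorb1 subset_trans)
  show thesis
  proof (rule that[OF param_ball_open[OF c] mem_param_ball[OF c p s(1)]])
    fix q q' assume q: "q \<in> param c ` (img c \<inter> ball ?a s)" and q': "q' \<in> param c ` (img c \<inter> ball ?a s)"
      and "avoidable q"
    then obtain f where f: "regular_embedding f" "q \<notin> f ` topspace X" unfolding avoidable_def by blast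
    obtain x where "x \<in> img c \<inter> ball ?a s" "q = param c x" using q by blast
    then have x: "x \<in> img c" "dist ?a x < s" "q = param c x" by simp_all
    obtain x' where "x' \<in> img c \<inter> ball ?a s" "q' = param c x'" using q' by blast
    then have x': "x' \<in> img c" "dist ?a x' < s" "q' = param c x'" by simp_all
    define w where "w = x' - x"
    have nw: "norm w < 2 * s" using x(2) x'(2) dist_triangle[of x' x ?a] by (simp add: w_def dist_norm norm_minus_commute)
    then have "L * norm w < L * (2 * s)" using L(1) by simp
    then have Lw: "L * norm w < 1" using s(3) by (simp add: mult_ac)
    have img: "push ?a r w y \<in> img c" if y: "y \<in> img c" for y
    proof (cases "2 * r \<le> dist y ?a")
      case True
      then show ?thesis using bump_eq_0[OF r(1) True] y by (simp add: push_def)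
    next
      case False
      have "norm (bump ?a r y *\<^sub>R w) \<le> norm w"
        using bump_range[of ?a r y] by (simp add: mult_left_le_one_le)
      then have "dist (push ?a r w y) y \<le> r" using nw s(2) by (simp add: push_def dist_norm)
      moreover have "dist (push ?a r w y) ?a \<le> dist (push ?a r w y) y + dist y ?a" by (rule dist_triangle)
      ultimately have "push ?a r w y \<in> cball ?a (4 * r)" using False r(1) by (simp add: dist_commute)
      then show ?thesis using r(2) by blast
    qed
    let ?g = "push_map c ?a r w"
    have g: "regular_embedding ?g" by (rule regular_embedding_push_map[OF c r(1) cpt L(2) Lw img])
    have "bump ?a r x = 1"
      by (rule bump_eq_1[OF r(1)]) (use x(2) s r(1) in \<open>simp add: dist_commute\<close>)
    then have gq: "?g q = q'" using x x' by (simp add: push_map_def param_in chart_param push_def w_def)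
    have "q' \<notin> (\<lambda>z. ?g (f z)) ` topspace X"
    proof
      assume "q' \<in> (\<lambda>z. ?g (f z)) ` topspace X"
      then obtain z where z: "z \<in> topspace X" "?g (f z) = ?g q" using gq by auto
      have "f z \<in> topspace X" using f(1) z(1) unfolding regular_embedding_def by blast
      moreover have "q \<in> topspace X" using x param_in chart_subset[OF c] by blast
      ultimately have "f z = q" using g z(2) unfolding regular_embedding_def by (meson inj_onD)
      then show False using f(2) z(1) by blast
    qed
    then show "avoidable q'" using regular_embedding_compose[OF f(1) g] unfolding avoidable_def by blast
  qed
qed

text \<open>Near \<open>p\<close> the push is the translation by \<open>s\<close> away from the
  bounding hyperplane. It vacates a strip of width \<open>s\<close>, which contains every point
  within \<open>s / 2\<close> of \<open>p\<close> in the chart.\<close>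

lemma avoidable_near_boundary_point:
  assumes c: "c \<in> \<A>" and p: "p \<in> fst c" and bd: "snd c p \<notin> interior (img c)"
  obtains W where "openin X W" "p \<in> W" "\<And>q. q \<in> W \<Longrightarrow> avoidable q"
proof -
  let ?a = "snd c p"
  have a: "?a \<in> img c" using p by blast
  obtain T k where T: "open T" "img c = T \<inter> {x. 0 \<le> x $ k}"
    using chart_domain[OF c]
  proof (cases rule: smooth_domainE)
    case (1 T)
    then have "interior (img c) = img c" by (simp add: interior_open)
    then show ?thesis using a bd by simp
  qed (use that in blast)
  have ak: "?a $ k = 0"
  proof (rule ccontr)
    assume "?a $ k \<noteq> 0"
    then have "?a \<in> T \<inter> {x. 0 < x $ k}" using a T(2) by auto
    moreover have "open (T \<inter> {x. 0 < x $ k})"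
      by (intro open_Int T(1) open_Collect_less continuous_intros)
    moreover have "T \<inter> {x. 0 < x $ k} \<subseteq> img c" using T(2) by auto
    ultimately show False using bd by (meson interior_maximal subsetD)
  qed
  have "?a \<in> T" using a T(2) by simp
  then obtain R where R: "0 < R" "cball ?a R \<subseteq> T" using T(1) open_contains_cball by metis
  define r where "r = R / 4"
  have r: "0 < r" "cball ?a (4 * r) \<subseteq> T" using R by (auto simp: r_def)
  have "cball ?a (2 * r) \<subseteq> cball ?a (4 * r)" using r(1) by (intro subset_cball) simp
  then have "cball ?a (2 * r) \<inter> img c = cball ?a (2 * r) \<inter> {x. 0 \<le> x $ k}" using r(2) T(2) by blast
  moreover have "closed {x::real^'n. 0 \<le> x $ k}" by (intro closed_Collect_le continuous_intros)
  ultimately have cpt: "compact (cball ?a (2 * r) \<inter> img c)" by (simp add: compact_Int_closed)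
  obtain L where L: "0 < L" "\<And>x y. \<bar>bump ?a r x - bump ?a r y\<bar> \<le> L * norm (x - y)"
    using bump_lipschitz[OF r(1)] by metis
  \<comment> \<open>The bound \<open>1 / (2 * L)\<close> gives \<open>L * norm w < 1\<close>; the
    bound \<open>r / 2\<close> ensures that points sent to within \<open>s / 2\<close> of the centre
    come from the region where the bump is 1.\<close>
  define s where "s = min (r / 2) (1 / (2 * L))"
  have s: "0 < s" "s \<le> r / 2" "s * (2 * L) \<le> 1" using r L by (auto simp: s_def min_def field_simps)
  define w where "w = (axis k s :: real^'n)"
  have "w = s *\<^sub>R axis k 1" by (simp add: w_def vec_eq_iff axis_def)
  then have nw: "norm w = s" using s(1) by simp
  have "0 < s * L" using s(1) L(1) by simp
  then have Lw: "L * norm w < 1" using s(3) unfolding nw by (simp add: mult_ac)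
  have img: "push ?a r w y \<in> img c" if y: "y \<in> img c" for y
  proof (cases "2 * r \<le> dist y ?a")
    case True
    then show ?thesis using bump_eq_0[OF r(1) True] y by (simp add: push_def)
  next
    case False
    have "norm (bump ?a r y *\<^sub>R w) \<le> norm w"
      using bump_range[of ?a r y] by (simp add: mult_left_le_one_le)
    moreover have "dist (push ?a r w y) y = norm (bump ?a r y *\<^sub>R w)" by (simp add: push_def dist_norm)
    ultimately have "dist (push ?a r w y) y \<le> r" using nw s(1,2) by linarith
    moreover have "dist (push ?a r w y) ?a \<le> dist (push ?a r w y) y + dist y ?a" by (rule dist_triangle)
    ultimately have "push ?a r w y \<in> cball ?a (4 * r)" using False r(1) by (simp add: dist_commute)
    moreover have "0 \<le> push ?a r w y $ k"
      using y T(2) s(1) bump_range[of ?a r y] by (simp add: push_def w_def)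
    ultimately show ?thesis using r(2) T(2) by blast
  qed
  let ?g = "push_map c ?a r w"
  have g: "regular_embedding ?g" by (rule regular_embedding_push_map[OF c r(1) cpt L(2) Lw img])
  have s2: "0 < s / 2" using s(1) by simp
  show thesis
  proof (rule that[OF param_ball_open[OF c] mem_param_ball[OF c p s2]])
    fix q assume "q \<in> param c ` (img c \<inter> ball ?a (s / 2))"
    then obtain b where "b \<in> img c \<inter> ball ?a (s / 2)" "q = param c b" by blast
    then have b: "b \<in> img c" "dist ?a b < s / 2" "q = param c b" by simp_all
    have qc: "q \<in> fst c" "snd c q = b" using b param_in chart_param by auto
    have "q \<notin> ?g ` topspace X"
    proof
      assume "q \<in> ?g ` topspace X"
      then obtain z where z: "?g z = q" by auto
      have zc: "z \<in> fst c" using z qc by (auto simp: push_map_def split: if_splits)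
      let ?x = "snd c z"
      have x: "?x \<in> img c" using zc by blast
      have pb: "push ?a r w ?x = b"
        using z zc qc(2) chart_param[OF img[OF x]] by (simp add: push_map_def)
      \<comment> \<open>A preimage lies within \<open>3 * s / 2\<close>, hence within
        \<open>r\<close>, of the centre. It has therefore been moved by all of \<open>s\<close>, and
        its coordinate \<open>k\<close> was negative.\<close>
      have "norm (bump ?a r ?x *\<^sub>R w) \<le> norm w"
        using bump_range[of ?a r ?x] by (simp add: mult_left_le_one_le)
      then have "dist b ?x \<le> s" using nw pb by (auto simp: push_def dist_norm)
      moreover have "dist ?x ?a \<le> dist ?x b + dist b ?a" by (rule dist_triangle)
      ultimately have "dist ?x ?a \<le> r" using b(2) s by (simp add: dist_commute)
      then have "bump ?a r ?x = 1" by (rule bump_eq_1[OF r(1)])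
      then have "?x $ k + s = b $ k" using pb by (auto simp: push_def w_def)
      moreover have "\<bar>(b - ?a) $ k\<bar> < s / 2"
        using component_le_norm_cart[of "b - ?a" k] b(2) by (simp add: dist_norm norm_minus_commute)
      ultimately have "?x $ k < 0" using ak s(1) by simp
      then show False using x T(2) by auto
    qed
    then show "avoidable q" using g unfolding avoidable_def by blast
  qed
qed

lemma all_avoidable:
  assumes conn: "connected_space X" and bd: "manifold_boundary \<A> \<noteq> {}" and p: "p \<in> topspace X"
  shows "avoidable p"
proof -
  let ?P = "{p \<in> topspace X. avoidable p}"
  \<comment> \<open>On a small neighbourhood either all points are avoidable or avoidability is
    constant. This one alternative makes both the avoidable points and their complement
    open.\<close>
  have loc: "\<exists>W. openin X W \<and> p \<in> W \<and> ((\<forall>q\<in>W. avoidable q) \<or> (\<forall>q\<in>W. \<forall>q'\<in>W. avoidable q \<longrightarrow> avoidable q'))"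
    if p: "p \<in> topspace X" for p
  proof -
    obtain c where c: "c \<in> \<A>" "p \<in> fst c" using chart_exists[OF p] by blast
    show ?thesis
    proof (cases "snd c p \<in> interior (img c)")
      case True
      then show ?thesis using avoidable_near_interior_point[OF c] by metis
    next
      case False
      then show ?thesis using avoidable_near_boundary_point[OF c] by metis
    qed
  qed
  have "openin X ?P"
  proof (subst openin_subopen, intro ballI)
    fix p assume "p \<in> ?P"
    then obtain W where W: "openin X W" "p \<in> W" "\<forall>q\<in>W. avoidable q" using loc[of p] by blast
    then show "\<exists>T. openin X T \<and> p \<in> T \<and> T \<subseteq> ?P" using openin_subset by blast
  qed
  moreover have "openin X (topspace X - ?P)"
  proof (subst openin_subopen, intro ballI)
    fix p assume p: "p \<in> topspace X - ?P"
    then obtain W where W: "openin X W" "p \<in> W" "\<forall>q\<in>W. \<not> avoidable q" using loc[of p] by blast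
    then show "\<exists>T. openin X T \<and> p \<in> T \<and> T \<subseteq> topspace X - ?P" using openin_subset by blast
  qed
  ultimately have "?P = {} \<or> ?P = topspace X"
    using conn unfolding connected_space_clopen_in closedin_def by blast
  moreover have "?P \<noteq> {}"
  proof -
    obtain q c where "c \<in> \<A>" "q \<in> fst c" "snd c q \<notin> interior (img c)"
      using bd unfolding manifold_boundary_def by (auto simp: split_beta)
    then obtain W where "q \<in> W" "\<And>q. q \<in> W \<Longrightarrow> avoidable q" using avoidable_near_boundary_point by metis
    then show ?thesis using \<open>c \<in> \<A>\<close> \<open>q \<in> fst c\<close> chart_subset by blast
  qed
  ultimately show ?thesis using p by blast
qed

lemma noncritical_exists:
  assumes "compact_space X" "connected_space X" "manifold_boundary \<A> \<noteq> {}"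
  obtains u where "smooth_function \<A> u" "\<And>p. p \<in> topspace X \<Longrightarrow> \<not> critical u p"
proof -
  let ?C = "\<lambda>u. {p \<in> topspace X. critical u p}"
  let ?Q = "\<lambda>n. \<exists>u. smooth_function \<A> u \<and> finite (?C u) \<and> card (?C u) = n"
  have "\<exists>n. ?Q n" using finite_critical_exists[OF assms(1)] by metis
  then obtain n where n: "?Q n" "\<And>m. m < n \<Longrightarrow> \<not> ?Q m" using exists_least_iff[of ?Q] by blast
  then obtain u where u: "smooth_function \<A> u" "finite (?C u)" "card (?C u) = n" by blast
  have "?C u = {}"
  proof (rule ccontr)
    assume "?C u \<noteq> {}"
    then obtain p where p: "p \<in> ?C u" by blast
    then obtain f where f: "regular_embedding f" "p \<notin> f ` topspace X"
      using all_avoidable[OF assms(2,3)] unfolding avoidable_def by blast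
    let ?v = "\<lambda>p. u (f p)"
    have v: "smooth_function \<A> ?v" using f(1) u(1) unfolding regular_embedding_def by blast
    \<comment> \<open>A critical point of the composition is sent to a critical point of
      \<open>u\<close>, and never to the missed point \<open>p\<close>; injectivity of
      \<open>f\<close> then compares the cardinalities.\<close>
    have sub: "f ` ?C ?v \<subseteq> ?C u - {p}"
      using f u(1) unfolding regular_embedding_def by blast
    have inj: "inj_on f (?C ?v)"
      using f(1) unfolding regular_embedding_def by (auto intro: inj_on_subset)
    have fin: "finite (f ` ?C ?v)" using finite_subset[OF sub] u(2) by simp
    have "card (?C ?v) = card (f ` ?C ?v)" using card_image[OF inj] by simp
    also have "\<dots> \<le> card (?C u - {p})" using card_mono[OF _ sub] u(2) by simp
    also have "\<dots> < n" using p u(2,3) by (metis card_Diff1_less)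
    finally have "card (?C ?v) < n" .
    moreover have "finite (?C ?v)" using fin inj finite_imageD by blast
    ultimately show False using n(2) v by blast
  qed
  then show thesis using that u(1) by blast
qed

end

section \<open>Conformal metrics with Schouten tensor in the cone\<close>

text \<open>The quotient of the two quadratic forms is invariant under scaling of \<open>v\<close>,
  so it is bounded by its maximum over the compact set of points of \<open>K\<close> and unit
  vectors.\<close>

lemma quadratic_form_bound:
  fixes A h :: "'b::metric_space \<Rightarrow> real^'n::finite^'n"
  assumes K: "compact K" and A: "continuous_on K A" and h: "continuous_on K h"
    and pos: "\<And>x v. x \<in> K \<Longrightarrow> v \<noteq> 0 \<Longrightarrow> 0 < v \<bullet> (h x *v v)"
  obtains C where "0 \<le> C" "\<And>x v. x \<in> K \<Longrightarrow> \<bar>v \<bullet> (A x *v v)\<bar> \<le> C * (v \<bullet> (h x *v v))"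
proof -
  let ?D = "K \<times> sphere (0::real^'n) 1"
  let ?q = "\<lambda>p. (snd p \<bullet> (A (fst p) *v snd p)) / (snd p \<bullet> (h (fst p) *v snd p))"
  have c: "continuous_on ?D (\<lambda>p. snd p \<bullet> (B (fst p) *v snd p))" if B: "continuous_on K B" for B :: "'b \<Rightarrow> real^'n^'n"
  proof -
    have "continuous_on ?D (\<lambda>p. B (fst p))"
      by (rule continuous_on_compose2[OF B continuous_on_fst[OF continuous_on_id]]) auto
    then show ?thesis unfolding inner_vec_def matrix_vector_mult_def
      by (simp, intro continuous_intros)
  qed
  have "snd p \<bullet> (h (fst p) *v snd p) \<noteq> 0" if "p \<in> ?D" for p
  proof -
    have "snd p \<noteq> 0" "fst p \<in> K" using that by auto
    then show ?thesis using pos[of "fst p" "snd p"] by simp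
  qed
  then have "continuous_on ?D ?q" by (intro continuous_on_divide c A h) blast
  then have "bounded (?q ` ?D)"
    by (intro compact_imp_bounded compact_continuous_image compact_Times K) auto
  then obtain C where C: "0 < C" "\<And>p. p \<in> ?D \<Longrightarrow> \<bar>?q p\<bar> \<le> C"
    unfolding bounded_pos by (auto simp: image_iff)
  show thesis
  proof (rule that[of C])
    fix x v assume x: "x \<in> K"
    show "\<bar>v \<bullet> (A x *v v)\<bar> \<le> C * (v \<bullet> (h x *v v))"
    proof (cases "v = 0")
      case False
      have "(x, v /\<^sub>R norm v) \<in> ?D" using x False by simp
      from C(2)[OF this] have "\<bar>v \<bullet> (A x *v v) / (v \<bullet> (h x *v v))\<bar> \<le> C"
        using False by (simp add: matrix_vector_mult_scaleR)
      then show ?thesis using pos[OF x False] by (simp add: abs_divide divide_le_eq)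
    qed simp
  qed (use C in simp)
qed

section \<open>Smoothness of curvature and Hessian, and positivity of the gradient norm\<close>

lemma smooth_on_ricci:
  assumes "metric_on S h"
  shows "smooth_on S (ricci S h)"
  unfolding ricci_def[abs_def] riemann_def
  by (intro smooth_on_vecI metric_onD(1)[OF assms])
    (simp, intro smooth_on_sum smooth_on_add smooth_on_diff smooth_on_mult smooth_on_partial
      smooth_on_christoffel metric_onD(1)[OF assms] assms)

lemma smooth_on_schouten:
  assumes "metric_on S h"
  shows "smooth_on S (schouten S h)"
proof -
  note S = metric_onD(1)[OF assms] and h = metric_onD(2)[OF assms]
  have "smooth_on S (scalar_curvature S h)"
    unfolding scalar_curvature_def[abs_def]
    by (intro smooth_on_sum smooth_on_mult smooth_on_nth smooth_on_ricci smooth_on_matrix_inv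
        metric_on_inv(1)[OF assms] S h assms)
  then show ?thesis unfolding schouten_def[abs_def]
    by (intro smooth_on_scaleR smooth_on_const smooth_on_diff smooth_on_mult smooth_on_ricci S h assms)
qed

definition hessian_matrix :: "(real^'n::finite) set \<Rightarrow> (real^'n \<Rightarrow> real^'n^'n) \<Rightarrow> (real^'n \<Rightarrow> real) \<Rightarrow> real^'n \<Rightarrow> real^'n^'n"
  where "hessian_matrix S h u x = (\<chi> j k. hessian S h u j k x)"

lemma smooth_on_hessian_matrix:
  assumes "metric_on S h" "smooth_on S u"
  shows "smooth_on S (hessian_matrix S h u)"
  unfolding hessian_matrix_def[abs_def] hessian_def
  by (intro smooth_on_vecI metric_onD(1)[OF assms(1)])
    (simp, intro smooth_on_diff smooth_on_sum smooth_on_mult smooth_on_partial smooth_on_christoffel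
      metric_onD(1)[OF assms(1)] assms)

lemma gradient_sq_inner:
  "gradient_sq S h u x = grad_on S u x \<bullet> (matrix_inv (h x) *v grad_on S u x)"
  by (simp add: gradient_sq_def gradient_def grad_on_def inner_vec_def matrix_vector_mult_def)

lemma gradient_sq_pos:
  assumes h: "metric_on S h" "x \<in> S" and "grad_on S u x \<noteq> 0"
  shows "0 < gradient_sq S h u x"
proof -
  let ?y = "matrix_inv (h x) *v grad_on S u x"
  have d: "grad_on S u x = h x *v ?y" using metric_on_inv(2)[OF h] by (simp add: matrix_vector_mul_assoc)
  then have "?y \<noteq> 0" using assms(3) by force
  then have "0 < ?y \<bullet> (h x *v ?y)" by (rule metric_onD(4)[OF h])
  then show ?thesis unfolding gradient_sq_inner using d by (simp add: inner_commute)
qed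

text \<open>The second term of the Hessian is the gain from the exponential: it is larger than the
  first by a factor N and supplies the \<beta> term of the estimate.\<close>

lemma exp_derivatives:
  fixes v :: "real^'n::finite \<Rightarrow> real" and N :: real
  assumes h: "metric_on S h" and v: "smooth_on S v" and x: "x \<in> S"
  defines "u \<equiv> \<lambda>x. exp (N * v x)"
  shows "partial i S u x = N * u x * partial i S v x"
    and "hessian S h u j k x = N * u x * hessian S h v j k x + N\<^sup>2 * u x * (partial j S v x * partial k S v x)"
    and "gradient_sq S h u x = N\<^sup>2 * (u x)\<^sup>2 * gradient_sq S h v x"
proof -
  note S = metric_onD(1)[OF h]
  have u: "smooth_on S u" unfolding u_def by (intro smooth_on_exp smooth_on_mult smooth_on_const S v)
  have p: "partial i S u y = N * u y * partial i S v y" if "y \<in> S" for y i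
    unfolding u_def
    by (rule partial_real_compose[OF S that smooth_on_imp_differentiable[OF v that], of "\<lambda>t. exp (N * t)"])
      (auto intro!: derivative_eq_intros)
  show "partial i S u x = N * u x * partial i S v x" by (rule p[OF x])
  have "partial j S (partial k S u) x = partial j S (\<lambda>y. (N * u y) * partial k S v y) x"
    by (rule partial_cong[OF p x])
  also have "\<dots> = (N * u x) * partial j S (partial k S v) x + partial j S (\<lambda>y. N * u y) x * partial k S v x"
    by (intro smooth_partial_mult[OF S x] smooth_on_mult smooth_on_const smooth_on_partial S u v)
  also have "partial j S (\<lambda>y. N * u y) x = N * partial j S u x"
    by (rule partial_bounded_linear[OF S x bounded_linear_mult_right smooth_on_imp_differentiable[OF u x]])
  finally show "hessian S h u j k x = N * u x * hessian S h v j k x + N\<^sup>2 * u x * (partial j S v x * partial k S v x)"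
    unfolding hessian_def p[OF x] by (simp add: sum_distrib_left algebra_simps power2_eq_square)
  show "gradient_sq S h u x = N\<^sup>2 * (u x)\<^sup>2 * gradient_sq S h v x"
    unfolding gradient_sq_def gradient_def p[OF x] by (simp add: sum_distrib_left mult_ac power2_eq_square)
qed

text \<open>The estimate at one point. The error is at most \<open>N * u x * (C1 + C2)\<close>,
  because \<open>1 \<le> N * u x\<close> lets the bound for the background Schouten tensor take the
  same factor. The admissible error \<delta> \<beta> m has one more factor N.\<close>

lemma conformal_eigenvalues_in_cone:
  fixes h :: "real^'n::finite \<Rightarrow> real^'n^'n" and \<Gamma> :: "(real^'n) set" and N \<delta> :: real
  assumes n: "CARD('n) \<ge> 3" and h: "metric_on S h" and v: "smooth_on S v" and x: "x \<in> S"
    and margin: "\<And>p m \<alpha> \<beta> r. \<lbrakk>\<And>i. 0 \<le> p i; (\<Sum>i\<in>UNIV. p i) = m; 0 < m; 0 < \<beta>; \<beta> \<le> \<alpha>; \<And>i. \<bar>r i\<bar> \<le> \<delta> * \<beta> * m\<rbrakk>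
      \<Longrightarrow> (\<chi> i. \<alpha> * (m / 2 - p i) + \<beta> * p i + r i) \<in> \<Gamma>"
    and C1: "\<And>w. \<bar>w \<bullet> (hessian_matrix S h v x *v w)\<bar> \<le> C1 * (w \<bullet> (h x *v w))"
    and C2: "\<And>w. \<bar>w \<bullet> (schouten S h x *v w)\<bar> \<le> C2 * (w \<bullet> (h x *v w))"
    and m: "0 < m" "m \<le> gradient_sq S h v x" and vx: "0 \<le> v x"
    and N: "1 \<le> N" "C1 + C2 \<le> N * (\<delta> * m)" and \<delta>: "0 < \<delta>" and C2_nonneg: "0 \<le> C2"
  defines "u \<equiv> \<lambda>x. exp (N * v x)"
  shows "\<exists>w\<in>\<Gamma>. eigenvalue_vector (matrix_inv (h x) ** - schouten S (\<lambda>x. exp (2 * u x) *\<^sub>R h x) x) w"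
proof -
  note S = metric_onD(1)[OF h]
  have u: "smooth_on S u" unfolding u_def by (intro smooth_on_exp smooth_on_mult smooth_on_const S v)
  let ?B = "- schouten S (\<lambda>x. exp (2 * u x) *\<^sub>R h x) x" and ?d = "grad_on S v x"
  let ?M = "gradient_sq S h v x"
  define \<alpha> where "\<alpha> = N\<^sup>2 * (u x)\<^sup>2"
  define \<beta> where "\<beta> = N\<^sup>2 * u x"
  \<comment> \<open>Here nonnegativity of \<open>v\<close> is used; it yields both \<beta> \<le>
    \<alpha> and \<open>1 \<le> N * u x\<close>.\<close>
  have u1: "1 \<le> u x" using vx N by (simp add: u_def)
  have B: "?B = (N * u x) *\<^sub>R hessian_matrix S h v x - schouten S h x
      + (\<beta> - \<alpha>) *\<^sub>R (\<chi> j k. ?d $ j * ?d $ k) + (\<alpha> * ?M / 2) *\<^sub>R h x"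
  proof -
    have D: "partial i S u x = N * u x * partial i S v x"
      "hessian S h u j k x = N * u x * hessian S h v j k x + N\<^sup>2 * u x * (partial j S v x * partial k S v x)"
      "gradient_sq S h u x = N\<^sup>2 * (u x)\<^sup>2 * gradient_sq S h v x" for i j k
      unfolding u_def by (rule exp_derivatives[OF h v x])+
    show ?thesis
      by (simp add: vec_eq_iff schouten_conformal[OF n h u x] D hessian_matrix_def grad_on_def \<alpha>_def \<beta>_def)
        (simp add: algebra_simps power2_eq_square)
  qed
  have sym: "transpose ?B = ?B"
    using transpose_schouten[OF metric_on_conformal[OF h u] x] by (simp add: transpose_def vec_eq_iff)
  obtain e :: "'n \<Rightarrow> real^'n" where e: "\<And>i. e i \<bullet> (h x *v e i) = 1"
    "eigenvalue_vector (matrix_inv (h x) ** ?B) (\<chi> i. e i \<bullet> (?B *v e i))"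
    "\<And>d. (\<Sum>i\<in>UNIV. (d \<bullet> e i)\<^sup>2) = d \<bullet> (matrix_inv (h x) *v d)"
    by (rule orthonormal_frame_eigenvalues[OF metric_onD(3)[OF h x] metric_onD(4)[OF h x] sym]) blast+
  define r where "r i = (N * u x) * (e i \<bullet> (hessian_matrix S h v x *v e i)) - e i \<bullet> (schouten S h x *v e i)" for i
  have dd: "w \<bullet> ((\<chi> j k. ?d $ j * ?d $ k) *v w) = (?d \<bullet> w)\<^sup>2" for w
  proof -
    have "(\<chi> j k. ?d $ j * ?d $ k) *v w = (?d \<bullet> w) *\<^sub>R ?d"
      by (simp add: vec_eq_iff matrix_vector_mult_def inner_vec_def sum_distrib_left mult_ac)
    then show ?thesis by (simp add: power2_eq_square inner_commute)
  qed
  have val: "e i \<bullet> (?B *v e i) = \<alpha> * (?M / 2 - (?d \<bullet> e i)\<^sup>2) + \<beta> * (?d \<bullet> e i)\<^sup>2 + r i" for i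
    unfolding B by (simp add: matrix_vector_mult_add_rdistrib matrix_vector_mult_diff_rdistrib
        scaleR_matrix_vector_assoc[symmetric] inner_add_right inner_diff_right dd e(1) r_def)
      (simp add: algebra_simps)
  have "(\<chi> i. \<alpha> * (?M / 2 - (?d \<bullet> e i)\<^sup>2) + \<beta> * (?d \<bullet> e i)\<^sup>2 + r i) \<in> \<Gamma>"
  proof (rule margin)
    show "(\<Sum>i\<in>UNIV. (?d \<bullet> e i)\<^sup>2) = ?M" unfolding e(3) gradient_sq_inner ..
    show "0 < ?M" using m by linarith
    show "0 < \<beta>" using N u1 by (simp add: \<beta>_def)
    have "u x * 1 \<le> u x * u x" using u1 by (intro mult_left_mono) auto
    then show "\<beta> \<le> \<alpha>" unfolding \<alpha>_def \<beta>_def power2_eq_square[of "u x"] by (intro mult_left_mono) auto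
    show "\<bar>r i\<bar> \<le> \<delta> * \<beta> * ?M" for i
    proof -
      have Nu: "1 \<le> N * u x" using N(1) u1 mult_mono[of 1 N 1 "u x"] by simp
      have "\<bar>r i\<bar> \<le> (N * u x) * \<bar>e i \<bullet> (hessian_matrix S h v x *v e i)\<bar> + \<bar>e i \<bullet> (schouten S h x *v e i)\<bar>"
        unfolding r_def using N(1) u1 by (intro order_trans[OF abs_triangle_ineq4]) (simp add: abs_mult)
      also have "\<dots> \<le> (N * u x) * C1 + C2"
        using C1[of "e i"] C2[of "e i"] Nu by (intro add_mono mult_left_mono) (auto simp: e(1))
      also have "\<dots> \<le> (N * u x) * C1 + (N * u x) * C2"
        using mult_right_mono[OF Nu C2_nonneg] by simp
      also have "\<dots> = (N * u x) * (C1 + C2)" by (simp add: distrib_left)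
      also have "\<dots> \<le> (N * u x) * (N * (\<delta> * m))" using N(2) Nu by (intro mult_left_mono) auto
      also have "\<dots> = \<delta> * \<beta> * m" by (simp add: \<beta>_def power2_eq_square mult_ac)
      also have "\<dots> \<le> \<delta> * \<beta> * ?M" using m \<delta> \<open>0 < \<beta>\<close> by (intro mult_left_mono) auto
      finally show ?thesis .
    qed
  qed simp
  then show ?thesis using e(2) unfolding val by blast
qed

context smooth_manifold
begin

section \<open>From coordinate estimates to the manifold\<close>

lemma metric_on_chart:
  assumes "riemannian_metric \<A> g" "c \<in> \<A>"
  shows "metric_on (img c) (\<lambda>x. g c (param c x))"
proof -
  have "smooth_on (img c) (g c \<circ> param c)"
    using assms unfolding riemannian_metric_def smooth_tensor2_def by blast
  moreover have "\<forall>p\<in>fst c. transpose (g c p) = g c p \<and> (\<forall>v. v \<noteq> 0 \<longrightarrow> v \<bullet> (g c p *v v) > 0)"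
    using assms unfolding riemannian_metric_def by blast
  ultimately show ?thesis
    unfolding metric_on_def comp_def using chart_domain[OF assms(2)] param_in by blast
qed

lemma schouten_tensor_chart:
  "schouten_tensor g c p = schouten (img c) (\<lambda>x. g c (param c x)) (snd c p)"
  by (simp add: schouten_tensor_def split_beta comp_def)

text \<open>Both tensors transform by the Jacobian, so the endomorphism
  \<open>matrix_inv (g c p) ** B c p\<close> is conjugated by it and keeps its characteristic
  polynomial. This passes from the chart of the estimate to all charts.\<close>

lemma eigenvalues_in_chart:
  assumes g: "riemannian_metric \<A> g" and u: "smooth_function \<A> u" and c: "c \<in> \<A>" "p \<in> fst c"
    and ev: "\<exists>v\<in>\<Gamma>. eigenvalue_vector (matrix_inv (g c p) ** - schouten_tensor (conformal u g) c p) v"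
  shows "eigenvalues_in \<A> g (- schouten_tensor (conformal u g)) \<Gamma> p"
  unfolding eigenvalues_in_def
proof (intro ballI impI)
  fix d assume d: "d \<in> \<A>" "p \<in> fst d"
  let ?S = "snd d ` (fst d \<inter> fst c)" and ?f = "\<lambda>x. snd c (param d x)" and ?x = "snd d p"
  let ?h = "\<lambda>c x. exp (2 * u (param c x)) *\<^sub>R g c (param c x)"
  have h: "metric_on (img c) (?h c)" if "c \<in> \<A>" for c
    by (rule metric_on_conformal[OF metric_on_chart[OF g that] smooth_functionD[OF u that]])
  have S: "smooth_domain ?S" by (intro overlap_domain openin_Int chart_open c d) auto
  have x: "?x \<in> ?S" using c d by blast
  have sub: "?S \<subseteq> img d" by blast
  let ?J = "jacobian_on ?S ?f"
  have tens: "g d q = transpose (?J (snd d q)) ** g c q ** ?J (snd d q)" if "q \<in> fst d \<inter> fst c" for q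
  proof -
    have J: "jacobian (transition d c) (at (snd d q) within ?S) = ?J (snd d q)"
      by (simp add: vec_eq_iff jacobian_on_def partial_def jacobian_def matrix_def transition_def split_beta comp_def)
    have "\<forall>c\<in>\<A>. \<forall>d\<in>\<A>. \<forall>p\<in>fst c \<inter> fst d. g c p =
        transpose (jacobian (transition c d) (at (snd c p) within snd c ` (fst c \<inter> fst d))) ** g d p **
        jacobian (transition c d) (at (snd c p) within snd c ` (fst c \<inter> fst d))"
      using g unfolding riemannian_metric_def smooth_tensor2_def Let_def by blast
    from this[rule_format, OF d(1) c(1) that] show ?thesis unfolding J .
  qed
  have scale: "a *\<^sub>R (A ** B ** C) = A ** (a *\<^sub>R B) ** C" for a and A B C :: "real^'n^'n"
    by (simp add: matrix_scalar_ac scalar_matrix_assoc)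
  \<comment> \<open>The conformal factor has the same value in both charts, so the transformation
    law of \<open>g\<close> passes to the conformal metric.\<close>
  interpret iso: isometry_on ?S "img c" "?h d" "?h c" ?f
  proof
    show "metric_on ?S (?h d)"
      using h[OF d(1)] S sub smooth_on_subset[OF chart_domain[OF d(1)] S sub] unfolding metric_on_def by blast
    show "metric_on (img c) (?h c)" by (rule h[OF c(1)])
    show "smooth_on ?S ?f" by (rule transition_smooth[OF d(1) c(1)])
    show "?f ` ?S \<subseteq> img c" using param_chart[OF d(1)] by auto
    fix y assume "y \<in> ?S"
    then obtain q where q: "q \<in> fst d \<inter> fst c" "y = snd d q" by blast
    then have "param d y = q" "param c (?f y) = q" using param_chart[OF d(1)] param_chart[OF c(1)] by auto
    then show "?h d y = transpose (?J y) ** ?h c (?f y) ** ?J y"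
      using tens[OF q(1)] q(2) by (simp add: scale)
  qed
  let ?K = "matrix_inv (?J ?x)" and ?B = "\<lambda>c. - schouten_tensor (conformal u g) c p"
  have fx: "?f ?x = snd c p" using param_chart[OF d] by simp
  have "schouten (img d) (?h d) ?x = transpose (?J ?x) ** schouten (img c) (?h c) (snd c p) ** ?J ?x"
    using schouten_subset[OF h[OF d(1)] S sub x] iso.schouten_transform[OF x] fx by simp
  then have "?B d = - (transpose (?J ?x) ** schouten (img c) (?h c) (snd c p) ** ?J ?x)"
    by (simp add: schouten_tensor_chart conformal_def)
  also have "\<dots> = transpose (?J ?x) ** ?B c ** ?J ?x"
    using scale[of "-1"] by (simp add: schouten_tensor_chart conformal_def)
  finally have Bd: "?B d = transpose (?J ?x) ** ?B c ** ?J ?x" .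
  have gd: "g d p = transpose (?J ?x) ** g c p ** ?J ?x" using tens[of p] c d by blast
  have inv: "matrix_inv (g c p) ** g c p = mat 1" "g c p ** matrix_inv (g c p) = mat 1"
    using metric_on_inv[OF metric_on_chart[OF g c(1)], of "snd c p"] c param_chart[OF c] by auto
  have invd: "matrix_inv (g d p) ** g d p = mat 1"
    using metric_on_inv[OF metric_on_chart[OF g d(1)], of ?x] d param_chart[OF d] by auto
  have "g d p ** (?K ** (matrix_inv (g c p) ** ?B c) ** ?J ?x) =
      transpose (?J ?x) ** (g c p ** ((?J ?x ** ?K) ** (matrix_inv (g c p) ** ?B c))) ** ?J ?x"
    unfolding gd by (simp only: matrix_mul_assoc)
  also have "\<dots> = transpose (?J ?x) ** ((g c p ** matrix_inv (g c p)) ** ?B c) ** ?J ?x"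
    unfolding iso.J_inv(1)[OF x] by (simp only: matrix_mul_assoc matrix_mul_lid)
  also have "\<dots> = ?B d" unfolding inv Bd by simp
  finally have "matrix_inv (g d p) ** (g d p ** (?K ** (matrix_inv (g c p) ** ?B c) ** ?J ?x)) = matrix_inv (g d p) ** ?B d"
    by simp
  then have Md: "matrix_inv (g d p) ** ?B d = ?K ** (matrix_inv (g c p) ** ?B c) ** ?J ?x"
    unfolding matrix_mul_assoc invd by simp
  have sim: "(matrix_inv (g d p) ** ?B d) ** ?K = ?K ** (matrix_inv (g c p) ** ?B c)"
    unfolding Md using iso.J_inv(1)[OF x] by (simp add: matrix_mul_assoc[symmetric])
  have "det ?K \<noteq> 0" using arg_cong[OF iso.J_inv(1)[OF x], of det] by (auto simp: det_mul)
  from eigenvalue_vector_similar[OF sim this] ev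
  show "\<exists>v\<in>\<Gamma>. eigenvalue_vector (matrix_inv (g d p) ** (- schouten_tensor (conformal u g)) d p) v"
    unfolding fun_Compl_def by blast
qed

lemma smooth_function_bounded_below:
  assumes "compact_space X" and u: "smooth_function \<A> u"
  obtains b where "\<And>p. p \<in> topspace X \<Longrightarrow> b \<le> u p"
proof -
  obtain F where F: "finite F" "\<And>c a r. (c, a, r) \<in> F \<Longrightarrow> coordinate_ball c a r"
    "\<And>p. p \<in> topspace X \<Longrightarrow> \<exists>(c, a, r)\<in>F. p \<in> fst c \<and> snd c p \<in> cball a r"
    by (rule finite_coordinate_cover[OF assms(1)]) blast
  have "\<exists>b. \<forall>p. (case d of (c, a, r) \<Rightarrow> p \<in> fst c \<and> snd c p \<in> cball a r) \<longrightarrow> b \<le> u p" if d: "d \<in> F" for d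
  proof -
    obtain c a r where dd: "d = (c, a, r)" by (cases d)
    have c: "c \<in> \<A>" and K: "compact (cball a r \<inter> img c)"
      using F(2)[of c a r] d dd by (auto simp: coordinate_ball_def)
    have "continuous_on (cball a r \<inter> img c) (\<lambda>x. u (param c x))"
      using smooth_on_imp_continuous_on[OF smooth_functionD[OF u c]] continuous_on_subset by blast
    then have "bounded ((\<lambda>x. u (param c x)) ` (cball a r \<inter> img c))"
      using K compact_continuous_image compact_imp_bounded by blast
    then obtain B where B: "\<And>x. x \<in> cball a r \<inter> img c \<Longrightarrow> \<bar>u (param c x)\<bar> \<le> B"
      unfolding bounded_iff by (metis imageI real_norm_def)
    have "- B \<le> u p" if "p \<in> fst c" "snd c p \<in> cball a r" for p
      using B[of "snd c p"] that param_chart[OF c that(1)] by force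
    then show ?thesis unfolding dd by auto
  qed
  then obtain b where b: "\<And>c a r p. (c, a, r) \<in> F \<Longrightarrow> p \<in> fst c \<Longrightarrow> snd c p \<in> cball a r \<Longrightarrow> b (c, a, r) \<le> u p"
    by (metis (mono_tags, lifting) case_prodI)
  show thesis
  proof (rule that[of "Min (insert 0 (b ` F))"])
    fix p assume "p \<in> topspace X"
    then obtain c a r where d: "(c, a, r) \<in> F" "p \<in> fst c" "snd c p \<in> cball a r" using F(3)[of p] by auto
    have "Min (insert 0 (b ` F)) \<le> b (c, a, r)" using F(1) d(1) by (intro Min_le) auto
    then show "Min (insert 0 (b ` F)) \<le> u p" using b[OF d] by linarith
  qed
qed

text \<open>Compactness of the ball makes the constants \<open>C1\<close> and \<open>C2\<close>
  uniform and, as \<open>v\<close> has no critical points, bounds \<open>gradient_sq\<close> below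
  by a positive \<open>m\<close>. One N then serves all points of the ball.\<close>

lemma coordinate_ball_threshold:
  fixes \<Gamma> :: "(real^'n) set"
  assumes n: "CARD('n) \<ge> 3" and g: "riemannian_metric \<A> g" and ball: "coordinate_ball c a r"
    and v: "smooth_function \<A> v" "\<And>p. p \<in> topspace X \<Longrightarrow> \<not> critical v p" "\<And>p. p \<in> topspace X \<Longrightarrow> 0 \<le> v p"
    and \<delta>: "0 < \<delta>"
    and margin: "\<And>p m \<alpha> \<beta> r. \<lbrakk>\<And>i. 0 \<le> p i; (\<Sum>i\<in>UNIV. p i) = m; 0 < m; 0 < \<beta>; \<beta> \<le> \<alpha>; \<And>i. \<bar>r i\<bar> \<le> \<delta> * \<beta> * m\<rbrakk>
      \<Longrightarrow> (\<chi> i. \<alpha> * (m / 2 - p i) + \<beta> * p i + r i) \<in> \<Gamma>"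
  shows "\<exists>N0. \<forall>N\<ge>N0. \<forall>p. p \<in> fst c \<and> snd c p \<in> cball a r \<longrightarrow>
    eigenvalues_in \<A> g (- schouten_tensor (conformal (\<lambda>p. exp (N * v p)) g)) \<Gamma> p"
proof -
  have c: "c \<in> \<A>" and K: "compact (cball a r \<inter> img c)" using ball by (auto simp: coordinate_ball_def)
  let ?S = "img c" and ?K = "cball a r \<inter> img c" and ?h = "\<lambda>x. g c (param c x)" and ?v = "\<lambda>x. v (param c x)"
  note S = chart_domain[OF c] and h = metric_on_chart[OF g c] and sv = smooth_functionD[OF v(1) c]
  have cont: "continuous_on ?K f" if "smooth_on ?S f" for f :: "real^'n \<Rightarrow> 'b::real_normed_vector"
    using smooth_on_imp_continuous_on[OF that] continuous_on_subset by blast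
  have pos: "0 < w \<bullet> (?h x *v w)" if "x \<in> ?K" "w \<noteq> 0" for x w
    using metric_onD(4)[OF h] that by blast
  obtain C1 where C1: "0 \<le> C1" "\<And>x w. x \<in> ?K \<Longrightarrow> \<bar>w \<bullet> (hessian_matrix ?S ?h ?v x *v w)\<bar> \<le> C1 * (w \<bullet> (?h x *v w))"
    using quadratic_form_bound[OF K cont[OF smooth_on_hessian_matrix[OF h sv]] cont[OF metric_onD(2)[OF h]] pos] by metis
  obtain C2 where C2: "0 \<le> C2" "\<And>x w. x \<in> ?K \<Longrightarrow> \<bar>w \<bullet> (schouten ?S ?h x *v w)\<bar> \<le> C2 * (w \<bullet> (?h x *v w))"
    using quadratic_form_bound[OF K cont[OF smooth_on_schouten[OF h]] cont[OF metric_onD(2)[OF h]] pos] by metis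
  have mpos: "0 < gradient_sq ?S ?h ?v x" if x: "x \<in> ?K" for x
  proof (rule gradient_sq_pos[OF h])
    show "x \<in> ?S" using x by simp
    have "param c x \<in> fst c" "snd c (param c x) = x" using x param_in chart_param by auto
    then show "grad_on ?S ?v x \<noteq> 0"
      using v(2) chart_subset[OF c] critical_iff[OF v(1) c] by (metis subsetD)
  qed
  obtain m where m: "0 < m" "\<And>x. x \<in> ?K \<Longrightarrow> m \<le> gradient_sq ?S ?h ?v x"
  proof (cases "?K = {}")
    case True
    then show ?thesis using that[of 1] by auto
  next
    case False
    have "smooth_on ?S (gradient_sq ?S ?h ?v)" unfolding gradient_sq_def[abs_def]
      by (intro smooth_on_sum smooth_on_mult smooth_on_partial smooth_on_gradient S h sv)
    from continuous_attains_inf[OF K False cont[OF this]]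
    obtain y where "y \<in> ?K" "\<And>x. x \<in> ?K \<Longrightarrow> gradient_sq ?S ?h ?v y \<le> gradient_sq ?S ?h ?v x" by blast
    then show ?thesis using that[of "gradient_sq ?S ?h ?v y"] mpos by blast
  qed
  \<comment> \<open>The second entry ensures \<open>C1 + C2 \<le> N * (\<delta> * m)\<close>, so
    that the errors stay within the margin of the cone.\<close>
  define N0 where "N0 = max 1 ((C1 + C2) / (\<delta> * m))"
  have "eigenvalues_in \<A> g (- schouten_tensor (conformal (\<lambda>p. exp (N * v p)) g)) \<Gamma> p"
    if N: "N0 \<le> N" and p: "p \<in> fst c" "snd c p \<in> cball a r" for N p
  proof (rule eigenvalues_in_chart[OF g _ c p(1)])
    show "smooth_function \<A> (\<lambda>p. exp (N * v p))"
      by (rule smooth_functionI) (intro smooth_on_exp smooth_on_mult smooth_on_const chart_domain smooth_functionD v(1))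
    have x: "snd c p \<in> ?S" "snd c p \<in> ?K" using p by auto
    have N1: "1 \<le> N" using N by (simp add: N0_def)
    have "(C1 + C2) / (\<delta> * m) \<le> N" using N by (simp add: N0_def)
    then have N2: "C1 + C2 \<le> N * (\<delta> * m)" using \<delta> m(1) by (simp add: divide_le_eq)
    have "0 \<le> ?v (snd c p)" using v(3) p(1) chart_subset[OF c] param_chart[OF c p(1)] by auto
    from conformal_eigenvalues_in_cone[OF n h sv x(1) margin C1(2)[OF x(2)] C2(2)[OF x(2)] m(1) m(2)[OF x(2)] this N1 N2 \<delta> C2(1)]
    show "\<exists>w\<in>\<Gamma>. eigenvalue_vector (matrix_inv (g c p) ** - schouten_tensor (conformal (\<lambda>p. exp (N * v p)) g) c p) w"
      by (simp add: schouten_tensor_chart conformal_def param_chart[OF c p(1)])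
  qed
  then show ?thesis by blast
qed

lemma conformal_metric_exists:
  fixes \<Gamma> :: "(real^'n) set"
  assumes n: "CARD('n) \<ge> 3" and X: "compact_space X" "connected_space X" "manifold_boundary \<A> \<noteq> {}"
    and g: "riemannian_metric \<A> g"
    and \<Gamma>: "open_cone \<Gamma>" "symmetric_set \<Gamma>" "convex \<Gamma>" "positive_cone \<subseteq> \<Gamma>" "is_varrho \<Gamma> \<rho>"
    and \<rho>: "2 < \<rho> \<or> (type2_cone \<Gamma> \<and> 2 \<le> \<rho>)"
  shows "\<exists>u. smooth_function \<A> u \<and>
    (\<forall>p\<in>topspace X. eigenvalues_in \<A> g (- schouten_tensor (conformal u g)) \<Gamma> p)"
proof -
  obtain \<delta> where \<delta>: "0 < \<delta>" and
    margin: "\<And>p m \<alpha> \<beta> r. \<lbrakk>\<And>i. 0 \<le> p i; (\<Sum>i\<in>UNIV. p i) = m; 0 < m; 0 < \<beta>; \<beta> \<le> \<alpha>; \<And>i. \<bar>r i\<bar> \<le> \<delta> * \<beta> * m\<rbrakk>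
      \<Longrightarrow> (\<chi> i. \<alpha> * (m / 2 - p i) + \<beta> * p i + r i) \<in> \<Gamma>"
    by (rule cone_margin[OF \<Gamma> \<rho>]) blast
  obtain v0 where v0: "smooth_function \<A> v0" "\<And>p. p \<in> topspace X \<Longrightarrow> \<not> critical v0 p"
    by (rule noncritical_exists[OF X]) blast
  obtain b where b: "\<And>p. p \<in> topspace X \<Longrightarrow> b \<le> v0 p"
    by (rule smooth_function_bounded_below[OF X(1) v0(1)]) blast
  \<comment> \<open>Subtracting a lower bound makes the function nonnegative and leaves its
    differential unchanged.\<close>
  define v where "v p = v0 p + (- b)" for p
  have v: "smooth_function \<A> v" unfolding v_def[abs_def] by (intro smooth_function_add smooth_function_const v0(1))
  have vpos: "0 \<le> v p" if "p \<in> topspace X" for p using b[OF that] by (simp add: v_def)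
  have vcrit: "\<not> critical v p" if "p \<in> topspace X" for p
  proof -
    obtain c where c: "c \<in> \<A>" "p \<in> fst c" using chart_exists[OF \<open>p \<in> topspace X\<close>] by blast
    have x: "snd c p \<in> img c" using c by blast
    have "partial i (img c) (\<lambda>x. v0 (param c x) + (- b)) (snd c p) = partial i (img c) (\<lambda>x. v0 (param c x)) (snd c p)" for i
      using smooth_partial_add[OF chart_domain[OF c(1)] x smooth_functionD[OF v0(1) c(1)] x
            smooth_on_const[OF chart_domain[OF c(1)]] x, of i "- b"] partial_const[OF chart_domain[OF c(1)] x]
      by simp
    then have "grad_on (img c) (\<lambda>x. v (param c x)) (snd c p) = grad_on (img c) (\<lambda>x. v0 (param c x)) (snd c p)"
      unfolding grad_on_def v_def by presburger
    then show ?thesis using v0(2)[OF \<open>p \<in> topspace X\<close>] critical_iff[OF v c] critical_iff[OF v0(1) c] by simp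
  qed
  obtain F where F: "finite F" "\<And>c a r. (c, a, r) \<in> F \<Longrightarrow> coordinate_ball c a r"
    "\<And>p. p \<in> topspace X \<Longrightarrow> \<exists>(c, a, r)\<in>F. p \<in> fst c \<and> snd c p \<in> cball a r"
    by (rule finite_coordinate_cover[OF X(1)]) blast
  let ?ok = "\<lambda>N p. eigenvalues_in \<A> g (- schouten_tensor (conformal (\<lambda>p. exp (N * v p)) g)) \<Gamma> p"
  have "\<exists>N0. \<forall>N\<ge>N0. \<forall>p. p \<in> fst (fst d) \<and> snd (fst d) p \<in> cball (fst (snd d)) (snd (snd d)) \<longrightarrow> ?ok N p"
    if d: "d \<in> F" for d
    by (rule coordinate_ball_threshold[OF n g F(2) v vcrit vpos \<delta> margin]) (use d in auto)
  then obtain T where T: "\<And>d N p. d \<in> F \<Longrightarrow> T d \<le> N \<Longrightarrow> p \<in> fst (fst d) \<Longrightarrow>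
      snd (fst d) p \<in> cball (fst (snd d)) (snd (snd d)) \<Longrightarrow> ?ok N p"
    by metis
  \<comment> \<open>The thresholds of the finitely many balls are met simultaneously; the 0 keeps
    the maximum defined for an empty cover.\<close>
  define N where "N = Max (insert 0 (T ` F))"
  have "?ok N p" if "p \<in> topspace X" for p
  proof -
    obtain d where d: "d \<in> F" "p \<in> fst (fst d)" "snd (fst d) p \<in> cball (fst (snd d)) (snd (snd d))"
      using F(3)[OF \<open>p \<in> topspace X\<close>] by (auto simp: split_beta)
    have "T d \<le> N" unfolding N_def using F(1) d(1) by (intro Max_ge) auto
    from T[OF d(1) this d(2,3)] show ?thesis .
  qed
  moreover have "smooth_function \<A> (\<lambda>p. exp (N * v p))"
    by (rule smooth_functionI) (intro smooth_on_exp smooth_on_mult smooth_on_const chart_domain smooth_functionD v)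
  ultimately show ?thesis by blast
qed

end

theorem theorem1p4:
  fixes X :: "'a topology"
    and \<A> :: "('a, 'n::finite) chart set"
    and g :: "('a, 'n) tensor2"
    and \<Gamma> :: "(real^'n) set"
    and \<rho> :: real
  assumes "CARD('n) \<ge> 3"
    and "smooth_manifold_with_boundary X \<A>"
    and "compact_space X" and "connected_space X"
    and "manifold_boundary \<A> \<noteq> {}"
    and "riemannian_metric \<A> g"
    and "open_cone \<Gamma>" and "symmetric_set \<Gamma>" and "convex \<Gamma>"
    and "frontier \<Gamma> \<noteq> {}"
    and "positive_cone \<subseteq> \<Gamma>"
    and "is_varrho \<Gamma> \<rho>"
  shows "(\<rho> > 2 \<longrightarrow>
      (\<exists>u. smooth_function \<A> u \<and>
        (\<forall>p\<in>topspace X. eigenvalues_in \<A> g (- schouten_tensor (conformal u g)) \<Gamma> p)))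
    \<and> (type2_cone \<Gamma> \<and> \<rho> \<ge> 2 \<longrightarrow>
      (\<exists>u. smooth_function \<A> u \<and>
        (\<forall>p\<in>topspace X. eigenvalues_in \<A> g (- schouten_tensor (conformal u g)) \<Gamma> p)))"
proof -
  interpret smooth_manifold X \<A> by (rule smooth_manifold.intro) (rule assms(2))
  have "\<exists>u. smooth_function \<A> u \<and>
      (\<forall>p\<in>topspace X. eigenvalues_in \<A> g (- schouten_tensor (conformal u g)) \<Gamma> p)"
    if "2 < \<rho> \<or> (type2_cone \<Gamma> \<and> 2 \<le> \<rho>)"
    using that by (rule conformal_metric_exists[OF assms(1,3-9,11,12)])
  then show ?thesis by blast
qed

end
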